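(* For all $n\geq 2$, the comparison map \[ c: H^3_{c,b}(\mathrm{Isom}^+(\mathbb{H}^n);\mathbb{R})\to H_c^3(\mathrm{Isom}^+(\mathbb{H}^n);\mathbb{R}) \] is injective.
   Context: $\mathrm{Isom}^+(\mathbb{H}^n)$ is the group of orientation preserving isometries of real hyperbolic $n$-space. For a locally compact second countable group $H$, $H_c^*(H;\mathbb{R})$ (continuous cohomology) and $H_{c,b}^*(H;\mathbb{R})$ (continuous bounded cohomology), with trivial real coefficients, are the cohomologies of the complexes of $H$-invariant (for the diagonal left action) cochains $H^{p+1}\to\mathbb{R}$ that are respectively continuous and continuous bounded, with the standard homogeneous differential $d\alpha(h_0,\dots,h_{p+1})=\sum_i(-1)^i\alpha(h_0,\dots,\hat h_i,\dots,h_{p+1})$. The comparison map is the map induced by the inclusion of continuous bounded cochains into continuous cochains. *)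

theory Defs
  imports "HOL-Analysis.Analysis" "HOL-Algebra.Algebra"
begin

section \<open>Continuous and continuous bounded cohomology\<close>

text \<open>
  Throughout, \<open>G\<close> is a group and \<open>T\<close> a topology with underlying set the carrier of \<open>G\<close>.
  A tuple \<open>(h\<^sub>0, \<dots>, h\<^sub>p)\<close> is an extensional function on \<open>{..p}\<close>, and a cochain an
  extensional real function on tuples.
\<close>

definition tuples :: "('g, 'b) monoid_scheme \<Rightarrow> nat \<Rightarrow> (nat \<Rightarrow> 'g) set" where
  "tuples G p = {..p} \<rightarrow>\<^sub>E carrier G"

definition diagonal_act :: "('g, 'b) monoid_scheme \<Rightarrow> nat \<Rightarrow> 'g \<Rightarrow> (nat \<Rightarrow> 'g) \<Rightarrow> (nat \<Rightarrow> 'g)" where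
  "diagonal_act G p g h = (\<lambda>i\<in>{..p}. g \<otimes>\<^bsub>G\<^esub> h i)"

definition continuous_cochains ::
    "('g, 'b) monoid_scheme \<Rightarrow> 'g topology \<Rightarrow> nat \<Rightarrow> ((nat \<Rightarrow> 'g) \<Rightarrow> real) set" where
  "continuous_cochains G T p =
     {\<alpha> \<in> extensional (tuples G p).
        continuous_map (product_topology (\<lambda>_. T) {..p}) euclideanreal \<alpha> \<and>
        (\<forall>g\<in>carrier G. \<forall>h\<in>tuples G p. \<alpha> (diagonal_act G p g h) = \<alpha> h)}"

definition bounded_continuous_cochains ::
    "('g, 'b) monoid_scheme \<Rightarrow> 'g topology \<Rightarrow> nat \<Rightarrow> ((nat \<Rightarrow> 'g) \<Rightarrow> real) set" where
  "bounded_continuous_cochains G T p =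
     {\<alpha> \<in> continuous_cochains G T p. bounded (\<alpha> ` tuples G p)}"

text \<open>The additive group of all cochains, written as a HOL-Algebra (multiplicative) monoid.\<close>

definition cochain_monoid :: "('g, 'b) monoid_scheme \<Rightarrow> nat \<Rightarrow> ((nat \<Rightarrow> 'g) \<Rightarrow> real) monoid" where
  "cochain_monoid G p =
     \<lparr>carrier = extensional (tuples G p),
      mult = (\<lambda>\<alpha> \<beta>. \<lambda>h\<in>tuples G p. \<alpha> h + \<beta> h),
      one = (\<lambda>h\<in>tuples G p. 0)\<rparr>"

text \<open>The face \<open>omit p i h\<close> is \<open>(h\<^sub>0, \<dots>, h\<^sub>p\<^sub>+\<^sub>1)\<close> with \<open>h\<^sub>i\<close> left out.\<close>

definition omit :: "nat \<Rightarrow> nat \<Rightarrow> (nat \<Rightarrow> 'g) \<Rightarrow> (nat \<Rightarrow> 'g)" where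
  "omit p i h = (\<lambda>j\<in>{..p}. h (if j < i then j else Suc j))"

definition cobd ::
    "('g, 'b) monoid_scheme \<Rightarrow> nat \<Rightarrow> ((nat \<Rightarrow> 'g) \<Rightarrow> real) \<Rightarrow> ((nat \<Rightarrow> 'g) \<Rightarrow> real)" where
  "cobd G p \<alpha> = (\<lambda>h\<in>tuples G (Suc p). \<Sum>i\<le>Suc p. (-1) ^ i * \<alpha> (omit p i h))"

text \<open>Cohomology of the subcomplex of cochains lying in \<open>C p\<close> in each degree \<open>p\<close>.\<close>

definition cocycles ::
    "('g, 'b) monoid_scheme \<Rightarrow> (nat \<Rightarrow> ((nat \<Rightarrow> 'g) \<Rightarrow> real) set) \<Rightarrow> nat \<Rightarrow> ((nat \<Rightarrow> 'g) \<Rightarrow> real) set" where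
  "cocycles G C p = {\<alpha> \<in> C p. cobd G p \<alpha> = \<one>\<^bsub>cochain_monoid G (Suc p)\<^esub>}"

definition coboundaries ::
    "('g, 'b) monoid_scheme \<Rightarrow> (nat \<Rightarrow> ((nat \<Rightarrow> 'g) \<Rightarrow> real) set) \<Rightarrow> nat \<Rightarrow> ((nat \<Rightarrow> 'g) \<Rightarrow> real) set" where
  "coboundaries G C p = (case p of 0 \<Rightarrow> {\<one>\<^bsub>cochain_monoid G 0\<^esub>} | Suc q \<Rightarrow> cobd G q ` C q)"

definition cohomology_group ::
    "('g, 'b) monoid_scheme \<Rightarrow> (nat \<Rightarrow> ((nat \<Rightarrow> 'g) \<Rightarrow> real) set) \<Rightarrow> nat \<Rightarrow>
       ((nat \<Rightarrow> 'g) \<Rightarrow> real) set monoid" where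
  "cohomology_group G C p =
     (cochain_monoid G p)\<lparr>carrier := cocycles G C p\<rparr> Mod coboundaries G C p"

definition continuous_cohomology ::
    "('g, 'b) monoid_scheme \<Rightarrow> 'g topology \<Rightarrow> nat \<Rightarrow> ((nat \<Rightarrow> 'g) \<Rightarrow> real) set monoid" where
  "continuous_cohomology G T = cohomology_group G (continuous_cochains G T)"

definition bounded_continuous_cohomology ::
    "('g, 'b) monoid_scheme \<Rightarrow> 'g topology \<Rightarrow> nat \<Rightarrow> ((nat \<Rightarrow> 'g) \<Rightarrow> real) set monoid" where
  "bounded_continuous_cohomology G T = cohomology_group G (bounded_continuous_cochains G T)"

text \<open>
  A class is a coset \<open>A\<close> of bounded coboundaries; its image is the coset of continuous
  coboundaries through any (equivalently, the union of those through all) representatives.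
  See \<open>comparison_map_coset\<close> below.
\<close>

definition comparison_map ::
    "('g, 'b) monoid_scheme \<Rightarrow> 'g topology \<Rightarrow> nat \<Rightarrow>
       ((nat \<Rightarrow> 'g) \<Rightarrow> real) set \<Rightarrow> ((nat \<Rightarrow> 'g) \<Rightarrow> real) set" where
  "comparison_map G T p A =
     (\<Union>\<alpha>\<in>A. coboundaries G (continuous_cochains G T) p #>\<^bsub>cochain_monoid G p\<^esub> \<alpha>)"


section \<open>Orientation preserving isometries of hyperbolic space\<close>

text \<open>
  Hyperbolic space of dimension \<open>n = CARD('n)\<close> is the Poincare ball model, with the distance
  function of the metric of constant curvature \<open>-1\<close>.
\<close>

definition hyperbolic_space :: "(real ^ 'n::finite) set" where
  "hyperbolic_space = ball 0 1"

definition hyperbolic_dist :: "real ^ 'n::finite \<Rightarrow> real ^ 'n \<Rightarrow> real" where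
  "hyperbolic_dist x y =
     arcosh (1 + 2 * (norm (x - y))\<^sup>2 / ((1 - (norm x)\<^sup>2) * (1 - (norm y)\<^sup>2)))"

definition hyperbolic_isometries :: "(real ^ 'n::finite \<Rightarrow> real ^ 'n) set" where
  "hyperbolic_isometries =
     {f \<in> Bij hyperbolic_space.
        \<forall>x\<in>hyperbolic_space. \<forall>y\<in>hyperbolic_space.
          hyperbolic_dist (f x) (f y) = hyperbolic_dist x y}"

text \<open>
  The ball is an open subset of Euclidean space, so preserving orientation means that the
  Jacobian determinant is positive everywhere. Demanding differentiability is harmless:
  isometries of hyperbolic space are smooth.
\<close>

definition orientation_preserving :: "(real ^ 'n::finite \<Rightarrow> real ^ 'n) \<Rightarrow> bool" where
  "orientation_preserving f \<longleftrightarrow>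
     (\<forall>x\<in>hyperbolic_space. \<exists>f'. (f has_derivative f') (at x) \<and> 0 < det (matrix f'))"

definition Isom_plus :: "(real ^ 'n::finite \<Rightarrow> real ^ 'n) monoid" where
  "Isom_plus = (BijGroup hyperbolic_space)
     \<lparr>carrier := {f \<in> hyperbolic_isometries. orientation_preserving f}\<rparr>"

text \<open>
  The compact-open topology. The hyperbolic distance induces the Euclidean topology on the
  ball, so compactness and openness may be taken there.
\<close>

definition Isom_plus_topology :: "(real ^ 'n::finite \<Rightarrow> real ^ 'n) topology" where
  "Isom_plus_topology = topology_generated_by
     {{f \<in> carrier Isom_plus. f ` K \<subseteq> U} | K U.
        compact K \<and> K \<subseteq> hyperbolic_space \<and> open U \<and> U \<subseteq> hyperbolic_space}"


section \<open>Consistency of the definitions\<close>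

lemma cochain_monoid_comm_group: "comm_group (cochain_monoid G p)"
proof (rule comm_groupI)
  fix \<alpha> assume "\<alpha> \<in> carrier (cochain_monoid G p)"
  then show "\<exists>\<beta>\<in>carrier (cochain_monoid G p). \<beta> \<otimes>\<^bsub>cochain_monoid G p\<^esub> \<alpha> = \<one>\<^bsub>cochain_monoid G p\<^esub>"
    by (intro bexI[of _ "\<lambda>h\<in>tuples G p. - \<alpha> h"]) (auto simp: cochain_monoid_def)
qed (auto simp: cochain_monoid_def extensional_def fun_eq_iff restrict_def)

lemma omit_tuples: "h \<in> tuples G (Suc p) \<Longrightarrow> omit p i h \<in> tuples G p"
  by (auto simp: omit_def tuples_def PiE_iff)

lemma omit_omit: "i \<le> j \<Longrightarrow> omit p j (omit (Suc p) i h) = omit p i (omit (Suc p) (Suc j) h)"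
  by (auto simp: omit_def restrict_def fun_eq_iff)

lemma omit_diagonal_act:
  "omit p i (diagonal_act G (Suc p) g h) = diagonal_act G p g (omit p i h)"
  by (auto simp: omit_def diagonal_act_def restrict_def fun_eq_iff)

lemma diagonal_act_tuples:
  assumes "group G" "g \<in> carrier G" "h \<in> tuples G p"
  shows "diagonal_act G p g h \<in> tuples G p"
proof -
  interpret group G by fact
  show ?thesis using assms by (auto simp: diagonal_act_def tuples_def PiE_iff)
qed

lemma cobd_cobd: "cobd G (Suc p) (cobd G p \<alpha>) = \<one>\<^bsub>cochain_monoid G (Suc (Suc p))\<^esub>"
proof -
  have "(\<Sum>i\<le>Suc (Suc p). (-1) ^ i * cobd G p \<alpha> (omit (Suc p) i h)) = 0"
    if h: "h \<in> tuples G (Suc (Suc p))" for h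
  proof -
    define F where "F = (\<lambda>(i, j). (-1) ^ (i + j) * \<alpha> (omit p j (omit (Suc p) i h)))"
    define S where "S = {..Suc (Suc p)} \<times> {..Suc p}"
    have "(\<Sum>i\<le>Suc (Suc p). (-1) ^ i * cobd G p \<alpha> (omit (Suc p) i h)) = sum F S"
      unfolding S_def F_def sum.cartesian_product[symmetric]
      by (intro sum.cong refl)
         (simp only: cobd_def restrict_apply' omit_tuples[OF h] sum_distrib_left power_add mult.assoc)
    also have "\<dots> = sum F {x \<in> S. fst x \<le> snd x} + sum F {x \<in> S. \<not> fst x \<le> snd x}"
      by (subst sum.union_disjoint[symmetric]) (auto simp: S_def intro!: sum.cong)
    also have "sum F {x \<in> S. fst x \<le> snd x} = - sum F {x \<in> S. \<not> fst x \<le> snd x}"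
      unfolding sum_negf[symmetric]
    proof (rule sum.reindex_bij_witness[where i = "\<lambda>(i, j). (j, i - 1)" and j = "\<lambda>(i, j). (Suc j, i)"])
      fix a assume "a \<in> {x \<in> S. fst x \<le> snd x}"
      then show "- F (case a of (i, j) \<Rightarrow> (Suc j, i)) = F a"
        by (auto simp: F_def omit_omit add.commute split: prod.splits)
    qed (auto simp: S_def)
    finally show ?thesis by simp
  qed
  then show ?thesis
    by (auto simp: cobd_def[of G "Suc p"] cochain_monoid_def fun_eq_iff restrict_def)
qed

lemma continuous_map_omit:
  "continuous_map (product_topology (\<lambda>_. T) {..Suc p}) (product_topology (\<lambda>_. T) {..p}) (omit p i)"
proof -
  have "continuous_map (product_topology (\<lambda>_. T) {..Suc p}) T (\<lambda>h. omit p i h k)" if "k \<le> p" for k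
    using that continuous_map_product_projection[of k "{..Suc p}" "\<lambda>_. T"]
      continuous_map_product_projection[of "Suc k" "{..Suc p}" "\<lambda>_. T"]
    by (cases "k < i") (simp_all add: omit_def)
  then show ?thesis
    by (subst continuous_map_componentwise) (auto simp: omit_def)
qed

lemma cobd_continuous_cochains:
  assumes G: "group G" and T: "topspace T = carrier G" and \<alpha>: "\<alpha> \<in> continuous_cochains G T p"
  shows "cobd G p \<alpha> \<in> continuous_cochains G T (Suc p)"
proof -
  have "continuous_map (product_topology (\<lambda>_. T) {..Suc p}) euclideanreal
          (\<lambda>h. \<Sum>i\<le>Suc p. (-1) ^ i * \<alpha> (omit p i h))"
    using \<alpha> unfolding continuous_cochains_def
    by (intro continuous_map_sum continuous_map_real_mult_left finite_atMost
          continuous_map_compose[OF continuous_map_omit, unfolded o_def]) auto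
  then have "continuous_map (product_topology (\<lambda>_. T) {..Suc p}) euclideanreal (cobd G p \<alpha>)"
    by (rule continuous_map_eq) (simp add: cobd_def tuples_def T)
  moreover have "cobd G p \<alpha> (diagonal_act G (Suc p) g h) = cobd G p \<alpha> h"
    if "g \<in> carrier G" "h \<in> tuples G (Suc p)" for g h
    using that \<alpha> omit_tuples[OF that(2)] diagonal_act_tuples[OF G that]
    by (auto simp: cobd_def omit_diagonal_act continuous_cochains_def intro!: sum.cong)
  ultimately show ?thesis
    by (auto simp: continuous_cochains_def cobd_def)
qed

lemma cobd_bounded_continuous_cochains:
  assumes G: "group G" and T: "topspace T = carrier G" and \<alpha>: "\<alpha> \<in> bounded_continuous_cochains G T p"
  shows "cobd G p \<alpha> \<in> bounded_continuous_cochains G T (Suc p)"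
proof -
  obtain B where B: "\<bar>\<alpha> h\<bar> \<le> B" if "h \<in> tuples G p" for h
    using \<alpha> by (auto simp: bounded_continuous_cochains_def bounded_iff)
  have "\<bar>cobd G p \<alpha> h\<bar> \<le> (\<Sum>i\<le>Suc p. B)" if "h \<in> tuples G (Suc p)" for h
    unfolding cobd_def restrict_apply'[OF that]
    by (rule order_trans[OF sum_abs sum_mono]) (use B omit_tuples[OF that] in \<open>auto simp: abs_mult power_abs\<close>)
  then show ?thesis
    using cobd_continuous_cochains[OF G T] \<alpha>
    unfolding bounded_continuous_cochains_def bounded_iff by fastforce
qed

definition cochain_subcomplex ::
    "('g, 'b) monoid_scheme \<Rightarrow> (nat \<Rightarrow> ((nat \<Rightarrow> 'g) \<Rightarrow> real) set) \<Rightarrow> bool" where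
  "cochain_subcomplex G C \<longleftrightarrow>
     (\<forall>p. subgroup (C p) (cochain_monoid G p) \<and> cobd G p ` C p \<subseteq> C (Suc p))"

lemma subgroup_cochain_monoidI:
  assumes "S \<subseteq> extensional (tuples G p)" "(\<lambda>h\<in>tuples G p. 0) \<in> S"
    and "\<And>\<alpha> \<beta>. \<alpha> \<in> S \<Longrightarrow> \<beta> \<in> S \<Longrightarrow> (\<lambda>h\<in>tuples G p. \<alpha> h - \<beta> h) \<in> S"
  shows "subgroup S (cochain_monoid G p)"
proof -
  interpret comm_group "cochain_monoid G p" by (rule cochain_monoid_comm_group)
  have inv: "inv\<^bsub>cochain_monoid G p\<^esub> \<alpha> = (\<lambda>h\<in>tuples G p. - \<alpha> h)" if "\<alpha> \<in> S" for \<alpha>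
    using that assms(1) by (intro inv_equality) (auto simp: cochain_monoid_def)
  have neg: "(\<lambda>h\<in>tuples G p. - \<alpha> h) \<in> S" if "\<alpha> \<in> S" for \<alpha>
    using assms(3)[OF assms(2) that] by (simp cong: restrict_cong)
  show ?thesis
  proof (rule subgroupI)
    fix \<alpha> \<beta> assume "\<alpha> \<in> S" "\<beta> \<in> S"
    then show "\<alpha> \<otimes>\<^bsub>cochain_monoid G p\<^esub> \<beta> \<in> S"
      using assms(3)[OF \<open>\<alpha> \<in> S\<close> neg[OF \<open>\<beta> \<in> S\<close>]] by (simp add: cochain_monoid_def cong: restrict_cong)
  qed (use assms inv neg in \<open>auto simp: cochain_monoid_def\<close>)
qed

lemma continuous_cochainsI:
  assumes G: "group G" and T: "topspace T = carrier G"
    and "continuous_map (product_topology (\<lambda>_. T) {..p}) euclideanreal f"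
    and "\<And>g h. g \<in> carrier G \<Longrightarrow> h \<in> tuples G p \<Longrightarrow> f (diagonal_act G p g h) = f h"
  shows "restrict f (tuples G p) \<in> continuous_cochains G T p"
proof -
  have "continuous_map (product_topology (\<lambda>_. T) {..p}) euclideanreal (restrict f (tuples G p))"
    by (rule continuous_map_eq[OF assms(3)]) (simp add: tuples_def T)
  then show ?thesis
    using assms(4) diagonal_act_tuples[OF G] by (simp add: continuous_cochains_def)
qed

lemma continuous_cochains_subcomplex:
  assumes G: "group G" and T: "topspace T = carrier G"
  shows "cochain_subcomplex G (continuous_cochains G T)"
proof -
  have "subgroup (continuous_cochains G T p) (cochain_monoid G p)" for p
  proof (rule subgroup_cochain_monoidI)
    show "(\<lambda>h\<in>tuples G p. 0) \<in> continuous_cochains G T p"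
      by (rule continuous_cochainsI[OF G T]) simp_all
    show "(\<lambda>h\<in>tuples G p. \<alpha> h - \<beta> h) \<in> continuous_cochains G T p"
      if "\<alpha> \<in> continuous_cochains G T p" "\<beta> \<in> continuous_cochains G T p" for \<alpha> \<beta>
      using that
      by (intro continuous_cochainsI[OF G T] continuous_map_diff) (simp_all add: continuous_cochains_def)
  qed (auto simp: continuous_cochains_def)
  then show ?thesis
    using cobd_continuous_cochains[OF G T] by (auto simp: cochain_subcomplex_def)
qed

lemma bounded_continuous_cochains_subcomplex:
  assumes G: "group G" and T: "topspace T = carrier G"
  shows "cochain_subcomplex G (bounded_continuous_cochains G T)"
proof -
  have "subgroup (bounded_continuous_cochains G T p) (cochain_monoid G p)" for p
  proof (rule subgroup_cochain_monoidI)
    have "(\<lambda>h\<in>tuples G p. 0) \<in> continuous_cochains G T p"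
      by (rule continuous_cochainsI[OF G T]) simp_all
    then show "(\<lambda>h\<in>tuples G p. 0) \<in> bounded_continuous_cochains G T p"
      by (auto simp: bounded_continuous_cochains_def bounded_iff)
    fix \<alpha> \<beta>
    assume ab: "\<alpha> \<in> bounded_continuous_cochains G T p" "\<beta> \<in> bounded_continuous_cochains G T p"
    then have "(\<lambda>h\<in>tuples G p. \<alpha> h - \<beta> h) \<in> continuous_cochains G T p"
      by (intro continuous_cochainsI[OF G T] continuous_map_diff)
         (simp_all add: continuous_cochains_def bounded_continuous_cochains_def)
    moreover have "bounded ((\<lambda>h. \<alpha> h - \<beta> h) ` tuples G p)"
      using ab by (intro bounded_minus_comp) (simp_all add: bounded_continuous_cochains_def)
    ultimately show "(\<lambda>h\<in>tuples G p. \<alpha> h - \<beta> h) \<in> bounded_continuous_cochains G T p"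
      by (simp add: bounded_continuous_cochains_def)
  qed (auto simp: bounded_continuous_cochains_def continuous_cochains_def)
  then show ?thesis
    using cobd_bounded_continuous_cochains[OF G T] by (auto simp: cochain_subcomplex_def)
qed

lemma cobd_hom: "cobd G p \<in> hom (cochain_monoid G p) (cochain_monoid G (Suc p))"
proof (rule homI)
  fix \<alpha> \<beta>
  show "cobd G p (\<alpha> \<otimes>\<^bsub>cochain_monoid G p\<^esub> \<beta>)
      = cobd G p \<alpha> \<otimes>\<^bsub>cochain_monoid G (Suc p)\<^esub> cobd G p \<beta>"
    using omit_tuples[of _ G p]
    by (auto simp: cobd_def cochain_monoid_def fun_eq_iff restrict_def algebra_simps
        simp flip: sum.distrib simp del: sum.atMost_Suc)
qed (auto simp: cochain_monoid_def cobd_def)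

lemma subgroup_cocycles:
  assumes "cochain_subcomplex G C"
  shows "subgroup (cocycles G C p) (cochain_monoid G p)"
proof -
  interpret group_hom "cochain_monoid G p" "cochain_monoid G (Suc p)" "cobd G p"
    by (intro group_hom.intro group_hom_axioms.intro cobd_hom
        comm_group.axioms(2) cochain_monoid_comm_group)
  have "cocycles G C p = C p \<inter> kernel (cochain_monoid G p) (cochain_monoid G (Suc p)) (cobd G p)"
    using assms by (auto simp: cocycles_def kernel_def cochain_subcomplex_def dest: subgroup.mem_carrier)
  moreover have "subgroup (C p) (cochain_monoid G p)"
    using assms by (simp add: cochain_subcomplex_def)
  ultimately show ?thesis
    using G.subgroups_Inter_pair subgroup_kernel by metis
qed

lemma subgroup_coboundaries:
  assumes "cochain_subcomplex G C"
  shows "subgroup (coboundaries G C p) (cochain_monoid G p)"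
proof (cases p)
  case 0
  interpret comm_group "cochain_monoid G 0" by (rule cochain_monoid_comm_group)
  show ?thesis using 0 triv_subgroup by (simp add: coboundaries_def)
next
  case (Suc q)
  interpret group_hom "cochain_monoid G q" "cochain_monoid G (Suc q)" "cobd G q"
    by (intro group_hom.intro group_hom_axioms.intro cobd_hom
        comm_group.axioms(2) cochain_monoid_comm_group)
  show ?thesis
    using assms Suc by (auto simp: coboundaries_def cochain_subcomplex_def intro!: subgroup_img_is_subgroup)
qed

lemma coboundaries_subset_cocycles:
  assumes "cochain_subcomplex G C"
  shows "coboundaries G C p \<subseteq> cocycles G C p"
proof (cases p)
  case 0
  then show ?thesis
    using subgroup.one_closed[OF subgroup_cocycles[OF assms, of 0]] by (simp add: coboundaries_def)
next
  case (Suc q)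
  then show ?thesis
    using assms cobd_cobd[of G q] by (auto simp: coboundaries_def cocycles_def cochain_subcomplex_def)
qed

lemma comm_group_cohomology_group:
  assumes "cochain_subcomplex G C"
  shows "comm_group (cohomology_group G C p)"
proof -
  interpret comm_group "cochain_monoid G p" by (rule cochain_monoid_comm_group)
  interpret Z: comm_group "(cochain_monoid G p)\<lparr>carrier := cocycles G C p\<rparr>"
    using subgroup_imp_group[OF subgroup_cocycles[OF assms]] subgroup.mem_carrier[OF subgroup_cocycles[OF assms]]
    by (intro group.group_comm_groupI) (auto intro: m_comm)
  show ?thesis
    unfolding cohomology_group_def
    by (intro Z.abelian_FactGroup subgroup_incl subgroup_cocycles subgroup_coboundaries
          coboundaries_subset_cocycles assms)
qed

lemma comparison_map_coset:
  assumes G: "group G" and T: "topspace T = carrier G"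
    and \<alpha>: "\<alpha> \<in> cocycles G (bounded_continuous_cochains G T) p"
  shows "comparison_map G T p
           (coboundaries G (bounded_continuous_cochains G T) p #>\<^bsub>cochain_monoid G p\<^esub> \<alpha>)
         = coboundaries G (continuous_cochains G T) p #>\<^bsub>cochain_monoid G p\<^esub> \<alpha>"
proof -
  interpret comm_group "cochain_monoid G p" by (rule cochain_monoid_comm_group)
  note sc = continuous_cochains_subcomplex[OF G T] and sb = bounded_continuous_cochains_subcomplex[OF G T]
  let ?Bc = "coboundaries G (continuous_cochains G T) p"
  let ?Bb = "coboundaries G (bounded_continuous_cochains G T) p"
  have sub: "?Bb \<subseteq> ?Bc"
    by (auto simp: coboundaries_def bounded_continuous_cochains_def split: nat.splits)
  have a: "\<alpha> \<in> carrier (cochain_monoid G p)"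
    using subgroup.mem_carrier[OF subgroup_cocycles[OF sb] \<alpha>] .
  have "?Bc #>\<^bsub>cochain_monoid G p\<^esub> \<beta> = ?Bc #>\<^bsub>cochain_monoid G p\<^esub> \<alpha>"
    if "\<beta> \<in> ?Bb #>\<^bsub>cochain_monoid G p\<^esub> \<alpha>" for \<beta>
  proof -
    have "\<beta> \<in> ?Bc #>\<^bsub>cochain_monoid G p\<^esub> \<alpha>" using that sub by (auto simp: r_coset_def)
    then show ?thesis
      using repr_independence[OF _ a subgroup_coboundaries[OF sc]] by simp
  qed
  moreover have "\<alpha> \<in> ?Bb #>\<^bsub>cochain_monoid G p\<^esub> \<alpha>"
    using rcos_self[OF a subgroup_coboundaries[OF sb]] .
  ultimately show ?thesis unfolding comparison_map_def by blast
qed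

lemma comparison_map_hom:
  assumes G: "group G" and T: "topspace T = carrier G"
  shows "comparison_map G T p \<in>
           hom (bounded_continuous_cohomology G T p) (continuous_cohomology G T p)"
proof -
  let ?Cc = "continuous_cochains G T" and ?Cb = "bounded_continuous_cochains G T"
  let ?M = "cochain_monoid G p"
  interpret comm_group ?M by (rule cochain_monoid_comm_group)
  note sc = continuous_cochains_subcomplex[OF G T] and sb = bounded_continuous_cochains_subcomplex[OF G T]
  have cos: "r_coset (?M\<lparr>carrier := S\<rparr>) = r_coset ?M" "set_mult (?M\<lparr>carrier := S\<rparr>) = set_mult ?M" for S
    by (auto simp: r_coset_def set_mult_def fun_eq_iff)
  have sub: "cocycles G ?Cb p \<subseteq> cocycles G ?Cc p"
    by (auto simp: cocycles_def bounded_continuous_cochains_def)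
  have car: "cocycles G ?Cb p \<subseteq> carrier ?M"
    using subgroup.subset[OF subgroup_cocycles[OF sb]] .
  have nc: "coboundaries G ?Cc p \<lhd> ?M" and nb: "coboundaries G ?Cb p \<lhd> ?M"
    using subgroup_imp_normal subgroup_coboundaries sc sb by blast+
  note cmp = comparison_map_coset[OF G T]
  show ?thesis
  proof (rule homI)
    fix A assume "A \<in> carrier (bounded_continuous_cohomology G T p)"
    then show "comparison_map G T p A \<in> carrier (continuous_cohomology G T p)"
      using sub by (auto simp: bounded_continuous_cohomology_def continuous_cohomology_def
          cohomology_group_def FactGroup_def RCOSETS_def cos cmp)
  next
    fix A B
    assume "A \<in> carrier (bounded_continuous_cohomology G T p)"
      "B \<in> carrier (bounded_continuous_cohomology G T p)"
    then obtain \<alpha> \<beta> where ab: "\<alpha> \<in> cocycles G ?Cb p" "\<beta> \<in> cocycles G ?Cb p"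
      and AB: "A = coboundaries G ?Cb p #>\<^bsub>?M\<^esub> \<alpha>" "B = coboundaries G ?Cb p #>\<^bsub>?M\<^esub> \<beta>"
      by (auto simp: bounded_continuous_cohomology_def
          cohomology_group_def FactGroup_def RCOSETS_def cos)
    have "\<alpha> \<otimes>\<^bsub>?M\<^esub> \<beta> \<in> cocycles G ?Cb p"
      using subgroup.m_closed[OF subgroup_cocycles[OF sb]] ab by blast
    then show "comparison_map G T p (A \<otimes>\<^bsub>bounded_continuous_cohomology G T p\<^esub> B)
        = comparison_map G T p A \<otimes>\<^bsub>continuous_cohomology G T p\<^esub> comparison_map G T p B"
      using ab car
      by (simp add: AB bounded_continuous_cohomology_def continuous_cohomology_def
          cohomology_group_def FactGroup_def cos cmp normal.rcos_sum[OF nb] normal.rcos_sum[OF nc]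
          subset_iff)
  qed
qed

lemma matrix_det_id: "det (matrix (\<lambda>x::real^'n::finite. x)) = 1"
  unfolding id_def[symmetric] matrix_id_mat_1 by simp

lemma orientation_preserving_cong:
  fixes f g :: "real ^ 'n::finite \<Rightarrow> real ^ 'n"
  assumes "\<And>x. x \<in> hyperbolic_space \<Longrightarrow> f x = g x" "orientation_preserving f"
  shows "orientation_preserving g"
  unfolding orientation_preserving_def
proof
  fix x :: "real^'n" assume x: "x \<in> hyperbolic_space"
  then obtain f' where f': "(f has_derivative f') (at x)" "0 < det (matrix f')"
    using assms(2) by (auto simp: orientation_preserving_def)
  have "(g has_derivative f') (at x)"
    by (rule has_derivative_transform_within_open[OF f'(1), of hyperbolic_space])
       (use x assms(1) in \<open>auto simp: hyperbolic_space_def\<close>)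
  with f' show "\<exists>f'. (g has_derivative f') (at x) \<and> 0 < det (matrix f')" by blast
qed

lemma subgroup_Isom_plus:
  "subgroup (carrier Isom_plus) (BijGroup (hyperbolic_space :: (real^'n::finite) set))"
proof -
  let ?H = "hyperbolic_space :: (real^'n) set"
  interpret group "BijGroup ?H" by (rule group_BijGroup)
  have opn: "open ?H" by (simp add: hyperbolic_space_def)
  have "(\<lambda>x\<in>?H. x) \<in> carrier Isom_plus"
  proof -
    have "orientation_preserving (\<lambda>x::real^'n. x)"
      by (auto simp: orientation_preserving_def matrix_det_id intro!: exI[of _ "\<lambda>x. x"] has_derivative_ident)
    then have "orientation_preserving (\<lambda>x\<in>?H. x)"
      by (rule orientation_preserving_cong[rotated]) auto
    then show ?thesis
      by (auto simp: Isom_plus_def hyperbolic_isometries_def id_Bij)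
  qed
  moreover have "restrict (inv_into ?H f) ?H \<in> carrier Isom_plus" if f: "f \<in> carrier Isom_plus" for f
  proof -
    let ?g = "inv_into ?H f"
    have bij: "bij_betw f ?H ?H" and fB: "f \<in> Bij ?H"
      and iso: "\<And>x y. x \<in> ?H \<Longrightarrow> y \<in> ?H \<Longrightarrow> hyperbolic_dist (f x) (f y) = hyperbolic_dist x y"
      and ori: "orientation_preserving f"
      using f by (auto simp: Isom_plus_def hyperbolic_isometries_def Bij_def)
    have g: "?g y \<in> ?H" "f (?g y) = y" if "y \<in> ?H" for y
      using bij that by (auto simp: bij_betw_def inv_into_into f_inv_into_f)
    obtain f' where f': "\<And>x. x \<in> ?H \<Longrightarrow> (f has_derivative f' x) (at x)"
      "\<And>x. x \<in> ?H \<Longrightarrow> 0 < det (matrix (f' x))"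
      using ori unfolding orientation_preserving_def by metis
    have "orientation_preserving ?g"
      unfolding orientation_preserving_def
    proof
      fix y assume y: "y \<in> ?H"
      let ?M = "matrix (f' (?g y))"
      have lin: "linear (f' (?g y))" using f'(1)[OF g(1)[OF y]] by (rule has_derivative_linear)
      have "invertible ?M" using f'(2)[OF g(1)[OF y]] by (simp add: invertible_det_nz)
      then obtain N where N: "?M ** N = mat 1" "N ** ?M = mat 1" by (auto simp: invertible_def)
      have "f' (?g y) \<circ> (*v) N = id"
        using N(1) fun_cong[OF matrix_vector_mul(2)[OF lin]]
        by (metis (no_types, lifting) comp_apply eq_id_iff matrix_vector_mul_assoc matrix_vector_mul_lid)
      then have "(?g has_derivative (*v) N) (at (f (?g y)))"
        using has_derivative_inverse_on[OF opn f'(1), where g = ?g and g' = "\<lambda>_. (*v) N" and x = "?g y"] g(1)[OF y]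
          bij by (auto simp: bij_betw_def)
      moreover have "0 < det N"
      proof -
        have "det ?M * det N = 1" using N(1) by (metis det_I det_mul)
        with f'(2)[OF g(1)[OF y]] show ?thesis
          by (metis zero_less_mult_pos zero_less_one)
      qed
      ultimately show "\<exists>g'. (?g has_derivative g') (at y) \<and> 0 < det (matrix g')"
        using g(2)[OF y] by (auto intro!: exI[of _ "(*v) N"])
    qed
    then have "orientation_preserving (restrict ?g ?H)"
      by (rule orientation_preserving_cong[rotated]) auto
    moreover have "hyperbolic_dist (?g x) (?g y) = hyperbolic_dist x y" if "x \<in> ?H" "y \<in> ?H" for x y
      using iso[OF g(1)[OF that(1)] g(1)[OF that(2)]] that by (simp add: g)
    ultimately show ?thesis
      using restrict_inv_into_Bij[OF fB] by (auto simp: Isom_plus_def hyperbolic_isometries_def)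
  qed
  moreover have "compose ?H f g \<in> carrier Isom_plus"
    if f: "f \<in> carrier Isom_plus" and g: "g \<in> carrier Isom_plus" for f g
  proof -
    have gH: "g x \<in> ?H" if "x \<in> ?H" for x
      using g that by (auto simp: Isom_plus_def hyperbolic_isometries_def Bij_def bij_betw_def)
    have "orientation_preserving (f \<circ> g)"
      unfolding orientation_preserving_def
    proof
      fix x assume x: "x \<in> ?H"
      obtain g' where g': "(g has_derivative g') (at x)" "0 < det (matrix g')"
        using g x by (auto simp: Isom_plus_def orientation_preserving_def)
      obtain f' where f': "(f has_derivative f') (at (g x))" "0 < det (matrix f')"
        using f gH[OF x] by (auto simp: Isom_plus_def orientation_preserving_def)
      have "0 < det (matrix (f' \<circ> g'))"
        using f' g' by (simp add: matrix_compose has_derivative_linear det_mul)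
      then show "\<exists>h'. (f \<circ> g has_derivative h') (at x) \<and> 0 < det (matrix h')"
        using diff_chain_at[OF g'(1) f'(1)] by blast
    qed
    then have "orientation_preserving (compose ?H f g)"
      by (rule orientation_preserving_cong[rotated]) (auto simp: compose_def)
    then show ?thesis
      using f g gH by (auto simp: Isom_plus_def hyperbolic_isometries_def compose_Bij compose_eq)
  qed
  moreover have sub: "carrier Isom_plus \<subseteq> Bij ?H"
    by (auto simp: Isom_plus_def hyperbolic_isometries_def)
  moreover have "inv\<^bsub>BijGroup ?H\<^esub> f = restrict (inv_into ?H f) ?H" if "f \<in> carrier Isom_plus" for f
    using sub that by (intro inv_BijGroup) blast
  moreover have "f \<otimes>\<^bsub>BijGroup ?H\<^esub> g = compose ?H f g"
    if "f \<in> carrier Isom_plus" "g \<in> carrier Isom_plus" for f g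
    using sub that by (simp add: BijGroup_def subset_iff)
  moreover have "carrier (BijGroup ?H) = Bij ?H" by (simp add: BijGroup_def)
  ultimately show ?thesis
    by (intro subgroupI) auto
qed

lemma group_Isom_plus: "group (Isom_plus :: (real^'n::finite \<Rightarrow> real^'n) monoid)"
proof -
  interpret group "BijGroup (hyperbolic_space :: (real^'n) set)" by (rule group_BijGroup)
  have "(Isom_plus :: (real^'n \<Rightarrow> real^'n) monoid) =
      (BijGroup hyperbolic_space)\<lparr>carrier := carrier Isom_plus\<rparr>"
    by (simp add: Isom_plus_def)
  then show ?thesis using subgroup_imp_group[OF subgroup_Isom_plus] by metis
qed

lemma topspace_Isom_plus_topology:
  "topspace (Isom_plus_topology :: (real^'n::finite \<Rightarrow> real^'n) topology) = carrier Isom_plus"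
proof -
  have "carrier Isom_plus \<in> {{f \<in> carrier Isom_plus. f ` K \<subseteq> U} | K U.
      compact K \<and> K \<subseteq> (hyperbolic_space :: (real^'n) set) \<and> open U \<and> U \<subseteq> hyperbolic_space}"
    by (auto intro!: exI[of _ "{}"])
  then show ?thesis
    unfolding Isom_plus_topology_def topology_generated_by_topspace by blast
qed

end

theory Submission
  imports Defs
begin

text \<open>
  Injectivity in degree three says that a bounded continuous cocycle \<open>\<alpha>\<close> with a continuous
  primitive \<open>\<beta>\<close> has a bounded continuous one. The primitive may be changed by any \<open>d\<gamma>\<close>, so the
  task is to find a continuous invariant \<open>\<gamma>\<close> on pairs for which \<open>\<beta> + d\<gamma>\<close> is bounded, knowing
  only that \<open>d\<beta>\<close> is bounded; such a \<open>\<beta>\<close> is called a quasi-cocycle below.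

  The first reduction averages \<open>\<beta>\<close> in each variable over the point stabilizer \<open>SO(n)\<close>, which turns
  it into a quasi-cocycle \<open>f\<close> on triples of points of hyperbolic space. The prism
  operator shows that \<open>f\<close> and \<open>\<beta>\<close> differ by a coboundary and a bounded term
  (\<open>average_homotopic\<close>). The average is von Neumann's mean of a continuous function on a compact
  group, the only constant that averages of finitely many of its translates approach uniformly.

  The second reduction makes \<open>f\<close> alternating. Some isometry swaps any two given points, so
  \<open>f x y x\<close> is a symmetric function of \<open>x\<close> and \<open>y\<close>; subtracting the coboundary of half of it leaves
  a function that alternates up to a bounded error (\<open>normalized_quasi_alternating\<close>), and the
  honest alternation of that differs from it by a bounded amount.

  What remains is the heart of the matter: an alternating invariant continuous quasi-cocycle \<open>A\<close> on
  hyperbolic space is bounded (\<open>alternating_quasi_cocycle.bounded\<close>). It is bounded on triangles of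
  bounded size by compactness and transitivity. On a geodesic it is a quasi-cocycle on the real
  line which is also invariant under reflections, and an amenability argument bounds it there
  (\<open>line_cochain.bounded\<close>). For triangles with one short side, the isosceles case carries
  the idea: doubling the angle at the apex doubles \<open>A\<close> up to a bounded error, but sliding the base
  towards the apex undoes the growth of the base and changes \<open>A\<close> only by a bounded amount; so \<open>2|A|\<close>
  is at most a constant more than the value of \<open>|A|\<close> at a smaller triangle of the same kind
  (\<open>short_isosceles_bounded\<close>). Finally geodesic triangles are
  thin: some point on one side is close to both other sides, and it cuts the triangle into
  three pieces, each of them degenerate up to triangles with a short side.
\<close>

section \<open>Means on a compact group\<close>

text \<open>
  A compact metrizable group on a carrier set, so that it applies to groups of matrices.
\<close>

locale compact_group =
  fixes K :: "'a::metric_space set"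
    and mul :: "'a \<Rightarrow> 'a \<Rightarrow> 'a" (infixl "\<cdot>" 70)
    and e :: 'a and iv :: "'a \<Rightarrow> 'a"
  assumes compact_K: "compact K"
    and e_in: "e \<in> K"
    and mul_in: "x \<in> K \<Longrightarrow> y \<in> K \<Longrightarrow> x \<cdot> y \<in> K"
    and inv_in: "x \<in> K \<Longrightarrow> iv x \<in> K"
    and mul_assoc: "x \<in> K \<Longrightarrow> y \<in> K \<Longrightarrow> z \<in> K \<Longrightarrow> x \<cdot> y \<cdot> z = x \<cdot> (y \<cdot> z)"
    and e_mul: "x \<in> K \<Longrightarrow> e \<cdot> x = x"
    and mul_e: "x \<in> K \<Longrightarrow> x \<cdot> e = x"
    and inv_mul: "x \<in> K \<Longrightarrow> iv x \<cdot> x = e"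
    and mul_inv: "x \<in> K \<Longrightarrow> x \<cdot> iv x = e"
    and continuous_mul: "continuous_on (K \<times> K) (\<lambda>(x, y). x \<cdot> y)"
    and continuous_inv: "continuous_on K iv"
begin

definition lavg :: "'a list \<Rightarrow> ('a \<Rightarrow> real) \<Rightarrow> 'a \<Rightarrow> real" where
  "lavg ks f x = (\<Sum>k\<leftarrow>ks. f (k \<cdot> x)) / length ks"

definition ravg :: "'a list \<Rightarrow> ('a \<Rightarrow> real) \<Rightarrow> 'a \<Rightarrow> real" where
  "ravg ks f x = (\<Sum>k\<leftarrow>ks. f (x \<cdot> k)) / length ks"

definition family :: "'a list \<Rightarrow> bool" where
  "family ks \<longleftrightarrow> ks \<noteq> [] \<and> set ks \<subseteq> K"

text \<open>
  A mean is a constant to which averages of left translates come uniformly close. Uniqueness comes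
  from right translates: left and right averages commute, so any left constant equals any right one.
\<close>

definition is_mean :: "('a \<Rightarrow> real) \<Rightarrow> real \<Rightarrow> bool" where
  "is_mean f c \<longleftrightarrow> (\<forall>\<epsilon>>0. \<exists>ks. family ks \<and> (\<forall>x\<in>K. \<bar>lavg ks f x - c\<bar> \<le> \<epsilon>))"

definition mean :: "('a \<Rightarrow> real) \<Rightarrow> real" where
  "mean f = (THE c. is_mean f c)"

lemma list_avg_le:
  fixes g :: "'b \<Rightarrow> real"
  assumes "ks \<noteq> []" "\<And>k. k \<in> set ks \<Longrightarrow> g k \<le> c"
  shows "(\<Sum>k\<leftarrow>ks. g k) / length ks \<le> c"
proof -
  have "(\<Sum>k\<leftarrow>ks. g k) \<le> (\<Sum>k\<leftarrow>ks. c)" using assms(2) by (intro sum_list_mono) auto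
  then show ?thesis using assms(1) by (simp add: sum_list_triv field_simps)
qed

lemma list_avg_near:
  fixes g :: "'b \<Rightarrow> real"
  assumes "ks \<noteq> []" "\<And>k. k \<in> set ks \<Longrightarrow> \<bar>g k - c\<bar> \<le> \<epsilon>"
  shows "\<bar>(\<Sum>k\<leftarrow>ks. g k) / length ks - c\<bar> \<le> \<epsilon>"
proof -
  have "g k \<le> c + \<epsilon>" "- g k \<le> - c + \<epsilon>" if "k \<in> set ks" for k
    using assms(2)[OF that] by auto
  then have "(\<Sum>k\<leftarrow>ks. g k) / length ks \<le> c + \<epsilon>" "(\<Sum>k\<leftarrow>ks. - g k) / length ks \<le> - c + \<epsilon>"
    by (intro list_avg_le[OF assms(1)]; auto)+
  moreover have "(\<Sum>k\<leftarrow>ks. - g k) = - (\<Sum>k\<leftarrow>ks. g k)" by (induction ks) auto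
  ultimately show ?thesis by (simp add: abs_le_iff)
qed

lemma lavg_near:
  assumes "family ks" "x \<in> K" "\<And>y. y \<in> K \<Longrightarrow> \<bar>f y - c\<bar> \<le> \<epsilon>"
  shows "\<bar>lavg ks f x - c\<bar> \<le> \<epsilon>"
  unfolding lavg_def using assms by (intro list_avg_near) (auto simp: family_def mul_in subset_iff)

lemma ravg_near:
  assumes "family ks" "x \<in> K" "\<And>y. y \<in> K \<Longrightarrow> \<bar>f y - c\<bar> \<le> \<epsilon>"
  shows "\<bar>ravg ks f x - c\<bar> \<le> \<epsilon>"
  unfolding ravg_def using assms by (intro list_avg_near) (auto simp: family_def mul_in subset_iff)

definition family_mult :: "'a list \<Rightarrow> 'a list \<Rightarrow> 'a list" where
  "family_mult ks ls = concat (map (\<lambda>l. map (\<lambda>k. k \<cdot> l) ks) ls)"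

lemma family_mult: "family ks \<Longrightarrow> family ls \<Longrightarrow> family (family_mult ks ls)"
  by (auto simp: family_def family_mult_def mul_in subset_iff)

lemma lavg_lavg:
  assumes "family ks" "family ls" "x \<in> K"
  shows "lavg ls (lavg ks f) x = lavg (family_mult ks ls) f x"
proof -
  have len: "length (family_mult ks ls) = length ks * length ls"
    by (induction ls) (auto simp: family_mult_def)
  have "(\<Sum>m\<leftarrow>family_mult ks ls. f (m \<cdot> x)) = (\<Sum>l\<leftarrow>ls. \<Sum>k\<leftarrow>ks. f (k \<cdot> l \<cdot> x))"
    unfolding family_mult_def by (induction ls) (simp_all add: o_def)
  also have "\<dots> = (\<Sum>l\<leftarrow>ls. \<Sum>k\<leftarrow>ks. f (k \<cdot> (l \<cdot> x)))"
    using assms by (intro arg_cong[where f = sum_list] map_cong refl)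
      (simp add: family_def mul_assoc subset_iff)
  moreover have "(\<Sum>l\<leftarrow>ls. (\<Sum>k\<leftarrow>ks. f (k \<cdot> (l \<cdot> x))) / length ks)
       = (\<Sum>l\<leftarrow>ls. \<Sum>k\<leftarrow>ks. f (k \<cdot> (l \<cdot> x))) / length ks"
    by (induction ls) (auto simp: add_divide_distrib)
  ultimately show ?thesis unfolding lavg_def len by (simp add: field_simps)
qed

lemma lavg_ravg:
  assumes "family ks" "family ls" "x \<in> K"
  shows "lavg ks (ravg ls f) x = ravg ls (lavg ks f) x"
proof -
  have "(\<Sum>k\<leftarrow>ks. (\<Sum>l\<leftarrow>ls. f (k \<cdot> x \<cdot> l)) / length ls) = (\<Sum>l\<leftarrow>ls. (\<Sum>k\<leftarrow>ks. f (k \<cdot> x \<cdot> l))) / length ls"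
    by (induction ks) (auto simp: add_divide_distrib sum_list_addf)
  moreover have "(\<Sum>l\<leftarrow>ls. (\<Sum>k\<leftarrow>ks. f (k \<cdot> x \<cdot> l)) / length ks) = (\<Sum>l\<leftarrow>ls. (\<Sum>k\<leftarrow>ks. f (k \<cdot> x \<cdot> l))) / length ks"
    by (induction ls) (auto simp: add_divide_distrib)
  moreover have "(\<Sum>l\<leftarrow>ls. (\<Sum>k\<leftarrow>ks. f (k \<cdot> (x \<cdot> l))) / length ks) = (\<Sum>l\<leftarrow>ls. (\<Sum>k\<leftarrow>ks. f (k \<cdot> x \<cdot> l)) / length ks)"
    using assms by (intro arg_cong[where f = sum_list] map_cong refl arg_cong2[where f = "(/)"])
      (simp add: family_def mul_assoc subset_iff)
  ultimately show ?thesis unfolding lavg_def ravg_def by (simp add: field_simps)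
qed

lemma lavg_add: "lavg ks (\<lambda>x. f x + g x) x = lavg ks f x + lavg ks g x"
  by (simp add: lavg_def sum_list_addf add_divide_distrib)

lemma continuous_translate:
  assumes "k \<in> K"
  shows "continuous_on K (\<lambda>x. k \<cdot> x)"
  by (rule continuous_on_compose2[OF continuous_mul, of _ "\<lambda>x. (k, x)", simplified])
     (use assms in \<open>auto intro!: continuous_intros\<close>)

lemma continuous_lavg:
  assumes f: "continuous_on K f" and "family ks"
  shows "continuous_on K (lavg ks f)"
proof -
  have "continuous_on K (\<lambda>x. \<Sum>k\<leftarrow>ks. f (k \<cdot> x))"
    using \<open>family ks\<close>
  proof (induction ks)
    case (Cons k ks)
    then have k: "k \<in> K" and ks: "ks = [] \<or> family ks" by (auto simp: family_def)
    have "continuous_on K (\<lambda>x. f (k \<cdot> x))"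
      by (rule continuous_on_compose2[OF f continuous_translate[OF k]]) (use k mul_in in auto)
    then show ?case using Cons.IH ks by (auto intro!: continuous_intros)
  qed (auto simp: family_def)
  then show ?thesis
    unfolding lavg_def [abs_def] using assms(2)
    by (intro continuous_on_divide continuous_on_const) (auto simp: family_def)
qed

text \<open>
  Take the infimum \<open>s\<close> of the maxima of all left averages of \<open>f\<close>. An average \<open>F\<close> whose maximum is
  barely above \<open>s\<close> cannot dip much below \<open>s\<close> anywhere: the dip fills a ball of a size depending only
  on \<open>f\<close>, finitely many translates of that ball cover the group, and averaging \<open>F\<close> over those
  translates would push the maximum below \<open>s\<close>. Hence \<open>F\<close> is uniformly close to \<open>s\<close>.
\<close>

lemma is_mean_exists:
  assumes f: "continuous_on K f"
  shows "\<exists>c. is_mean f c"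
proof -
  define Mx where "Mx ks = Sup (lavg ks f ` K)" for ks
  define s where "s = Inf (Mx ` {ks. family ks})"
  have "bounded (f ` K)"
    using compact_continuous_image[OF f compact_K] compact_imp_bounded by blast
  then obtain B where B: "\<And>x. x \<in> K \<Longrightarrow> \<bar>f x\<bar> \<le> B" by (auto simp: bounded_iff)
  have lB: "\<bar>lavg ks f x\<bar> \<le> B" if "family ks" "x \<in> K" for ks x
    using lavg_near[OF that, of f 0 B] B by auto
  have le_Mx: "lavg ks f x \<le> Mx ks" if "family ks" "x \<in> K" for ks x
    unfolding Mx_def using lB that by (intro cSup_upper bdd_aboveI[where M = B]) fastforce+
  have Mx_le: "Mx ks \<le> c" if "family ks" "\<And>x. x \<in> K \<Longrightarrow> lavg ks f x \<le> c" for ks c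
    unfolding Mx_def using that e_in by (intro cSup_least) auto
  have bdd: "bdd_below (Mx ` {ks. family ks})"
  proof (rule bdd_belowI[where m = "-B"])
    fix y assume "y \<in> Mx ` {ks. family ks}"
    then show "-B \<le> y" using le_Mx e_in lB by (fastforce simp: abs_le_iff)
  qed
  have s_le: "s \<le> Mx ks" if "family ks" for ks
    unfolding s_def using that bdd by (intro cInf_lower) auto
  have "is_mean f s"
    unfolding is_mean_def
  proof (intro allI impI)
    fix \<epsilon> :: real assume \<epsilon>: "0 < \<epsilon>"
    \<comment> \<open>The modulus of continuity must not depend on the average under consideration; it is
      obtained for \<open>f (k \<cdot> (x \<cdot> (iv a \<cdot> y)))\<close> jointly in all four variables.\<close>
    let ?P = "K \<times> K \<times> K \<times> K"
    have c1: "continuous_on ?P (\<lambda>p. iv (fst (snd (snd p))) \<cdot> snd (snd (snd p)))"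
      by (rule continuous_on_compose2[OF continuous_mul, of _ "\<lambda>p. (iv (fst (snd (snd p))), snd (snd (snd p)))", simplified])
         (auto intro!: continuous_intros continuous_on_compose2[OF continuous_inv] simp: inv_in)
    have c2: "continuous_on ?P (\<lambda>p. fst (snd p) \<cdot> (iv (fst (snd (snd p))) \<cdot> snd (snd (snd p))))"
      by (rule continuous_on_compose2[OF continuous_mul, of _ "\<lambda>p. (fst (snd p), iv (fst (snd (snd p))) \<cdot> snd (snd (snd p)))", simplified])
         (auto intro!: continuous_intros c1 simp: inv_in mul_in)
    have c3: "continuous_on ?P (\<lambda>p. fst p \<cdot> (fst (snd p) \<cdot> (iv (fst (snd (snd p))) \<cdot> snd (snd (snd p)))))"
      by (rule continuous_on_compose2[OF continuous_mul, of _ "\<lambda>p. (fst p, fst (snd p) \<cdot> (iv (fst (snd (snd p))) \<cdot> snd (snd (snd p))))", simplified])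
         (auto intro!: continuous_intros c2 simp: inv_in mul_in)
    have "continuous_on ?P (\<lambda>p. f (fst p \<cdot> (fst (snd p) \<cdot> (iv (fst (snd (snd p))) \<cdot> snd (snd (snd p))))))"
      by (rule continuous_on_compose2[OF f c3]) (auto simp: inv_in mul_in)
    then have "uniformly_continuous_on ?P (\<lambda>p. f (fst p \<cdot> (fst (snd p) \<cdot> (iv (fst (snd (snd p))) \<cdot> snd (snd (snd p))))))"
      by (intro compact_uniformly_continuous compact_Times compact_K)
    then obtain d where d: "0 < d" and
      dd: "\<And>p q. p \<in> ?P \<Longrightarrow> q \<in> ?P \<Longrightarrow> dist q p < d \<Longrightarrow>
         dist (f (fst q \<cdot> (fst (snd q) \<cdot> (iv (fst (snd (snd q))) \<cdot> snd (snd (snd q))))))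
              (f (fst p \<cdot> (fst (snd p) \<cdot> (iv (fst (snd (snd p))) \<cdot> snd (snd (snd p)))))) < \<epsilon>/2"
      using \<epsilon> half_gt_zero[OF \<epsilon>] unfolding uniformly_continuous_on_def by meson
    have near: "f (k \<cdot> (x \<cdot> (iv a \<cdot> y))) < f (k \<cdot> x) + \<epsilon>/2"
      if "k \<in> K" "x \<in> K" "a \<in> K" "y \<in> K" "dist y a < d" for k x a y
      using dd[of "(k, x, a, a)" "(k, x, a, y)"] that
      by (simp add: dist_Pair_Pair inv_mul mul_e dist_real_def abs_if split: if_splits)
    obtain N where N: "finite N" "N \<subseteq> K" "K \<subseteq> (\<Union>a\<in>N. ball a d)"
      using compactE_image[OF compact_K, of K "\<lambda>a. ball a d"] d by (metis (no_types, lifting) UN_I centre_in_ball open_ball subsetI)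
    obtain as where as: "set as = N" using finite_list[OF N(1)] by blast
    have as_ne: "as \<noteq> []" using N(3) e_in as by auto
    define n where "n = real (length as)"
    have n: "1 \<le> n" using as_ne by (cases as) (auto simp: n_def)
    \<comment> \<open>One of the \<open>n\<close> translates is low by \<open>\<epsilon>/2\<close>, the others are high by at most \<open>\<eta>\<close>; this
      choice makes the gain win.\<close>
    define \<eta> where "\<eta> = \<epsilon> / (4 * n)"
    have \<eta>: "0 < \<eta>" "n * \<eta> = \<epsilon>/4" "\<eta> \<le> \<epsilon>" using n \<epsilon> by (auto simp: \<eta>_def field_simps)
    have "\<exists>v\<in>Mx ` {ks. family ks}. v < s + \<eta>"
    proof -
      have "[e] \<in> {ks. family ks}" by (auto simp: family_def e_in)
      then show ?thesis
        using \<eta>(1) unfolding s_def by (intro cInf_lessD) auto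
    qed
    then obtain ks where ks: "family ks" "Mx ks < s + \<eta>" by auto
    let ?F = "lavg ks f"
    have up: "?F x < s + \<eta>" if "x \<in> K" for x using le_Mx[OF ks(1) that] ks(2) by linarith
    have "s - \<epsilon> \<le> ?F x" if x: "x \<in> K" for x
    proof (rule ccontr)
      assume "\<not> s - \<epsilon> \<le> ?F x"
      then have low: "?F x < s - \<epsilon>" by simp
      define ls where "ls = map (\<lambda>a. x \<cdot> iv a) as"
      have ls: "family ls" using as_ne as N(2) x by (auto simp: ls_def family_def mul_in inv_in)
      have "lavg ls ?F y \<le> s - \<eta>" if y: "y \<in> K" for y
      proof -
        obtain a where a: "a \<in> N" "dist y a < d" using N(3) y by (auto simp: dist_commute)
        have aK: "a \<in> K" using a N by auto
        have "?F (x \<cdot> (iv a \<cdot> y)) \<le> (\<Sum>k\<leftarrow>ks. f (k \<cdot> x) + \<epsilon>/2) / length ks"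
          unfolding lavg_def using ks(1) near[OF _ x aK y a(2)]
          by (intro divide_right_mono sum_list_mono) (auto simp: family_def subset_iff intro: less_imp_le)
        also have "\<dots> = ?F x + \<epsilon>/2"
          using ks(1) by (auto simp: lavg_def sum_list_addf sum_list_triv add_divide_distrib family_def)
        finally have Fa: "?F (x \<cdot> iv a \<cdot> y) \<le> s - \<epsilon>/2"
          using low x aK y by (simp add: mul_assoc inv_in)
        have "(\<Sum>b\<leftarrow>as. ?F (x \<cdot> iv b \<cdot> y)) \<le> n * (s + \<eta>) - (\<eta> + \<epsilon>/2)"
        proof -
          have split: "(\<Sum>b\<leftarrow>bs. ?F (x \<cdot> iv b \<cdot> y)) \<le> length bs * (s + \<eta>)" if "set bs \<subseteq> K" for bs
          proof -
            have "(\<Sum>b\<leftarrow>bs. ?F (x \<cdot> iv b \<cdot> y)) \<le> (\<Sum>b\<leftarrow>bs. s + \<eta>)"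
              using that up x y by (intro sum_list_mono less_imp_le up) (auto simp: mul_in inv_in subset_iff)
            then show ?thesis by (simp add: sum_list_triv)
          qed
          obtain us vs where uv: "as = us @ a # vs" using a as by (metis split_list)
          have "set us \<subseteq> K" "set vs \<subseteq> K" using uv as N(2) by auto
          with split[of us] split[of vs] Fa show ?thesis
            by (simp add: uv n_def algebra_simps)
        qed
        then have "lavg ls ?F y \<le> (n * (s + \<eta>) - (\<eta> + \<epsilon>/2)) / n"
        proof -
          have "lavg ls ?F y = (\<Sum>b\<leftarrow>as. ?F (x \<cdot> iv b \<cdot> y)) / n"
            unfolding lavg_def[of _ "lavg ks f"] ls_def n_def length_map map_map o_def ..
          then show ?thesis using n \<open>_ \<le> n * (s + \<eta>) - (\<eta> + \<epsilon>/2)\<close> by (simp add: divide_right_mono)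
        qed
        also have "\<dots> \<le> s - \<eta>"
          using n \<eta> \<epsilon> by (simp add: field_simps)
        finally show ?thesis .
      qed
      then have "Mx (family_mult ks ls) \<le> s - \<eta>"
        using lavg_lavg[OF ks(1) ls, of _ f] by (intro Mx_le family_mult ks ls) auto
      with s_le[OF family_mult[OF ks(1) ls]] \<eta> show False by simp
    qed
    then show "\<exists>ks. family ks \<and> (\<forall>x\<in>K. \<bar>lavg ks f x - s\<bar> \<le> \<epsilon>)"
      using ks(1) up \<eta>(3) by (intro exI[of _ ks]) (force simp: abs_le_iff)
  qed
  then show ?thesis by blast
qed

lemma right_mean_exists:
  assumes f: "continuous_on K f"
  shows "\<exists>c. \<forall>\<epsilon>>0. \<exists>ks. family ks \<and> (\<forall>x\<in>K. \<bar>ravg ks f x - c\<bar> \<le> \<epsilon>)"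
proof -
  have inv_unique: "z = iv w" if z: "z \<in> K" and w: "w \<in> K" and zw: "z \<cdot> w = e" for z w
  proof -
    have "z = z \<cdot> w \<cdot> iv w" using z w by (simp add: mul_assoc inv_in mul_inv mul_e)
    then show ?thesis using w by (simp add: zw e_mul inv_in)
  qed
  have inv_inv: "iv (iv x) = x" if "x \<in> K" for x
    using inv_unique[of x "iv x"] that by (simp add: inv_in mul_inv)
  have inv_mult: "iv (x \<cdot> y) = iv y \<cdot> iv x" if x: "x \<in> K" and y: "y \<in> K" for x y
  proof -
    have "iv y \<cdot> iv x \<cdot> (x \<cdot> y) = iv y \<cdot> (iv x \<cdot> x \<cdot> y)"
      using x y by (simp only: mul_assoc inv_in mul_in)
    also have "\<dots> = e" using x y by (simp add: inv_mul e_mul)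
    finally show ?thesis
      using inv_unique[of "iv y \<cdot> iv x" "x \<cdot> y"] x y by (simp add: mul_in inv_in)
  qed
  have "continuous_on K (\<lambda>x. f (iv x))"
    by (rule continuous_on_compose2[OF f continuous_inv]) (auto simp: inv_in)
  then obtain c where c: "is_mean (\<lambda>x. f (iv x)) c" using is_mean_exists by blast
  have "\<exists>ks. family ks \<and> (\<forall>x\<in>K. \<bar>ravg ks f x - c\<bar> \<le> \<epsilon>)" if \<epsilon>: "0 < \<epsilon>" for \<epsilon>
  proof -
    obtain ks where ks: "family ks" "\<And>x. x \<in> K \<Longrightarrow> \<bar>lavg ks (\<lambda>x. f (iv x)) x - c\<bar> \<le> \<epsilon>"
      using c \<epsilon> unfolding is_mean_def by blast
    have "ravg (map iv ks) f x = lavg ks (\<lambda>x. f (iv x)) (iv x)" if "x \<in> K" for x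
    proof -
      have "map (\<lambda>k. f (x \<cdot> iv k)) ks = map (\<lambda>k. f (iv (k \<cdot> iv x))) ks"
        using ks(1) that by (intro map_cong refl) (simp add: family_def subset_iff inv_mult inv_in inv_inv)
      then show ?thesis unfolding ravg_def lavg_def length_map map_map o_def by (rule arg_cong[where f = "\<lambda>xs. sum_list xs / real (length ks)"])
    qed
    with ks inv_in show ?thesis
      by (intro exI[of _ "map iv ks"]) (auto simp: family_def)
  qed
  then show ?thesis by blast
qed

lemma left_right_mean:
  assumes "family ks" "family ls"
    and "\<And>x. x \<in> K \<Longrightarrow> \<bar>lavg ks f x - c\<bar> \<le> \<epsilon>" "\<And>x. x \<in> K \<Longrightarrow> \<bar>ravg ls f x - c'\<bar> \<le> \<epsilon>'"
  shows "\<bar>c - c'\<bar> \<le> \<epsilon> + \<epsilon>'"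
proof -
  have "\<bar>ravg ls (lavg ks f) e - c\<bar> \<le> \<epsilon>" by (rule ravg_near[OF assms(2) e_in assms(3)])
  moreover have "\<bar>lavg ks (ravg ls f) e - c'\<bar> \<le> \<epsilon>'" by (rule lavg_near[OF assms(1) e_in assms(4)])
  ultimately show ?thesis using lavg_ravg[OF assms(1,2) e_in, of f] by linarith
qed

lemma is_mean_unique:
  assumes f: "continuous_on K f" and "is_mean f c" "is_mean f d"
  shows "c = d"
proof -
  obtain r where r: "\<And>\<epsilon>. 0 < \<epsilon> \<Longrightarrow> \<exists>ks. family ks \<and> (\<forall>x\<in>K. \<bar>ravg ks f x - r\<bar> \<le> \<epsilon>)"
    using right_mean_exists[OF f] by blast
  have "b = r" if "is_mean f b" for b
  proof -
    have "\<bar>b - r\<bar> \<le> 0 + \<epsilon>" if \<epsilon>: "0 < \<epsilon>" for \<epsilon>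
    proof -
      obtain ks ls where "family ks" "family ls" "\<And>x. x \<in> K \<Longrightarrow> \<bar>lavg ks f x - b\<bar> \<le> \<epsilon>/2"
        "\<And>x. x \<in> K \<Longrightarrow> \<bar>ravg ls f x - r\<bar> \<le> \<epsilon>/2"
        using r[of "\<epsilon>/2"] \<open>is_mean f b\<close> half_gt_zero[OF \<epsilon>] unfolding is_mean_def by blast
      from left_right_mean[OF this] show ?thesis by simp
    qed
    then have "\<bar>b - r\<bar> \<le> 0" by (rule field_le_epsilon)
    then show ?thesis by simp
  qed
  from this[OF assms(2)] this[OF assms(3)] show ?thesis by simp
qed

lemma is_mean_mean:
  assumes f: "continuous_on K f"
  shows "is_mean f (mean f)"
proof -
  obtain c where c: "is_mean f c" using is_mean_exists[OF f] by blast
  show ?thesis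
    unfolding mean_def by (rule theI[where P = "is_mean f" and a = c, OF c]) (rule is_mean_unique[OF f _ c])
qed

lemma mean_eqI: "continuous_on K f \<Longrightarrow> is_mean f c \<Longrightarrow> mean f = c"
  by (rule is_mean_unique[OF _ is_mean_mean])

lemma lavg_cong: "family ks \<Longrightarrow> x \<in> K \<Longrightarrow> (\<And>y. y \<in> K \<Longrightarrow> f y = g y) \<Longrightarrow> lavg ks f x = lavg ks g x"
  unfolding lavg_def by (intro arg_cong2[where f = "(/)"] arg_cong[where f = sum_list] map_cong refl)
    (auto simp: family_def mul_in subset_iff)

lemma mean_cong: "(\<And>x. x \<in> K \<Longrightarrow> f x = g x) \<Longrightarrow> mean f = mean g"
proof -
  assume fg: "\<And>x. x \<in> K \<Longrightarrow> f x = g x"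
  have "family ks \<and> (\<forall>x\<in>K. \<bar>lavg ks f x - c\<bar> \<le> \<epsilon>) \<longleftrightarrow>
      family ks \<and> (\<forall>x\<in>K. \<bar>lavg ks g x - c\<bar> \<le> \<epsilon>)" for ks c \<epsilon>
    by (rule conj_cong[OF refl], rule ball_cong[OF refl]) (simp add: lavg_cong[of ks _ f g] fg)
  then have "is_mean f = is_mean g"
    unfolding is_mean_def fun_eq_iff by (simp only:) simp
  then show ?thesis by (simp add: mean_def)
qed

lemma mean_near:
  assumes f: "continuous_on K f" and "\<And>x. x \<in> K \<Longrightarrow> \<bar>f x - c\<bar> \<le> b"
  shows "\<bar>mean f - c\<bar> \<le> b"
proof (rule field_le_epsilon)
  fix \<epsilon> :: real assume "0 < \<epsilon>"
  then obtain ks where ks: "family ks" "\<And>x. x \<in> K \<Longrightarrow> \<bar>lavg ks f x - mean f\<bar> \<le> \<epsilon>"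
    using is_mean_mean[OF f] unfolding is_mean_def by blast
  show "\<bar>mean f - c\<bar> \<le> b + \<epsilon>"
  proof -
    have "\<bar>lavg ks f e - c\<bar> \<le> b" by (rule lavg_near[OF ks(1) e_in assms(2)])
    with ks(2)[OF e_in] show ?thesis by linarith
  qed
qed

lemma mean_const: "mean (\<lambda>x. c) = c"
  using mean_near[of "\<lambda>x. c" c 0] by (simp add: continuous_on_const)

lemma mean_translate:
  assumes f: "continuous_on K f" and k: "k \<in> K"
  shows "mean (\<lambda>x. f (k \<cdot> x)) = mean f"
proof -
  have c: "continuous_on K (\<lambda>x. f (k \<cdot> x))"
    by (rule continuous_on_compose2[OF f continuous_translate[OF k]]) (use k mul_in in auto)
  have "is_mean f (mean (\<lambda>x. f (k \<cdot> x)))"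
    unfolding is_mean_def
  proof (intro allI impI)
    fix \<epsilon> :: real assume "0 < \<epsilon>"
    then obtain ks where ks: "family ks" "\<forall>x\<in>K. \<bar>lavg ks (\<lambda>x. f (k \<cdot> x)) x - mean (\<lambda>x. f (k \<cdot> x))\<bar> \<le> \<epsilon>"
      using is_mean_mean[OF c] unfolding is_mean_def by blast
    have "lavg (map ((\<cdot>) k) ks) f x = lavg ks (\<lambda>x. f (k \<cdot> x)) x" if "x \<in> K" for x
    proof -
      have "map (\<lambda>l. f (k \<cdot> l \<cdot> x)) ks = map (\<lambda>l. f (k \<cdot> (l \<cdot> x))) ks"
        using ks(1) k that by (intro map_cong refl) (simp add: family_def subset_iff mul_assoc)
      then show ?thesis unfolding lavg_def length_map map_map o_def by (rule arg_cong[where f = "\<lambda>xs. sum_list xs / real (length ks)"])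
    qed
    then show "\<exists>ks. family ks \<and> (\<forall>x\<in>K. \<bar>lavg ks f x - mean (\<lambda>x. f (k \<cdot> x))\<bar> \<le> \<epsilon>)"
      using ks k by (intro exI[of _ "map ((\<cdot>) k) ks"]) (auto simp: family_def mul_in)
  qed
  then show ?thesis using mean_eqI[OF f] by simp
qed

text \<open>
  Averages of \<open>lavg ks f\<close> are averages of \<open>f\<close>, which gives additivity of the mean: first flatten
  \<open>f\<close>, then flatten the resulting average of \<open>g\<close>, which leaves \<open>f\<close> flat.
\<close>

lemma mean_lavg:
  assumes f: "continuous_on K f" and ks: "family ks"
  shows "mean (lavg ks f) = mean f"
proof -
  let ?g = "lavg ks f"
  have g: "continuous_on K ?g" by (rule continuous_lavg[OF f ks])
  have "is_mean f (mean ?g)"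
    unfolding is_mean_def
  proof (intro allI impI)
    fix \<epsilon> :: real assume "0 < \<epsilon>"
    then obtain ls where ls: "family ls" "\<forall>x\<in>K. \<bar>lavg ls ?g x - mean ?g\<bar> \<le> \<epsilon>"
      using is_mean_mean[OF g] unfolding is_mean_def by blast
    then show "\<exists>ks. family ks \<and> (\<forall>x\<in>K. \<bar>lavg ks f x - mean ?g\<bar> \<le> \<epsilon>)"
      using lavg_lavg[OF ks ls(1), of _ f] family_mult[OF ks ls(1)] by (intro exI[of _ "family_mult ks ls"]) auto
  qed
  then show ?thesis using mean_eqI[OF f] by simp
qed

lemma mean_add:
  assumes f: "continuous_on K f" and g: "continuous_on K g"
  shows "mean (\<lambda>x. f x + g x) = mean f + mean g"
proof -
  have c: "continuous_on K (\<lambda>x. f x + g x)" by (intro continuous_intros f g)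
  have "is_mean (\<lambda>x. f x + g x) (mean f + mean g)"
    unfolding is_mean_def
  proof (intro allI impI)
    fix \<epsilon> :: real assume \<epsilon>: "0 < \<epsilon>"
    obtain ks where ks: "family ks" "\<And>x. x \<in> K \<Longrightarrow> \<bar>lavg ks f x - mean f\<bar> \<le> \<epsilon>/2"
      using is_mean_mean[OF f] half_gt_zero[OF \<epsilon>] unfolding is_mean_def by blast
    obtain ls where ls: "family ls" "\<And>x. x \<in> K \<Longrightarrow> \<bar>lavg ls (lavg ks g) x - mean g\<bar> \<le> \<epsilon>/2"
      using is_mean_mean[OF continuous_lavg[OF g ks(1)]] half_gt_zero[OF \<epsilon>]
      unfolding is_mean_def mean_lavg[OF g ks(1)] by blast
    have "\<bar>lavg (family_mult ks ls) (\<lambda>x. f x + g x) x - (mean f + mean g)\<bar> \<le> \<epsilon>" if x: "x \<in> K" for x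
    proof -
      have "\<bar>lavg ls (lavg ks f) x - mean f\<bar> \<le> \<epsilon>/2" by (rule lavg_near[OF ls(1) x ks(2)])
      then show ?thesis
        using ls(2)[OF x] unfolding lavg_lavg[OF ks(1) ls(1) x, symmetric] lavg_add[abs_def] by linarith
    qed
    then show "\<exists>ks. family ks \<and> (\<forall>x\<in>K. \<bar>lavg ks (\<lambda>x. f x + g x) x - (mean f + mean g)\<bar> \<le> \<epsilon>)"
      using family_mult[OF ks(1) ls(1)] by blast
  qed
  then show ?thesis by (rule mean_eqI[OF c])
qed

lemma mean_diff:
  assumes f: "continuous_on K f" and g: "continuous_on K g"
  shows "mean (\<lambda>x. f x - g x) = mean f - mean g"
proof -
  have "continuous_on K (\<lambda>x. f x - g x)" by (intro continuous_intros f g)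
  from mean_add[OF this g] show ?thesis by simp
qed

lemma continuous_on_mean:
  fixes F :: "'b::metric_space \<Rightarrow> 'a \<Rightarrow> real"
  assumes "continuous_on (S \<times> K) (\<lambda>p. F (fst p) (snd p))"
  shows "continuous_on S (\<lambda>s. mean (F s))"
proof -
  have F: "continuous_on (S \<times> K) (\<lambda>(s, k). F s k)"
    using assms by (simp add: case_prod_unfold)
  have cF: "continuous_on K (F s)" if "s \<in> S" for s
  proof -
    have "continuous_on K (\<lambda>k. (\<lambda>(s, k). F s k) (s, k))"
      by (rule continuous_on_compose2[OF F]) (use that in \<open>auto intro!: continuous_intros\<close>)
    then show ?thesis by simp
  qed
  show ?thesis
    unfolding continuous_on_iff
  proof (intro ballI allI impI)
    fix s and \<epsilon> :: real assume s: "s \<in> S" and \<epsilon>: "0 < \<epsilon>"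
    have "\<forall>\<^sub>F t in at s within S. \<forall>k\<in>K. dist (F t k) (F s k) \<le> \<epsilon>/2"
    proof -
      obtain X0 where X0: "s \<in> X0" "open X0"
        "\<forall>x\<in>X0 \<inter> S. \<forall>t\<in>K. dist (case (x, t) of (s, k) \<Rightarrow> F s k) (case (s, t) of (s, k) \<Rightarrow> F s k) \<le> \<epsilon>/2"
        by (rule continuous_on_prod_compactE[OF F compact_K s half_gt_zero[OF \<epsilon>]])
      then show ?thesis unfolding eventually_at_topological by (intro exI[of _ X0]) simp
    qed
    then obtain d where d: "0 < d"
      "\<forall>t\<in>S. t \<noteq> s \<and> dist t s < d \<longrightarrow> (\<forall>k\<in>K. dist (F t k) (F s k) \<le> \<epsilon>/2)"
      unfolding eventually_at by blast
    have "dist (mean (F t)) (mean (F s)) < \<epsilon>" if t: "t \<in> S" "dist t s < d" for t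
    proof (cases "t = s")
      case False
      have "\<bar>mean (\<lambda>k. F t k - F s k) - 0\<bar> \<le> \<epsilon>/2"
        using d(2) t False
        by (intro mean_near continuous_on_diff cF t s) (simp add: dist_real_def)
      then show ?thesis
        using mean_diff[OF cF[OF t(1)] cF[OF s]] \<epsilon> by (simp add: dist_real_def)
    qed (use \<epsilon> in simp)
    then show "\<exists>d>0. \<forall>x'\<in>S. dist x' s < d \<longrightarrow> dist (mean (F x')) (mean (F s)) < \<epsilon>"
      using d(1) by blast
  qed
qed

definition mean2 :: "('a \<Rightarrow> 'a \<Rightarrow> real) \<Rightarrow> real" where
  "mean2 F = mean (\<lambda>k. mean (F k))"

definition mean3 :: "('a \<Rightarrow> 'a \<Rightarrow> 'a \<Rightarrow> real) \<Rightarrow> real" where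
  "mean3 F = mean (\<lambda>k. mean2 (F k))"

definition continuous2 :: "('a \<Rightarrow> 'a \<Rightarrow> real) \<Rightarrow> bool" where
  "continuous2 F \<longleftrightarrow> continuous_on (K \<times> K) (\<lambda>p. F (fst p) (snd p))"

text \<open>
  The arguments are nested to the left so that the innermost mean is taken over the last factor of a
  product, as in \<open>continuous_on_mean\<close>.
\<close>

definition continuous3 :: "('a \<Rightarrow> 'a \<Rightarrow> 'a \<Rightarrow> real) \<Rightarrow> bool" where
  "continuous3 F \<longleftrightarrow> continuous_on ((K \<times> K) \<times> K) (\<lambda>p. F (fst (fst p)) (snd (fst p)) (snd p))"

lemma continuous2D:
  assumes "continuous2 F"
  shows "k \<in> K \<Longrightarrow> continuous_on K (F k)" "continuous_on K (\<lambda>k. mean (F k))"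
proof -
  note F = assms[unfolded continuous2_def]
  show "continuous_on K (\<lambda>k. mean (F k))" by (rule continuous_on_mean[OF F])
  assume k: "k \<in> K"
  have "continuous_on K (\<lambda>l. (\<lambda>p. F (fst p) (snd p)) (k, l))"
    by (rule continuous_on_compose2[OF F]) (use k in \<open>auto intro!: continuous_intros\<close>)
  then show "continuous_on K (F k)" by simp
qed

lemma continuous3D:
  assumes "continuous3 F"
  shows "k \<in> K \<Longrightarrow> continuous2 (F k)" "continuous_on K (\<lambda>k. mean2 (F k))"
proof -
  note F = assms[unfolded continuous3_def]
  have "continuous_on (K \<times> K) (\<lambda>q. mean (F (fst q) (snd q)))"
    by (rule continuous_on_mean[OF F])
  then show "continuous_on K (\<lambda>k. mean2 (F k))"
    unfolding mean2_def by (rule continuous_on_mean)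
  assume k: "k \<in> K"
  have "continuous_on (K \<times> K) (\<lambda>q. (\<lambda>p. F (fst (fst p)) (snd (fst p)) (snd p)) ((k, fst q), snd q))"
    by (rule continuous_on_compose2[OF F]) (use k in \<open>auto intro!: continuous_intros\<close>)
  then show "continuous2 (F k)" by (simp add: continuous2_def)
qed

lemma mean2_translate:
  assumes F: "continuous2 F" and "a \<in> K" "b \<in> K"
  shows "mean2 (\<lambda>k l. F (a \<cdot> k) (b \<cdot> l)) = mean2 F"
proof -
  have "mean2 (\<lambda>k l. F (a \<cdot> k) (b \<cdot> l)) = mean (\<lambda>k. mean (F (a \<cdot> k)))"
    unfolding mean2_def using assms by (intro mean_cong mean_translate continuous2D mul_in)
  also have "\<dots> = mean2 F"
    unfolding mean2_def by (rule mean_translate[OF continuous2D(2)[OF F] \<open>a \<in> K\<close>])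
  finally show ?thesis .
qed

lemma mean3_translate:
  assumes F: "continuous3 F" and "a \<in> K" "b \<in> K" "c \<in> K"
  shows "mean3 (\<lambda>k l m. F (a \<cdot> k) (b \<cdot> l) (c \<cdot> m)) = mean3 F"
proof -
  have "mean3 (\<lambda>k l m. F (a \<cdot> k) (b \<cdot> l) (c \<cdot> m)) = mean (\<lambda>k. mean2 (F (a \<cdot> k)))"
    unfolding mean3_def using assms by (intro mean_cong mean2_translate continuous3D mul_in)
  also have "\<dots> = mean3 F"
    unfolding mean3_def by (rule mean_translate[OF continuous3D(2)[OF F] \<open>a \<in> K\<close>])
  finally show ?thesis .
qed

lemma mean2_add:
  assumes F: "continuous2 F" and G: "continuous2 G"
  shows "mean2 (\<lambda>k l. F k l + G k l) = mean2 F + mean2 G"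
proof -
  have "mean2 (\<lambda>k l. F k l + G k l) = mean (\<lambda>k. mean (F k) + mean (G k))"
    unfolding mean2_def using assms by (intro mean_cong mean_add continuous2D)
  also have "\<dots> = mean2 F + mean2 G"
    unfolding mean2_def by (intro mean_add continuous2D assms)
  finally show ?thesis .
qed

lemma mean3_add:
  assumes F: "continuous3 F" and G: "continuous3 G"
  shows "mean3 (\<lambda>k l m. F k l m + G k l m) = mean3 F + mean3 G"
proof -
  have "mean3 (\<lambda>k l m. F k l m + G k l m) = mean (\<lambda>k. mean2 (F k) + mean2 (G k))"
    unfolding mean3_def using assms by (intro mean_cong mean2_add continuous3D)
  also have "\<dots> = mean3 F + mean3 G"
    unfolding mean3_def by (intro mean_add continuous3D assms)
  finally show ?thesis .
qed

lemma mean3_near: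
  assumes F: "continuous3 F" and "\<And>k l m. k \<in> K \<Longrightarrow> l \<in> K \<Longrightarrow> m \<in> K \<Longrightarrow> \<bar>F k l m - c\<bar> \<le> b"
  shows "\<bar>mean3 F - c\<bar> \<le> b"
  unfolding mean3_def mean2_def
proof (intro mean_near)
  show "continuous_on K (\<lambda>k. mean (\<lambda>l. mean (F k l)))"
    using continuous3D(2)[OF F] by (simp add: mean2_def)
  fix k assume k: "k \<in> K"
  then show "continuous_on K (\<lambda>l. mean (F k l))" "l \<in> K \<Longrightarrow> continuous_on K (F k l)" for l
    by (simp_all add: continuous2D[OF continuous3D(1)[OF F]])
qed (use assms in auto)

lemma mean3_mean2:
  "mean3 (\<lambda>k l m. F k l) = mean2 F" "mean3 (\<lambda>k l m. F k m) = mean2 F" "mean3 (\<lambda>k l m. F l m) = mean2 F"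
  by (simp_all add: mean3_def mean2_def mean_const)

lemma mean3_uminus:
  assumes F: "continuous3 F"
  shows "mean3 (\<lambda>k l m. - F k l m) = - mean3 F"
proof -
  have "continuous3 (\<lambda>k l m. - F k l m)" using F unfolding continuous3_def by (intro continuous_on_minus)
  from mean3_add[OF F this] show ?thesis by (simp add: mean3_def mean2_def mean_const)
qed

end

section \<open>Hyperbolic translations of the ball\<close>

definition translation_denom :: "'a::real_inner \<Rightarrow> 'a \<Rightarrow> real" where
  "translation_denom a x = 1 + 2 * (a \<bullet> x) + (a \<bullet> a) * (x \<bullet> x)"

text \<open>
  Moebius addition \<open>a \<oplus> x\<close>: the hyperbolic translation along the diameter through \<open>a\<close> that takes
  \<open>0\<close> to \<open>a\<close>. The second summand is, up to the factor \<open>1 - |a|\<^sup>2\<close>, the inversion of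
  \<open>x / |x|\<^sup>2 + a\<close>, written so that it makes sense at \<open>0\<close>.
\<close>

definition translation :: "'a::real_inner \<Rightarrow> 'a \<Rightarrow> 'a" where
  "translation a x = a + ((1 - a \<bullet> a) / translation_denom a x) *\<^sub>R (x + (x \<bullet> x) *\<^sub>R a)"

lemma inner_less_1: "(x::'a::real_inner) \<in> ball 0 1 \<Longrightarrow> x \<bullet> x < 1"
  by (simp add: dot_square_norm power_less_one_iff abs_square_less_1)

lemma translation_denom_pos:
  fixes a x :: "'a::real_inner"
  assumes "a \<in> ball 0 1" "x \<in> ball 0 1"
  shows "0 < translation_denom a x"
proof -
  have "norm a * norm x < 1"
    using assms mult_strict_mono[of "norm a" 1 "norm x" 1] by auto
  then have "0 < (1 - norm a * norm x)\<^sup>2" by simp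
  also have "\<dots> = 1 - 2 * (norm a * norm x) + (a \<bullet> a) * (x \<bullet> x)"
    by (simp add: power2_eq_square dot_square_norm algebra_simps)
  also have "\<dots> \<le> translation_denom a x"
    using norm_cauchy_schwarz[of "-a" x] by (simp add: translation_denom_def)
  finally show ?thesis .
qed

text \<open>
  This identity is what makes the translation conformal and reduces the metric computations below
  to identities between the inner products of \<open>a\<close>, \<open>x\<close> and \<open>y\<close>.
\<close>

lemma translation_numerator_inner:
  "(x + (x \<bullet> x) *\<^sub>R a) \<bullet> (x + (x \<bullet> x) *\<^sub>R a) = (x \<bullet> x) * translation_denom a x"
  by (simp add: translation_denom_def algebra_simps inner_commute power2_eq_square)

lemma one_minus_translation:
  fixes a x :: "'a::real_inner"
  assumes "a \<in> ball 0 1" "x \<in> ball 0 1"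
  shows "1 - translation a x \<bullet> translation a x = (1 - a \<bullet> a) * (1 - x \<bullet> x) / translation_denom a x"
proof -
  define N where "N = translation_denom a x"
  define u where "u = x + (x \<bullet> x) *\<^sub>R a"
  define q where "q = 1 - a \<bullet> a"
  have N: "N \<noteq> 0" using translation_denom_pos[OF assms] by (simp add: N_def)
  have uu: "u \<bullet> u = (x \<bullet> x) * N" by (simp add: u_def N_def translation_numerator_inner)
  have au: "a \<bullet> u = a \<bullet> x + (x \<bullet> x) * (a \<bullet> a)" by (simp add: u_def algebra_simps)
  have "translation a x = a + (q / N) *\<^sub>R u" by (simp add: translation_def q_def N_def u_def)
  then have "translation a x \<bullet> translation a x = a \<bullet> a + 2 * (q / N) * (a \<bullet> u) + (q / N)\<^sup>2 * (u \<bullet> u)"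
    by (simp add: algebra_simps inner_commute power2_eq_square)
  also have "\<dots> = a \<bullet> a + (q / N) * (2 * (a \<bullet> u) + q * (x \<bullet> x))"
    using N by (simp add: uu power2_eq_square field_simps)
  finally have "1 - translation a x \<bullet> translation a x = (q / N) * (N - 2 * (a \<bullet> u) - q * (x \<bullet> x))"
    using N by (simp add: q_def field_simps)
  also have "N - 2 * (a \<bullet> u) - q * (x \<bullet> x) = 1 - x \<bullet> x"
    by (simp add: au N_def q_def translation_denom_def algebra_simps)
  finally show ?thesis by (simp add: q_def N_def)
qed

lemma translation_in_ball:
  fixes a x :: "'a::real_inner"
  assumes "a \<in> ball 0 1" "x \<in> ball 0 1"
  shows "translation a x \<in> ball 0 1"
proof -
  have "0 < 1 - translation a x \<bullet> translation a x"
    unfolding one_minus_translation[OF assms]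
    using translation_denom_pos[OF assms] inner_less_1[OF assms(1)] inner_less_1[OF assms(2)] by simp
  then show ?thesis by (simp add: dot_square_norm abs_square_less_1)
qed

lemma norm_translation_diff:
  fixes a x y :: "'a::real_inner"
  assumes a: "a \<in> ball 0 1" and x: "x \<in> ball 0 1" and y: "y \<in> ball 0 1"
  shows "(norm (translation a x - translation a y))\<^sup>2 =
    (1 - a \<bullet> a)\<^sup>2 * (norm (x - y))\<^sup>2 / (translation_denom a x * translation_denom a y)"
proof -
  define N M where "N = translation_denom a x" and "M = translation_denom a y"
  define u w where "u = x + (x \<bullet> x) *\<^sub>R a" and "w = y + (y \<bullet> y) *\<^sub>R a"
  define q where "q = 1 - a \<bullet> a"
  have N: "N \<noteq> 0" "M \<noteq> 0" using translation_denom_pos[OF a x] translation_denom_pos[OF a y]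
    by (simp_all add: N_def M_def)
  have uu: "u \<bullet> u = (x \<bullet> x) * N" "w \<bullet> w = (y \<bullet> y) * M"
    by (simp_all add: u_def w_def N_def M_def translation_numerator_inner)
  have uw: "u \<bullet> w = x \<bullet> y + (y \<bullet> y) * (a \<bullet> x) + (x \<bullet> x) * (a \<bullet> y) + (x \<bullet> x) * (y \<bullet> y) * (a \<bullet> a)"
    by (simp add: u_def w_def algebra_simps inner_commute)
  have "translation a x - translation a y = q *\<^sub>R ((1 / N) *\<^sub>R u - (1 / M) *\<^sub>R w)"
    by (simp add: translation_def q_def N_def M_def u_def w_def scaleR_diff_right)
  then have "(norm (translation a x - translation a y))\<^sup>2
      = q\<^sup>2 * (((1 / N) *\<^sub>R u - (1 / M) *\<^sub>R w) \<bullet> ((1 / N) *\<^sub>R u - (1 / M) *\<^sub>R w))"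
    by (simp add: power_mult_distrib dot_square_norm)
  also have "((1 / N) *\<^sub>R u - (1 / M) *\<^sub>R w) \<bullet> ((1 / N) *\<^sub>R u - (1 / M) *\<^sub>R w)
      = (u \<bullet> u) / N\<^sup>2 + (w \<bullet> w) / M\<^sup>2 - 2 * (u \<bullet> w) / (N * M)"
    by (simp add: inner_diff_left inner_diff_right inner_commute power2_eq_square)
  also have "\<dots> = ((x \<bullet> x) * M + (y \<bullet> y) * N - 2 * (u \<bullet> w)) / (N * M)"
    using N by (simp add: uu power2_eq_square field_simps)
  also have "(x \<bullet> x) * M + (y \<bullet> y) * N - 2 * (u \<bullet> w) = (norm (x - y))\<^sup>2"
    by (simp add: uw N_def M_def translation_denom_def algebra_simps inner_commute flip: dot_square_norm)
  finally show ?thesis by (simp add: q_def N_def M_def)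
qed

lemma translation_minus_translation:
  fixes a x :: "'a::real_inner"
  assumes "a \<in> ball 0 1" "x \<in> ball 0 1"
  shows "translation (- a) (translation a x) = x"
proof -
  define N where "N = translation_denom a x"
  define u where "u = x + (x \<bullet> x) *\<^sub>R a"
  define q where "q = 1 - a \<bullet> a"
  define y where "y = translation a x"
  have N: "N \<noteq> 0" using translation_denom_pos[OF assms] by (simp add: N_def)
  have q: "q \<noteq> 0" using inner_less_1[OF assms(1)] by (simp add: q_def)
  have y: "y = a + (q / N) *\<^sub>R u" by (simp add: y_def translation_def q_def N_def u_def)
  have yy: "1 - y \<bullet> y = q * (1 - x \<bullet> x) / N"
    using one_minus_translation[OF assms] by (simp add: y_def q_def N_def)
  have ay: "a \<bullet> y = a \<bullet> a + (q / N) * (a \<bullet> x + (x \<bullet> x) * (a \<bullet> a))"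
    by (simp add: y u_def algebra_simps)
  have "translation_denom (- a) y = 1 - 2 * (a \<bullet> y) + (a \<bullet> a) - (a \<bullet> a) * (1 - y \<bullet> y)"
    by (simp add: translation_denom_def algebra_simps)
  also have "\<dots> = q - (q / N) * (2 * (a \<bullet> x + (x \<bullet> x) * (a \<bullet> a)) + (a \<bullet> a) * (1 - x \<bullet> x))"
  proof -
    define r where "r = q / N"
    have "1 - y \<bullet> y = r * (1 - x \<bullet> x)" "a \<bullet> y = a \<bullet> a + r * (a \<bullet> x + (x \<bullet> x) * (a \<bullet> a))"
      by (simp_all add: yy ay r_def)
    then show ?thesis unfolding r_def[symmetric] by (simp only: q_def) (simp add: algebra_simps)
  qed
  also have "\<dots> = (q / N) * (N - (2 * (a \<bullet> x + (x \<bullet> x) * (a \<bullet> a)) + (a \<bullet> a) * (1 - x \<bullet> x)))"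
    using N by (simp add: algebra_simps)
  also have "N - (2 * (a \<bullet> x + (x \<bullet> x) * (a \<bullet> a)) + (a \<bullet> a) * (1 - x \<bullet> x)) = q"
    by (simp add: N_def q_def translation_denom_def algebra_simps)
  finally have D: "translation_denom (- a) y = q * q / N" by simp
  have "translation (- a) y = - a + (N / q) *\<^sub>R ((1 - y \<bullet> y) *\<^sub>R a + (q / N) *\<^sub>R u)"
    using q N by (simp add: translation_def D q_def[symmetric]) (simp add: y algebra_simps)
  also have "\<dots> = - a + (1 - x \<bullet> x) *\<^sub>R a + u"
    using q N by (simp add: yy scaleR_add_right)
  also have "\<dots> = x" by (simp add: u_def algebra_simps)
  finally show ?thesis by (simp add: y_def)
qed

text \<open>
  The hyperbolic cosine of the hyperbolic distance: a rational function, on which invariance under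
  isometries becomes an algebraic identity.
\<close>

definition cosh_dist :: "'a::real_inner \<Rightarrow> 'a \<Rightarrow> real" where
  "cosh_dist x y = 1 + 2 * (norm (x - y))\<^sup>2 / ((1 - x \<bullet> x) * (1 - y \<bullet> y))"

lemma cosh_dist_ge_1: "x \<in> ball 0 1 \<Longrightarrow> y \<in> ball 0 1 \<Longrightarrow> 1 \<le> cosh_dist x y"
  using inner_less_1[of x] inner_less_1[of y] by (simp add: cosh_dist_def)

lemma hyperbolic_dist_eq: "hyperbolic_dist x y = arcosh (cosh_dist x y)"
  by (simp add: hyperbolic_dist_def cosh_dist_def dot_square_norm)

lemma cosh_dist_commute: "cosh_dist x y = cosh_dist y x"
  by (simp add: cosh_dist_def norm_minus_commute mult.commute)

lemma cosh_dist_translation: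
  fixes a x y :: "'a::real_inner"
  assumes a: "a \<in> ball 0 1" and x: "x \<in> ball 0 1" and y: "y \<in> ball 0 1"
  shows "cosh_dist (translation a x) (translation a y) = cosh_dist x y"
proof -
  have "translation_denom a x \<noteq> 0" "translation_denom a y \<noteq> 0" "1 - a \<bullet> a \<noteq> 0" "1 - x \<bullet> x \<noteq> 0" "1 - y \<bullet> y \<noteq> 0"
    using translation_denom_pos[OF a x] translation_denom_pos[OF a y] inner_less_1[OF a] inner_less_1[OF x] inner_less_1[OF y] by auto
  then show ?thesis
    unfolding cosh_dist_def one_minus_translation[OF a x] one_minus_translation[OF a y] norm_translation_diff[OF assms]
    by (simp add: power2_eq_square)
qed

definition translation_deriv :: "'a::real_inner \<Rightarrow> 'a \<Rightarrow> 'a \<Rightarrow> 'a" where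
  "translation_deriv a x h =
     ((1 - a \<bullet> a) / translation_denom a x) *\<^sub>R (h + (2 * (x \<bullet> h)) *\<^sub>R a)
     - ((1 - a \<bullet> a) * (2 * (a \<bullet> h) + 2 * (a \<bullet> a) * (x \<bullet> h)) / (translation_denom a x)\<^sup>2) *\<^sub>R (x + (x \<bullet> x) *\<^sub>R a)"

lemma has_derivative_translation:
  fixes a x :: "'a::real_inner"
  assumes "a \<in> ball 0 1" "x \<in> ball 0 1"
  shows "(translation a has_derivative translation_deriv a x) (at x)"
proof -
  define N' where "N' = (\<lambda>h. 2 * (a \<bullet> h) + 2 * (a \<bullet> a) * (x \<bullet> h))"
  have N: "translation_denom a x \<noteq> 0" using translation_denom_pos[OF assms] by simp
  have xx: "((\<lambda>x. x \<bullet> x) has_derivative (\<lambda>h. 2 * (x \<bullet> h))) (at x)"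
    by (rule has_derivative_eq_rhs[OF has_derivative_inner[OF has_derivative_ident has_derivative_ident]])
       (simp add: fun_eq_iff inner_commute)
  have ax: "((\<lambda>x. a \<bullet> x) has_derivative (\<lambda>h. a \<bullet> h)) (at x)"
    by (intro has_derivative_inner_right has_derivative_ident)
  have "((\<lambda>x. 1 + 2 * (a \<bullet> x) + (a \<bullet> a) * (x \<bullet> x)) has_derivative
      (\<lambda>h. 0 + 2 * (a \<bullet> h) + (a \<bullet> a) * (2 * (x \<bullet> h)))) (at x)"
    by (intro has_derivative_add has_derivative_const has_derivative_mult_right xx ax)
  then have N': "(translation_denom a has_derivative N') (at x)"
    by (simp add: translation_denom_def[abs_def] N'_def mult.assoc mult.left_commute)
  have "((\<lambda>x. (1 - a \<bullet> a) / translation_denom a x) has_derivative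
      (\<lambda>h. (1 - a \<bullet> a) * - (inverse (translation_denom a x) * N' h * inverse (translation_denom a x)))) (at x)"
    unfolding divide_inverse by (intro has_derivative_mult_right Deriv.has_derivative_inverse[OF N N'])
  moreover have "((\<lambda>x. x + (x \<bullet> x) *\<^sub>R a) has_derivative (\<lambda>h. h + (2 * (x \<bullet> h)) *\<^sub>R a)) (at x)"
    by (intro has_derivative_add has_derivative_ident has_derivative_scaleR_left xx)
  ultimately have "((\<lambda>x. a + ((1 - a \<bullet> a) / translation_denom a x) *\<^sub>R (x + (x \<bullet> x) *\<^sub>R a)) has_derivative
      (\<lambda>h. 0 + (((1 - a \<bullet> a) / translation_denom a x) *\<^sub>R (h + (2 * (x \<bullet> h)) *\<^sub>R a) +
         ((1 - a \<bullet> a) * - (inverse (translation_denom a x) * N' h * inverse (translation_denom a x))) *\<^sub>R (x + (x \<bullet> x) *\<^sub>R a)))) (at x)"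
    by (intro has_derivative_add[OF has_derivative_const] has_derivative_scaleR)
  then show ?thesis
    unfolding translation_def[abs_def]
    by (rule has_derivative_eq_rhs)
       (simp add: fun_eq_iff translation_deriv_def N'_def divide_inverse power2_eq_square mult_ac)
qed

text \<open>
  Translations preserve orientation because they are connected to the identity: along the path
  \<open>s \<mapsto> s a\<close> the Jacobian determinant is continuous, is \<open>1\<close> at the start, and never vanishes, since
  translation by \<open>- s a\<close> is an inverse.
\<close>

lemma det_translation_deriv_pos:
  fixes a x :: "real^'n::finite"
  assumes a: "a \<in> ball 0 1" and x: "x \<in> ball 0 1"
  shows "0 < det (matrix (translation_deriv a x))"
proof (rule ccontr)
  assume neg: "\<not> 0 < det (matrix (translation_deriv a x))"
  define d where "d s = det (matrix (translation_deriv (s *\<^sub>R a) x))" for s :: real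
  have sa: "s *\<^sub>R a \<in> ball 0 1" if "s \<in> {0..1}" for s
    using that a mult_left_le_one_le[of "norm a" s] by auto
  have N: "translation_denom (s *\<^sub>R a) x \<noteq> 0" if "s \<in> {0..1}" for s
    using translation_denom_pos[OF sa[OF that] x] by simp
  have cN: "continuous_on {0..1} (\<lambda>s. translation_denom (s *\<^sub>R a) x)"
    unfolding translation_denom_def by (intro continuous_intros)
  have "continuous_on {0..1} d"
    unfolding d_def det_def matrix_def translation_deriv_def using N
    by (intro continuous_intros cN) auto
  moreover have "d 1 \<le> 0" "0 \<le> d 0"
    using neg by (auto simp: d_def translation_deriv_def[abs_def] translation_denom_def matrix_det_id)
  ultimately obtain s where s: "0 \<le> s" "s \<le> 1" "d s = 0"
    using IVT2'[of d 1 0 0] by auto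
  let ?b = "s *\<^sub>R a"
  have b: "?b \<in> ball 0 1" using sa s by auto
  have mb: "- ?b \<in> ball 0 1" using b by simp
  let ?y = "translation ?b x"
  have d1: "(translation ?b has_derivative translation_deriv ?b x) (at x)"
    by (rule has_derivative_translation[OF b x])
  have d2: "(translation (- ?b) has_derivative translation_deriv (- ?b) ?y) (at ?y)"
    by (rule has_derivative_translation[OF mb translation_in_ball[OF b x]])
  have "((\<lambda>x. x) has_derivative translation_deriv (- ?b) ?y \<circ> translation_deriv ?b x) (at x)"
    by (rule has_derivative_transform_within_open[OF diff_chain_at[OF d1 d2], of "ball 0 1"])
       (use x translation_minus_translation[OF b] in auto)
  then have "translation_deriv (- ?b) ?y \<circ> translation_deriv ?b x = (\<lambda>x. x)"
    using has_derivative_ident has_derivative_unique by blast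
  then have "det (matrix (translation_deriv (- ?b) ?y)) * det (matrix (translation_deriv ?b x)) = 1"
    using matrix_compose[of "translation_deriv ?b x" "translation_deriv (- ?b) ?y"] d1 d2
    by (metis det_mul has_derivative_linear matrix_det_id)
  then show False using s(3) by (simp add: d_def)
qed

section \<open>Isometries as framed points\<close>

text \<open>
  An isometry is determined by the image \<open>x\<close> of the origin together with a rotation \<open>Q\<close>: apply
  \<open>Q\<close> first and translate the origin to \<open>x\<close> afterwards. This identifies the isometry group, as a set
  and later as a space, with the product of hyperbolic space and \<open>SO(n)\<close>.
\<close>

definition frame :: "real^'n::finite \<Rightarrow> real^'n^'n \<Rightarrow> real^'n \<Rightarrow> real^'n" where
  "frame x Q = (\<lambda>y\<in>hyperbolic_space. translation x (Q *v y))"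

lemma rotation_matrixD:
  fixes Q :: "real^'n::finite^'n"
  assumes "rotation_matrix Q"
  shows "norm (Q *v x) = norm x" "(Q *v x) \<bullet> (Q *v y) = x \<bullet> y" "transpose Q *v (Q *v x) = x"
    "Q *v (transpose Q *v x) = x" "det Q = 1" "rotation_matrix (transpose Q)"
proof -
  have Q: "orthogonal_matrix Q" "det Q = 1" using assms by (auto simp: rotation_matrix_def)
  have "orthogonal_transformation ((*v) Q)"
    using Q(1) by (simp add: orthogonal_transformation_matrix)
  then show "norm (Q *v x) = norm x" "(Q *v x) \<bullet> (Q *v y) = x \<bullet> y"
    by (auto simp: orthogonal_transformation_norm orthogonal_transformation_def)
  show "transpose Q *v (Q *v x) = x" "Q *v (transpose Q *v x) = x"
    using Q(1) by (simp_all add: matrix_vector_mul_assoc orthogonal_matrix_def del: transpose_matrix_vector)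
  show "det Q = 1" by fact
  show "rotation_matrix (transpose Q)"
    using Q by (simp add: rotation_matrix_def orthogonal_matrix_transpose det_transpose)
qed

lemma rotation_matrix_mult: "rotation_matrix P \<Longrightarrow> rotation_matrix Q \<Longrightarrow> rotation_matrix (P ** Q :: real^'n::finite^'n)"
  by (simp add: rotation_matrix_def orthogonal_matrix_mul det_mul)

lemma rotation_matrix_mat: "rotation_matrix (mat 1 :: real^'n::finite^'n)"
  by (simp add: rotation_matrix_def orthogonal_matrix_id)

lemma mem_hyperbolic_space: "x \<in> hyperbolic_space \<longleftrightarrow> norm x < 1"
  by (simp add: hyperbolic_space_def)

lemma rotation_in_hyperbolic_space [simp]:
  "rotation_matrix Q \<Longrightarrow> Q *v x \<in> hyperbolic_space \<longleftrightarrow> x \<in> hyperbolic_space"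
  by (simp add: mem_hyperbolic_space rotation_matrixD(1))

lemma translation_in_hyperbolic_space:
  "a \<in> hyperbolic_space \<Longrightarrow> x \<in> hyperbolic_space \<Longrightarrow> translation a x \<in> hyperbolic_space"
  unfolding hyperbolic_space_def by (rule translation_in_ball)

lemma uminus_in_hyperbolic_space [simp]: "- a \<in> hyperbolic_space \<longleftrightarrow> a \<in> hyperbolic_space"
  by (simp add: mem_hyperbolic_space)

lemma zero_in_hyperbolic_space [simp]: "0 \<in> hyperbolic_space"
  by (simp add: mem_hyperbolic_space)

lemma hyperbolic_dist_eq_iff:
  assumes "x \<in> hyperbolic_space" "y \<in> hyperbolic_space" "x' \<in> hyperbolic_space" "y' \<in> hyperbolic_space"
  shows "hyperbolic_dist x y = hyperbolic_dist x' y' \<longleftrightarrow> cosh_dist x y = cosh_dist x' y'"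
proof -
  have "1 \<le> cosh_dist x y" "1 \<le> cosh_dist x' y'"
    using assms by (auto simp: hyperbolic_space_def cosh_dist_ge_1)
  note inv = this[THEN cosh_arcosh_real]
  show ?thesis
    unfolding hyperbolic_dist_eq
  proof
    assume "arcosh (cosh_dist x y) = arcosh (cosh_dist x' y')"
    then have "cosh (arcosh (cosh_dist x y)) = cosh (arcosh (cosh_dist x' y'))" by (rule arg_cong)
    then show "cosh_dist x y = cosh_dist x' y'" unfolding inv .
  next
    assume "cosh_dist x y = cosh_dist x' y'"
    then show "arcosh (cosh_dist x y) = arcosh (cosh_dist x' y')" by (rule arg_cong)
  qed
qed

lemma carrier_Isom_plusD:
  assumes "g \<in> carrier (Isom_plus :: (real^'n::finite \<Rightarrow> real^'n) monoid)"
  shows "x \<in> hyperbolic_space \<Longrightarrow> g x \<in> hyperbolic_space" "g \<in> extensional hyperbolic_space"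
    "x \<in> hyperbolic_space \<Longrightarrow> y \<in> hyperbolic_space \<Longrightarrow> cosh_dist (g x) (g y) = cosh_dist x y"
proof -
  have bij: "bij_betw g hyperbolic_space hyperbolic_space" and ext: "g \<in> extensional hyperbolic_space"
    and iso: "\<And>x y. x \<in> hyperbolic_space \<Longrightarrow> y \<in> hyperbolic_space \<Longrightarrow>
      hyperbolic_dist (g x) (g y) = hyperbolic_dist x y"
    using assms by (auto simp: Isom_plus_def hyperbolic_isometries_def Bij_def)
  have gin: "x \<in> hyperbolic_space \<Longrightarrow> g x \<in> hyperbolic_space" for x using bij by (auto simp: bij_betw_def)
  then show "x \<in> hyperbolic_space \<Longrightarrow> g x \<in> hyperbolic_space" by blast
  show "g \<in> extensional hyperbolic_space" by fact
  show "x \<in> hyperbolic_space \<Longrightarrow> y \<in> hyperbolic_space \<Longrightarrow> cosh_dist (g x) (g y) = cosh_dist x y"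
    using iso[of x y] hyperbolic_dist_eq_iff[of "g x" "g y" x y] gin[of x] gin[of y] by blast
qed

lemma carrier_Isom_plusI:
  fixes f :: "real^'n::finite \<Rightarrow> real^'n"
  assumes f: "\<And>x. x \<in> hyperbolic_space \<Longrightarrow> f x \<in> hyperbolic_space"
    and g: "\<And>x. x \<in> hyperbolic_space \<Longrightarrow> g x \<in> hyperbolic_space"
    and gf: "\<And>x. x \<in> hyperbolic_space \<Longrightarrow> g (f x) = x" and fg: "\<And>x. x \<in> hyperbolic_space \<Longrightarrow> f (g x) = x"
    and iso: "\<And>x y. x \<in> hyperbolic_space \<Longrightarrow> y \<in> hyperbolic_space \<Longrightarrow> cosh_dist (f x) (f y) = cosh_dist x y"
    and der: "\<And>x. x \<in> hyperbolic_space \<Longrightarrow> \<exists>f'. (f has_derivative f') (at x) \<and> 0 < det (matrix f')"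
  shows "restrict f hyperbolic_space \<in> carrier Isom_plus"
proof -
  have "bij_betw f hyperbolic_space hyperbolic_space"
    by (rule bij_betw_byWitness[where f' = g]) (use f g gf fg in auto)
  then have "restrict f hyperbolic_space \<in> Bij hyperbolic_space"
    by (auto simp: Bij_def bij_betw_def inj_on_def)
  moreover have "hyperbolic_dist (f x) (f y) = hyperbolic_dist x y"
    if "x \<in> hyperbolic_space" "y \<in> hyperbolic_space" for x y
    using that iso[of x y] by (simp add: hyperbolic_dist_eq)
  moreover have "orientation_preserving (restrict f hyperbolic_space)"
    by (rule orientation_preserving_cong[of f]) (use der in \<open>auto simp: orientation_preserving_def\<close>)
  ultimately show ?thesis
    by (simp add: Isom_plus_def hyperbolic_isometries_def)
qed

lemma frame_in_Isom_plus:
  fixes Q :: "real^'n::finite^'n"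
  assumes x: "x \<in> hyperbolic_space" and Q: "rotation_matrix Q"
  shows "frame x Q \<in> carrier Isom_plus"
  unfolding frame_def
proof (rule carrier_Isom_plusI[where g = "\<lambda>y. transpose Q *v translation (- x) y"])
  fix y z :: "real^'n" assume y: "y \<in> hyperbolic_space" and z: "z \<in> hyperbolic_space"
  have xb: "x \<in> ball 0 1" "- x \<in> ball 0 1" and Qb: "Q *v y \<in> ball 0 1" "Q *v z \<in> ball 0 1" and yb: "y \<in> ball 0 1"
    using x y z Q by (auto simp: hyperbolic_space_def[symmetric])
  show "translation x (Q *v y) \<in> hyperbolic_space" "transpose Q *v translation (- x) y \<in> hyperbolic_space"
    using x y Q by (simp_all add: translation_in_hyperbolic_space rotation_matrixD(6) del: transpose_matrix_vector)
  show "transpose Q *v translation (- x) (translation x (Q *v y)) = y"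
    using translation_minus_translation[OF xb(1) Qb(1)] by (simp add: rotation_matrixD(3)[OF Q] del: transpose_matrix_vector)
  show "translation x (Q *v (transpose Q *v translation (- x) y)) = y"
    using translation_minus_translation[OF xb(2) yb] by (simp add: rotation_matrixD(4)[OF Q] del: transpose_matrix_vector)
  have "norm (Q *v y - Q *v z) = norm (y - z)"
    using Q rotation_matrixD(1)[of Q "y - z"] by (simp add: matrix_vector_mult_diff_distrib)
  then show "cosh_dist (translation x (Q *v y)) (translation x (Q *v z)) = cosh_dist y z"
    unfolding cosh_dist_translation[OF xb(1) Qb] by (simp add: cosh_dist_def rotation_matrixD(2)[OF Q])
  have "((*v) Q has_derivative (*v) Q) (at y)"
    by (intro bounded_linear_imp_has_derivative matrix_vector_mul_bounded_linear)
  from diff_chain_at[OF this has_derivative_translation[OF xb(1) Qb(1)]]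
  have "((\<lambda>y. translation x (Q *v y)) has_derivative translation_deriv x (Q *v y) \<circ> (*v) Q) (at y)"
    by (simp add: o_def)
  moreover have "0 < det (matrix (translation_deriv x (Q *v y) \<circ> (*v) Q))"
    using det_translation_deriv_pos[OF xb(1) Qb(1)] has_derivative_linear[OF has_derivative_translation[OF xb(1) Qb(1)]]
    by (simp add: matrix_compose det_mul rotation_matrixD(5)[OF Q])
  ultimately show "\<exists>f'. ((\<lambda>y. translation x (Q *v y)) has_derivative f') (at y) \<and> 0 < det (matrix f')" by blast
qed

lemma mult_Isom_plus:
  assumes "g \<in> carrier (Isom_plus :: (real^'n::finite \<Rightarrow> real^'n) monoid)" "h \<in> carrier Isom_plus"
  shows "g \<otimes>\<^bsub>Isom_plus\<^esub> h = compose hyperbolic_space g h"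
  using assms by (auto simp: Isom_plus_def BijGroup_def hyperbolic_isometries_def)

lemma mult_Isom_plus_apply:
  assumes "g \<in> carrier (Isom_plus :: (real^'n::finite \<Rightarrow> real^'n) monoid)" "h \<in> carrier Isom_plus"
    and "y \<in> hyperbolic_space"
  shows "(g \<otimes>\<^bsub>Isom_plus\<^esub> h) y = g (h y)"
  unfolding mult_Isom_plus[OF assms(1,2)] using assms(3) by (rule compose_eq)

lemma frame_apply: "y \<in> hyperbolic_space \<Longrightarrow> frame x Q y = translation x (Q *v y)"
  by (simp add: frame_def)

lemma translation_zero [simp]: "translation x 0 = x" "translation 0 x = x"
  by (simp_all add: translation_def translation_denom_def)

lemma frame_zero: "frame x Q 0 = x"
  by (simp add: frame_def)

text \<open>
  The rotation that remains after translating back. Its columns are twice the images of half the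
  unit vectors, because the unit vectors themselves lie on the boundary of the ball.
\<close>

definition frame_rotation :: "(real^'n::finite \<Rightarrow> real^'n) \<Rightarrow> real^'n^'n" where
  "frame_rotation g = (\<chi> i j. 2 * (translation (- g 0) (g ((1/2) *\<^sub>R axis j 1))) $ i)"

lemma half_axis_in_hyperbolic_space: "(1/2) *\<^sub>R axis j (1::real) \<in> hyperbolic_space"
  by (simp add: mem_hyperbolic_space norm_axis_1)

lemma frame_rotation_frame:
  fixes Q :: "real^'n::finite^'n"
  assumes x: "x \<in> hyperbolic_space" and Q: "rotation_matrix Q"
  shows "frame_rotation (frame x Q) = Q"
proof -
  have "translation (- x) (frame x Q y) = Q *v y" if "y \<in> hyperbolic_space" for y
    using that x Q translation_minus_translation[of x "Q *v y"]
    by (simp add: frame_def hyperbolic_space_def[symmetric])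
  then have "translation (- x) (frame x Q ((1/2) *\<^sub>R axis j 1)) = (1/2) *\<^sub>R (Q *v axis j 1)" for j
    by (simp only: half_axis_in_hyperbolic_space matrix_vector_mult_scaleR)
  then show ?thesis
    by (simp add: frame_rotation_def frame_zero vec_eq_iff matrix_vector_mul_component inner_axis mult.commute)
qed

text \<open>
  Distance to \<open>0\<close> determines the Euclidean norm, and then the hyperbolic distance determines the
  Euclidean one. So the map preserves inner products, extends from the sphere of radius \<open>1/2\<close> to an
  orthogonal map, and agrees with that map on the whole ball. Its
  determinant is positive since this map is also the derivative at \<open>0\<close>.
\<close>

lemma isometry_fixing_0_is_rotation:
  fixes f :: "real^'n::finite \<Rightarrow> real^'n"
  assumes f: "f \<in> carrier Isom_plus" and f0: "f 0 = 0"
  shows "\<exists>Q. rotation_matrix Q \<and> (\<forall>y\<in>hyperbolic_space. f y = Q *v y)"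
proof -
  note fin = carrier_Isom_plusD(1)[OF f] and iso = carrier_Isom_plusD(3)[OF f]
  have sq: "y \<bullet> y < 1" if "y \<in> hyperbolic_space" for y :: "real^'n"
    using that inner_less_1 by (simp add: hyperbolic_space_def)
  have nrm: "f y \<bullet> f y = y \<bullet> y" if y: "y \<in> hyperbolic_space" for y
  proof -
    have "cosh_dist 0 (f y) = cosh_dist 0 y" using iso[OF _ y, of 0] by (simp add: f0)
    then have "(f y \<bullet> f y) / (1 - f y \<bullet> f y) = (y \<bullet> y) / (1 - y \<bullet> y)"
      by (simp add: cosh_dist_def dot_square_norm)
    then show ?thesis using sq[OF y] sq[OF fin[OF y]] by (simp add: field_simps)
  qed
  have dst: "norm (f y - f z) = norm (y - z)" if y: "y \<in> hyperbolic_space" and z: "z \<in> hyperbolic_space" for y z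
  proof -
    have "cosh_dist (f y) (f z) = cosh_dist y z" by (rule iso[OF y z])
    then have "(norm (f y - f z))\<^sup>2 = (norm (y - z))\<^sup>2"
      using sq[OF y] sq[OF z] by (simp add: cosh_dist_def nrm[OF y] nrm[OF z])
    then show ?thesis by (simp add: power2_eq_iff_nonneg)
  qed
  have inn: "f y \<bullet> f z = y \<bullet> z" if y: "y \<in> hyperbolic_space" and z: "z \<in> hyperbolic_space" for y z
  proof -
    have "(f y - f z) \<bullet> (f y - f z) = (y - z) \<bullet> (y - z)" using dst[OF y z] by (simp add: dot_square_norm)
    then show ?thesis using nrm[OF y] nrm[OF z] by (simp add: inner_diff_left inner_diff_right inner_commute)
  qed
  have half: "(1/2) *\<^sub>R u \<in> hyperbolic_space" if "norm u = 1" for u :: "real^'n"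
    using that by (simp add: mem_hyperbolic_space)
  have "\<exists>h. orthogonal_transformation h \<and> (\<forall>u. norm u = 1 \<longrightarrow> h u = 2 *\<^sub>R f ((1/2) *\<^sub>R u))"
  proof (rule isometry_sphere_extend)
    fix u :: "real^'n" assume u: "norm u = 1"
    have "(2 *\<^sub>R f ((1/2) *\<^sub>R u)) \<bullet> (2 *\<^sub>R f ((1/2) *\<^sub>R u)) = 1"
      using nrm[OF half[OF u]] u norm_eq_1[of u] by simp
    then show "norm (2 *\<^sub>R f ((1/2) *\<^sub>R u)) = 1" by (simp only: norm_eq_1)
    fix v :: "real^'n" assume v: "norm v = 1"
    show "dist (2 *\<^sub>R f ((1/2) *\<^sub>R u)) (2 *\<^sub>R f ((1/2) *\<^sub>R v)) = dist u v"
      using dst[OF half[OF u] half[OF v]]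
      by (simp add: dist_norm flip: scaleR_diff_right)
  qed
  then obtain h where h: "orthogonal_transformation h"
    and hu: "\<forall>u. norm u = 1 \<longrightarrow> h u = 2 *\<^sub>R f ((1/2) *\<^sub>R u)" by (elim exE conjE)
  have lin: "linear h" using h(1) by (rule orthogonal_transformation_linear)
  have fh: "f y = h y" if y: "y \<in> hyperbolic_space" for y
  proof (rule ccontr)
    assume ne: "f y \<noteq> h y"
    obtain w where w: "h w = f y - h y" using surjD[OF orthogonal_transformation_surj[OF h(1)], of "f y - h y"] by auto
    have w0: "w \<noteq> 0" using w ne lin by (auto simp: linear_0)
    define u where "u = w /\<^sub>R norm w"
    have u: "norm u = 1" using w0 by (simp add: u_def)
    have "f y \<bullet> h u = y \<bullet> u" using inn[OF y half[OF u]] by (simp add: hu[rule_format, OF u])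
    moreover have "h y \<bullet> h u = y \<bullet> u" using h(1) by (simp add: orthogonal_transformation_def)
    ultimately have "(f y - h y) \<bullet> h u = 0" by (simp add: inner_diff_left)
    moreover have "h u = (f y - h y) /\<^sub>R norm w" using lin w by (simp add: u_def linear_scale)
    ultimately show False using ne w0 by simp
  qed
  obtain f' where f': "(f has_derivative f') (at 0)" "0 < det (matrix f')"
  proof -
    have "orientation_preserving f" using f by (simp add: Isom_plus_def)
    from this[unfolded orientation_preserving_def, rule_format, OF zero_in_hyperbolic_space] that
    show ?thesis by blast
  qed
  have "(h has_derivative h) (at 0)"
    using lin by (intro bounded_linear_imp_has_derivative) (simp add: linear_conv_bounded_linear)
  then have "(f has_derivative h) (at 0)"
    by (rule has_derivative_transform_within_open[of _ _ _ _ hyperbolic_space])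
       (use fh in \<open>auto simp: hyperbolic_space_def\<close>)
  then have "f' = h" by (rule has_derivative_unique[OF f'(1)])
  then have "0 < det (matrix h)" using f' by simp
  moreover have "orthogonal_matrix (matrix h)" using h(1) by (simp add: orthogonal_transformation_matrix)
  ultimately have "rotation_matrix (matrix h)"
    unfolding rotation_matrix_def using det_orthogonal_matrix[of "matrix h"] by auto
  moreover have "f y = matrix h *v y" if "y \<in> hyperbolic_space" for y
    unfolding fh[OF that] using lin by simp
  ultimately show ?thesis by (intro exI[of _ "matrix h"] conjI ballI)
qed

lemma frame_decomposition:
  fixes g :: "real^'n::finite \<Rightarrow> real^'n"
  assumes g: "g \<in> carrier Isom_plus"
  shows "g 0 \<in> hyperbolic_space" "rotation_matrix (frame_rotation g)" "frame (g 0) (frame_rotation g) = g"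
proof -
  interpret G: group "Isom_plus :: (real^'n \<Rightarrow> real^'n) monoid" by (rule group_Isom_plus)
  show g0: "g 0 \<in> hyperbolic_space" using carrier_Isom_plusD(1)[OF g] by simp
  have mg0: "- g 0 \<in> hyperbolic_space" using g0 by simp
  let ?t = "frame (- g 0) (mat 1)"
  have t: "?t \<in> carrier Isom_plus" by (rule frame_in_Isom_plus[OF mg0 rotation_matrix_mat])
  have cancel: "translation (g 0) (translation (- g 0) y) = y" "translation (- g 0) (translation (g 0) y) = y"
    if "y \<in> hyperbolic_space" for y
    using translation_minus_translation[of "- g 0" y] translation_minus_translation[of "g 0" y] that g0
    by (simp_all add: hyperbolic_space_def)
  have f: "?t \<otimes>\<^bsub>Isom_plus\<^esub> g \<in> carrier Isom_plus" using t g by simp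
  have fy: "(?t \<otimes>\<^bsub>Isom_plus\<^esub> g) y = translation (- g 0) (g y)" if "y \<in> hyperbolic_space" for y
    using that by (simp add: mult_Isom_plus_apply[OF t g] frame_apply carrier_Isom_plusD(1)[OF g])
  have "(?t \<otimes>\<^bsub>Isom_plus\<^esub> g) 0 = 0" using cancel(2)[of 0] by (simp add: fy)
  from isometry_fixing_0_is_rotation[OF f this]
  obtain Q where Q: "rotation_matrix Q"
    and fQ: "\<forall>y\<in>hyperbolic_space. (?t \<otimes>\<^bsub>Isom_plus\<^esub> g) y = Q *v y" by blast
  have tg: "translation (- g 0) (g y) = Q *v y" if "y \<in> hyperbolic_space" for y
    using fy[OF that] fQ that by simp
  have eq: "g = frame (g 0) Q"
  proof
    fix y
    show "g y = frame (g 0) Q y"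
    proof (cases "y \<in> hyperbolic_space")
      case True
      then show ?thesis using cancel(1)[OF carrier_Isom_plusD(1)[OF g True]] tg[OF True] by (simp add: frame_apply True)
    next
      case False
      then show ?thesis using carrier_Isom_plusD(2)[OF g] by (simp add: frame_def extensional_def)
    qed
  qed
  have R: "frame_rotation g = Q"
    by (subst eq) (rule frame_rotation_frame[OF g0 Q])
  show "rotation_matrix (frame_rotation g)" "frame (g 0) (frame_rotation g) = g"
    using Q eq by (simp_all add: R)
qed

text \<open>
  Left multiplication acts on framed points by moving the point and multiplying all frames over it by
  the same rotation. Hence averaging over the frames is an invariant operation.
\<close>

lemma mult_frame:
  fixes g :: "real^'n::finite \<Rightarrow> real^'n"
  assumes g: "g \<in> carrier Isom_plus" and x: "x \<in> hyperbolic_space"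
  shows "\<exists>R. rotation_matrix R \<and> (\<forall>Q. rotation_matrix Q \<longrightarrow> g \<otimes>\<^bsub>Isom_plus\<^esub> frame x Q = frame (g x) (R ** Q))"
proof -
  interpret G: group "Isom_plus :: (real^'n \<Rightarrow> real^'n) monoid" by (rule group_Isom_plus)
  have t: "frame x (mat 1) \<in> carrier Isom_plus" by (rule frame_in_Isom_plus[OF x rotation_matrix_mat])
  let ?h = "g \<otimes>\<^bsub>Isom_plus\<^esub> frame x (mat 1)"
  have h: "?h \<in> carrier Isom_plus" using g t by simp
  have h0: "?h 0 = g x" by (simp add: mult_Isom_plus[OF g t] compose_eq frame_zero)
  have "g \<otimes>\<^bsub>Isom_plus\<^esub> frame x Q = frame (g x) (frame_rotation ?h ** Q)" if Q: "rotation_matrix Q" for Q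
  proof
    fix y
    have xQ: "frame x Q \<in> carrier Isom_plus" by (rule frame_in_Isom_plus[OF x Q])
    show "(g \<otimes>\<^bsub>Isom_plus\<^esub> frame x Q) y = frame (g x) (frame_rotation ?h ** Q) y"
    proof (cases "y \<in> hyperbolic_space")
      case True
      have "(g \<otimes>\<^bsub>Isom_plus\<^esub> frame x Q) y = ?h (Q *v y)"
        using True Q by (simp add: mult_Isom_plus_apply[OF g t] mult_Isom_plus_apply[OF g xQ] frame_apply)
      also have "\<dots> = frame (g x) (frame_rotation ?h) (Q *v y)"
        using frame_decomposition(3)[OF h] by (simp only: h0)
      finally show ?thesis using True Q by (simp add: frame_def matrix_vector_mul_assoc)
    next
      case False
      then show ?thesis unfolding mult_Isom_plus[OF g xQ] by (simp add: frame_def compose_def)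
    qed
  qed
  then show ?thesis
    by (intro exI[of _ "frame_rotation ?h"] conjI allI impI frame_decomposition(2)[OF h])
qed

section \<open>The compact-open topology in coordinates\<close>

abbreviation rotations :: "(real^'n::finite^'n) set" where
  "rotations \<equiv> {Q. rotation_matrix Q}"

lemma continuous_on_matrix_mult [continuous_intros]:
  fixes f g :: "'a::topological_space \<Rightarrow> real^'n::finite^'n"
  assumes "continuous_on S f" "continuous_on S g"
  shows "continuous_on S (\<lambda>x. f x ** g x)"
  unfolding matrix_matrix_mult_def
  by (intro continuous_on_vec_lambda continuous_on_sum continuous_on_mult continuous_on_component assms)

lemma continuous_on_matrix_vector_mult [continuous_intros]:
  fixes f :: "'a::topological_space \<Rightarrow> real^'n::finite^'n"
  assumes "continuous_on S f" "continuous_on S g"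
  shows "continuous_on S (\<lambda>x. f x *v g x)"
  unfolding matrix_vector_mult_def
  by (intro continuous_on_vec_lambda continuous_on_sum continuous_on_mult continuous_on_component assms)

lemma continuous_on_transpose [continuous_intros]:
  fixes f :: "'a::topological_space \<Rightarrow> real^'n::finite^'n"
  assumes "continuous_on S f"
  shows "continuous_on S (\<lambda>x. transpose (f x))"
  unfolding transpose_def
  by (intro continuous_on_vec_lambda continuous_on_component assms)

lemma continuous_on_det [continuous_intros]:
  fixes f :: "'a::topological_space \<Rightarrow> real^'n::finite^'n"
  assumes "continuous_on S f"
  shows "continuous_on S (\<lambda>x. det (f x))"
  unfolding det_def
  by (intro continuous_on_sum continuous_on_mult continuous_on_const continuous_on_prod continuous_on_component assms)

lemma compact_rotations: "compact (rotations :: (real^'n::finite^'n) set)"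
proof -
  have "norm Q \<le> real CARD('n)" if "rotation_matrix Q" for Q :: "real^'n^'n"
  proof -
    have "norm (Q $ i) = 1" for i
    proof -
      have "transpose Q *v axis i 1 = Q $ i"
        by (simp add: matrix_vector_mult_basis row_def vec_eq_iff del: transpose_matrix_vector)
      then show ?thesis
        using rotation_matrixD(1)[OF rotation_matrixD(6)[OF that], of "axis i 1"] by (simp add: norm_axis_1)
    qed
    then have "(\<Sum>i\<in>UNIV. norm (Q $ i)) = real CARD('n)" by simp
    moreover have "norm Q \<le> (\<Sum>i\<in>UNIV. norm (Q $ i))"
      unfolding norm_vec_def by (rule L2_set_le_sum) simp
    ultimately show ?thesis by simp
  qed
  then have "bounded (rotations :: (real^'n^'n) set)" by (auto simp: bounded_iff)
  moreover have "closed (rotations :: (real^'n^'n) set)"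
  proof -
    have "(rotations :: (real^'n^'n) set) =
        {Q. transpose Q ** Q = mat 1} \<inter> {Q. Q ** transpose Q = mat 1} \<inter> {Q. det Q = 1}"
      by (auto simp: rotation_matrix_def orthogonal_matrix_def)
    moreover have "closed {Q :: real^'n^'n. transpose Q ** Q = mat 1}"
      "closed {Q :: real^'n^'n. Q ** transpose Q = mat 1}" "closed {Q :: real^'n^'n. det Q = 1}"
      by (intro closed_Collect_eq continuous_intros)+
    ultimately show ?thesis by (simp add: closed_Int)
  qed
  ultimately show ?thesis by (simp add: compact_eq_bounded_closed)
qed

global_interpretation rot: compact_group "rotations :: (real^'n::finite^'n) set" "(**)" "mat 1" transpose
proof
  show "compact (rotations :: (real^'n^'n) set)" by (rule compact_rotations)
  show "continuous_on (rotations \<times> rotations) (\<lambda>(x :: real^'n^'n, y). x ** y)"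
    unfolding case_prod_unfold by (intro continuous_intros)
  show "continuous_on rotations (transpose :: real^'n^'n \<Rightarrow> real^'n^'n)"
    by (intro continuous_intros)
qed (simp_all add: rotation_matrix_mat rotation_matrix_mult rotation_matrixD(6) matrix_mul_assoc,
    simp_all add: rotation_matrix_def orthogonal_matrix_def)

lemma continuous_on_translation:
  "continuous_on (hyperbolic_space \<times> hyperbolic_space) (\<lambda>(a, x). translation a (x :: real^'n::finite))"
proof -
  have "translation_denom a x \<noteq> 0" if "a \<in> hyperbolic_space" "x \<in> hyperbolic_space" for a x :: "real^'n"
    using translation_denom_pos[of a x] that by (simp add: hyperbolic_space_def)
  then have *: "\<forall>p\<in>hyperbolic_space \<times> hyperbolic_space. translation_denom (fst p) (snd p :: real^'n) \<noteq> 0"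
    by auto
  have "continuous_on (hyperbolic_space \<times> hyperbolic_space) (\<lambda>p. translation_denom (fst p) (snd p :: real^'n))"
    unfolding translation_denom_def by (intro continuous_intros)
  then show ?thesis
    unfolding case_prod_unfold translation_def using * by (intro continuous_intros) auto
qed

lemma continuous_on_translation_compose:
  fixes f g :: "'a::topological_space \<Rightarrow> real^'n::finite"
  assumes "continuous_on S f" "continuous_on S g"
    "\<And>s. s \<in> S \<Longrightarrow> f s \<in> hyperbolic_space" "\<And>s. s \<in> S \<Longrightarrow> g s \<in> hyperbolic_space"
  shows "continuous_on S (\<lambda>s. translation (f s) (g s))"
proof -
  have "continuous_on S (\<lambda>s. (\<lambda>(a, x). translation a x) (f s, g s))"
    by (rule continuous_on_compose2[OF continuous_on_translation])
       (use assms in \<open>auto intro!: continuous_intros\<close>)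
  then show ?thesis by simp
qed

text \<open>
  The set of parameters sending a compact set \<open>K\<close> into an open set \<open>U\<close> is open, since its complement is
  the projection along \<open>K\<close> of a closed set.
\<close>

lemma continuous_map_frame:
  "continuous_map (top_of_set (hyperbolic_space \<times> rotations)) Isom_plus_topology
     (\<lambda>(x, Q). frame x (Q :: real^'n::finite^'n))"
  unfolding Isom_plus_topology_def
proof (rule continuous_on_generated_topo)
  let ?S = "(hyperbolic_space :: (real^'n) set) \<times> (rotations :: (real^'n^'n) set)"
  fix W
  assume "W \<in> {{f \<in> carrier (Isom_plus :: (real^'n \<Rightarrow> real^'n) monoid). f ` K \<subseteq> U} | K U.
        compact K \<and> K \<subseteq> hyperbolic_space \<and> open U \<and> U \<subseteq> hyperbolic_space}"
  then obtain K U where W: "W = {f \<in> carrier Isom_plus. f ` K \<subseteq> U}" and K: "compact K" "K \<subseteq> hyperbolic_space"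
    and U: "open (U :: (real^'n) set)" by blast
  define F :: "(real^'n) \<times> ((real^'n) \<times> (real^'n^'n)) \<Rightarrow> real^'n"
    where "F = (\<lambda>p. translation (fst (snd p)) (snd (snd p) *v fst p))"
  have cF: "continuous_on (K \<times> ?S) F"
    unfolding F_def using K by (intro continuous_on_translation_compose continuous_intros) auto
  have "closedin (top_of_set (K \<times> ?S)) (K \<times> ?S \<inter> F -` (- U))"
    by (rule continuous_closedin_preimage[OF cF closed_Compl[OF U]])
  from closedin_compact_projection[OF K(1) this]
  have "closedin (top_of_set ?S) {x. \<exists>y. y \<in> K \<and> (y, x) \<in> K \<times> ?S \<inter> F -` (- U)}" .
  then have "openin (top_of_set ?S) (?S - {x. \<exists>y. y \<in> K \<and> (y, x) \<in> K \<times> ?S \<inter> F -` (- U)})"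
    by (intro openin_diff) auto
  moreover have "(\<lambda>(x, Q). frame x Q) -` W \<inter> topspace (top_of_set ?S)
      = ?S - {x. \<exists>y. y \<in> K \<and> (y, x) \<in> K \<times> ?S \<inter> F -` (- U)}"
    using K(2) by (auto simp: W F_def frame_in_Isom_plus frame_apply subset_iff)
  ultimately show "openin (top_of_set ?S) ((\<lambda>(x, Q). frame x Q) -` W \<inter> topspace (top_of_set ?S))" by simp
next
  have "\<Union> {{f \<in> carrier (Isom_plus :: (real^'n \<Rightarrow> real^'n) monoid). f ` K \<subseteq> U} | K U.
        compact K \<and> K \<subseteq> hyperbolic_space \<and> open U \<and> U \<subseteq> hyperbolic_space} = carrier Isom_plus"
    using topspace_Isom_plus_topology unfolding Isom_plus_topology_def topology_generated_by_topspace .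
  then show "(\<lambda>(x, Q). frame x Q) ` topspace (top_of_set (hyperbolic_space \<times> rotations))
      \<subseteq> \<Union> {{f \<in> carrier (Isom_plus :: (real^'n \<Rightarrow> real^'n) monoid). f ` K \<subseteq> U} | K U.
        compact K \<and> K \<subseteq> hyperbolic_space \<and> open U \<and> U \<subseteq> hyperbolic_space}"
    by (simp only:) (auto simp: frame_in_Isom_plus)
qed

lemma continuous_map_evaluation:
  fixes y :: "real^'n::finite"
  assumes y: "y \<in> hyperbolic_space"
  shows "continuous_map Isom_plus_topology (top_of_set hyperbolic_space) (\<lambda>g. g y)"
  unfolding continuous_map_in_subtopology
proof
  show "continuous_map Isom_plus_topology euclidean (\<lambda>g. g y)"
    unfolding continuous_map_def
  proof (intro conjI allI impI)
    fix U :: "(real^'n) set" assume "openin euclidean U"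
    then have U: "open U" by simp
    have "{g \<in> topspace Isom_plus_topology. g y \<in> U} =
        {f \<in> carrier Isom_plus. f ` {y} \<subseteq> U \<inter> hyperbolic_space}"
      using carrier_Isom_plusD(1)[OF _ y] by (auto simp: topspace_Isom_plus_topology)
    moreover have "openin Isom_plus_topology {f \<in> carrier Isom_plus. f ` {y} \<subseteq> U \<inter> hyperbolic_space}"
      unfolding Isom_plus_topology_def
      by (rule topology_generated_by_Basis, rule CollectI, rule exI[of _ "{y}"],
          rule exI[of _ "U \<inter> hyperbolic_space"]) (use y U in \<open>auto simp: hyperbolic_space_def\<close>)
    ultimately show "openin Isom_plus_topology {g \<in> topspace Isom_plus_topology. g y \<in> U}" by simp
  qed simp
  show "(\<lambda>g. g y) \<in> topspace Isom_plus_topology \<rightarrow> hyperbolic_space"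
    using carrier_Isom_plusD(1)[OF _ y] by (auto simp: topspace_Isom_plus_topology)
qed

text \<open>
  The inverse of \<open>frame\<close>. Its continuity needs only the evaluation maps at the origin and at half the
  unit vectors.
\<close>

definition coordinates :: "(real^'n::finite \<Rightarrow> real^'n) \<Rightarrow> (real^'n) \<times> (real^'n^'n)" where
  "coordinates g = (g 0, frame_rotation g)"

lemma continuous_map_coordinates:
  "continuous_map Isom_plus_topology (top_of_set (hyperbolic_space \<times> rotations))
     (coordinates :: (real^'n::finite \<Rightarrow> real^'n) \<Rightarrow> _)"
proof -
  let ?H = "hyperbolic_space :: (real^'n) set"
  define E :: "'n \<Rightarrow> (real^'n) \<times> (real^'n) \<Rightarrow> real^'n^'n"
    where "E j p = (\<chi> i k. if k = j then 2 * (translation (- fst p) (snd p)) $ i else 0)" for j p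
  have cE: "continuous_map (top_of_set (?H \<times> ?H)) euclidean (E j)" for j
  proof -
    have "continuous_on (?H \<times> ?H) (\<lambda>p. translation (- fst p) (snd p))"
      by (intro continuous_on_translation_compose continuous_intros) auto
    then have "continuous_on (?H \<times> ?H) (E j)"
      unfolding E_def
      by (intro continuous_on_vec_lambda, rename_tac i k, case_tac "k = j")
         (simp_all add: continuous_on_mult_left continuous_on_component)
    then show ?thesis by simp
  qed
  have ev: "continuous_map Isom_plus_topology (top_of_set (?H \<times> ?H)) (\<lambda>g. (g 0, g ((1/2) *\<^sub>R axis j 1)))" for j
  proof -
    have "continuous_map Isom_plus_topology (prod_topology (top_of_set ?H) (top_of_set ?H))
        (\<lambda>g. (g 0, g ((1/2) *\<^sub>R axis j 1)))"
      by (intro continuous_map_pairedI continuous_map_evaluation half_axis_in_hyperbolic_space zero_in_hyperbolic_space)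
    then show ?thesis by simp
  qed
  have "continuous_map Isom_plus_topology euclidean (\<lambda>g. \<Sum>j\<in>UNIV. E j (g 0, g ((1/2) *\<^sub>R axis j 1)))"
    by (intro continuous_map_sum finite continuous_map_compose[OF ev cE, unfolded o_def])
  moreover have "(\<lambda>g. \<Sum>j\<in>UNIV. E j (g 0, g ((1/2) *\<^sub>R axis j 1))) = frame_rotation"
    by (simp add: fun_eq_iff frame_rotation_def vec_eq_iff E_def if_distrib cong: if_cong)
  ultimately have "continuous_map Isom_plus_topology euclidean (frame_rotation :: (real^'n \<Rightarrow> real^'n) \<Rightarrow> _)"
    by simp
  then have "continuous_map Isom_plus_topology (top_of_set rotations) (frame_rotation :: (real^'n \<Rightarrow> real^'n) \<Rightarrow> _)"
    by (auto simp: continuous_map_in_subtopology topspace_Isom_plus_topology frame_decomposition(2))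
  then have "continuous_map Isom_plus_topology (prod_topology (top_of_set ?H) (top_of_set rotations)) (\<lambda>g. (g 0, frame_rotation g))"
    by (intro continuous_map_pairedI continuous_map_evaluation zero_in_hyperbolic_space)
  then show ?thesis by (simp add: coordinates_def[abs_def])
qed

lemma continuous_on_cochain:
  assumes \<alpha>: "\<alpha> \<in> continuous_cochains G T p"
    and f: "\<And>i. i \<le> p \<Longrightarrow> continuous_map (top_of_set S) T (f i)"
  shows "continuous_on S (\<lambda>s. \<alpha> (\<lambda>i\<in>{..p}. f i s))"
proof -
  have "continuous_map (top_of_set S) (product_topology (\<lambda>_. T) {..p}) (\<lambda>s. \<lambda>i\<in>{..p}. f i s)"
    using f by (subst continuous_map_componentwise) auto
  moreover have "continuous_map (product_topology (\<lambda>_. T) {..p}) euclideanreal \<alpha>"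
    using \<alpha> by (simp add: continuous_cochains_def)
  ultimately have "continuous_map (top_of_set S) euclideanreal (\<alpha> \<circ> (\<lambda>s. \<lambda>i\<in>{..p}. f i s))"
    by (rule continuous_map_compose)
  then show ?thesis by (simp add: o_def)
qed

lemma continuous_map_coordinates_pair:
  fixes F :: "((real^'n::finite) \<times> (real^'n^'n)) \<times> ((real^'n) \<times> (real^'n^'n)) \<Rightarrow> real"
  assumes F: "continuous_on ((hyperbolic_space \<times> rotations) \<times> (hyperbolic_space \<times> rotations)) F"
  shows "continuous_map (product_topology (\<lambda>_. Isom_plus_topology) {..1::nat}) euclideanreal
     (\<lambda>h. F (coordinates (h 0), coordinates (h 1)))"
proof -
  let ?S = "(hyperbolic_space :: (real^'n) set) \<times> (rotations :: (real^'n^'n) set)"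
  let ?P = "product_topology (\<lambda>_. Isom_plus_topology) {..1::nat}"
  have "continuous_map ?P (top_of_set ?S) (\<lambda>h. coordinates (h i))" if "i \<in> {..1}" for i
    using continuous_map_compose[OF continuous_map_product_projection[OF that] continuous_map_coordinates]
    by (simp add: o_def)
  then have "continuous_map ?P (prod_topology (top_of_set ?S) (top_of_set ?S)) (\<lambda>h. (coordinates (h 0), coordinates (h 1)))"
    by (intro continuous_map_pairedI) auto
  then have "continuous_map ?P (top_of_set (?S \<times> ?S)) (\<lambda>h. (coordinates (h 0), coordinates (h 1)))"
    by simp
  moreover have "continuous_map (top_of_set (?S \<times> ?S)) euclideanreal F" using F by simp
  ultimately have "continuous_map ?P euclideanreal (F \<circ> (\<lambda>h. (coordinates (h 0), coordinates (h 1))))"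
    by (rule continuous_map_compose)
  then show ?thesis by (simp add: o_def)
qed

section \<open>Alternating quasi-cocycles on the line\<close>

text \<open>
  The restriction of an alternating invariant quasi-cocycle to a geodesic. Invariance under the
  reflections of the line is essential: without it \<open>f(t - s) + f(r - t) - f(r - s)\<close>, for an arbitrary
  odd \<open>f\<close>, would be an unbounded example.
\<close>

locale line_cochain =
  fixes \<phi> :: "real \<Rightarrow> real \<Rightarrow> real \<Rightarrow> real" and C :: real
  assumes translation_invariant: "\<phi> (s + h) (t + h) (r + h) = \<phi> s t r"
    and reflection_invariant: "\<phi> (- s) (- t) (- r) = \<phi> s t r"
    and swap12: "\<phi> t s r = - \<phi> s t r" and swap23: "\<phi> s r t = - \<phi> s t r"
    and quasi_cocycle: "\<bar>\<phi> t r q - \<phi> s r q + \<phi> s t q - \<phi> s t r\<bar> \<le> C"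
    and locally_bounded: "\<exists>B. \<forall>w\<in>{0..c}. \<bar>\<phi> 0 c w\<bar> \<le> B"
begin

lemma reflection: "\<phi> (m - s) (m - t) (m - r) = \<phi> s t r"
  using translation_invariant[of "- s" m "- t" "- r"] reflection_invariant[of s t r] by simp

lemma odd_about_midpoint: "\<phi> x y (x + y - w) = - \<phi> x y w"
  using reflection[of "x + y" y x w] swap12[of y x w] by simp

text \<open>
  Apply the quasi-cocycle inequality to \<open>x, y, w, w + (y - x)\<close>. The reflection that reverses this
  quadruple pairs its four faces, and the alternating sum of the faces becomes twice the
  difference in question.
\<close>

lemma quasi_period: "\<bar>\<phi> x y (w + (y - x)) - \<phi> x y w\<bar> \<le> C / 2"
proof -
  define v where "v = w + (y - x)"
  have e: "x + v - w = y" "x + v - y = w" "x + v - v = x" "x + v - x = v" by (simp_all add: v_def)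
  have "\<phi> y w v = \<phi> w y x" using reflection[of "x + v" w y x] unfolding e .
  moreover have "\<phi> x w v = \<phi> v y x" using reflection[of "x + v" v y x] unfolding e .
  moreover have "\<phi> w y x = - \<phi> x y w" "\<phi> v y x = - \<phi> x y v"
    using swap12[of y w x] swap23[of y w x] swap12[of x y w] swap12[of y v x] swap23[of y v x] swap12[of x y v] by auto
  ultimately have "\<bar>2 * \<phi> x y v - 2 * \<phi> x y w\<bar> \<le> C"
    using quasi_cocycle[of y w v x] by simp
  then show ?thesis unfolding v_def[symmetric] by linarith
qed

lemma quasi_period_nat: "\<bar>\<phi> x y (w + real k * (y - x)) - \<phi> x y w\<bar> \<le> real k * (C / 2)"
proof (induction k)
  case (Suc k)
  have "\<phi> x y (w + real (Suc k) * (y - x)) = \<phi> x y (w + real k * (y - x) + (y - x))"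
    by (simp add: algebra_simps)
  moreover have "real (Suc k) * (C / 2) = real k * (C / 2) + C / 2" by (simp add: algebra_simps)
  ultimately show ?case
    using Suc quasi_period[of x y "w + real k * (y - x)"] by linarith
qed simp

lemma linear_growth:
  assumes "x < z"
  obtains B where "\<And>v k. \<bar>v - x\<bar> \<le> real k * (z - x) \<Longrightarrow> \<bar>\<phi> x z v\<bar> \<le> B + (real k + 1) * (C / 2)"
proof -
  define c where "c = z - x"
  have c: "0 < c" using assms by (simp add: c_def)
  have C: "0 \<le> C" using quasi_cocycle[of 0 0 0 0] by linarith
  obtain B where B: "\<forall>w\<in>{0..c}. \<bar>\<phi> 0 c w\<bar> \<le> B" using locally_bounded by blast
  have B': "\<bar>\<phi> x z w\<bar> \<le> B" if "x \<le> w" "w \<le> x + c" for w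
    using B translation_invariant[of 0 x c "w - x"] that by (auto simp: c_def)
  have "\<bar>\<phi> x z v\<bar> \<le> B + (real k + 1) * (C / 2)" if v: "\<bar>v - x\<bar> \<le> real k * (z - x)" for v k
  proof -
    define m where "m = \<lfloor>(v - x) / c\<rfloor>"
    have m: "of_int m \<le> (v - x) / c" "(v - x) / c < of_int m + 1" by (simp_all add: m_def)
    have mc: "of_int m * c \<le> v - x" "v - x \<le> of_int m * c + c"
      using m c by (simp_all add: field_simps)
    have "\<bar>(v - x) / c\<bar> \<le> real k" using v c by (simp add: c_def[symmetric] abs_divide pos_divide_le_eq)
    then have mk: "\<bar>of_int m\<bar> \<le> real k + 1" using m by linarith
    define w where "w = v - of_int m * c"
    have w: "x \<le> w" "w \<le> x + c" using mc by (simp_all add: w_def)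
    have "\<bar>\<phi> x z v - \<phi> x z w\<bar> \<le> real (nat \<bar>m\<bar>) * (C / 2)"
    proof (cases "0 \<le> m")
      case True
      then have "v = w + real (nat \<bar>m\<bar>) * (z - x)" by (simp add: w_def c_def)
      then show ?thesis using quasi_period_nat[of x z w "nat \<bar>m\<bar>"] by simp
    next
      case False
      then have "w = v + real (nat \<bar>m\<bar>) * (z - x)" by (simp add: w_def c_def)
      then show ?thesis using quasi_period_nat[of x z v "nat \<bar>m\<bar>"] by (simp add: abs_minus_commute)
    qed
    also have "\<dots> \<le> (real k + 1) * (C / 2)" using mk C by (intro mult_right_mono) auto
    finally show ?thesis using B'[OF w] by linarith
  qed
  then show ?thesis by (rule that)
qed

text \<open>
  Compare \<open>\<phi> x y z\<close> with the other faces of the two tetrahedra with fourth vertex \<open>y + N\<close> and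
  \<open>y - N\<close>. By oddness about the midpoint and quasi-periodicity the faces over \<open>[x, y]\<close> cancel up to
  \<open>C / 2\<close>, and so do those over \<open>[y, z]\<close>; those over \<open>[x, z]\<close> give a difference \<open>g N - g (N + s)\<close>.
  Averaging over \<open>N = 0, s, 2 s, \<dots>\<close> telescopes this difference, and the linear growth of \<open>g\<close> is
  slow enough, because \<open>|s| \<le> z - x\<close>, for the average to stay bounded in terms of \<open>C\<close> alone.
\<close>

lemma bounded_sorted:
  assumes xy: "x \<le> y" and yz: "y \<le> z" and xz: "x < z"
  shows "\<bar>\<phi> x y z\<bar> \<le> 2 * C"
proof -
  have C: "0 \<le> C" using quasi_cocycle[of 0 0 0 0] by linarith
  define s where "s = x + z - 2 * y"
  define g where "g N = \<phi> x z (y + N)" for N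
  have step: "\<bar>2 * \<phi> x y z + (g N - g (N + s))\<bar> \<le> 3 * C" for N
  proof -
    have "\<bar>\<phi> x y (y + N) + \<phi> x y (y - N)\<bar> \<le> C / 2"
      using odd_about_midpoint[of x y "x + N"] quasi_period[of x y "x + N"] by (simp add: algebra_simps)
    moreover have "\<bar>\<phi> y z (y + N) + \<phi> y z (y - N)\<bar> \<le> C / 2"
    proof -
      have e: "y + z - (z + N) = y - N" "y + N + (z - y) = z + N" by simp_all
      show ?thesis
        using odd_about_midpoint[of y z "z + N"] quasi_period[of y z "y + N"] unfolding e by linarith
    qed
    moreover have "\<phi> x z (y - N) = - g (N + s)"
      using odd_about_midpoint[of x z "y + (N + s)"] by (simp add: g_def s_def algebra_simps)
    moreover have "g N = \<phi> x z (y + N)" by (simp add: g_def)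
    ultimately show ?thesis
      using quasi_cocycle[of y z "y + N" x] quasi_cocycle[of y z "y - N" x] by linarith
  qed
  have telescope: "\<bar>real j * (2 * \<phi> x y z) + (g 0 - g (real j * s))\<bar> \<le> real j * (3 * C)" for j
  proof (induction j)
    case (Suc j)
    have "g (real j * s + s) = g (real (Suc j) * s)" by (simp add: algebra_simps)
    with Suc step[of "real j * s"] show ?case by (simp add: algebra_simps)
  qed simp
  obtain B where B: "\<And>v k. \<bar>v - x\<bar> \<le> real k * (z - x) \<Longrightarrow> \<bar>\<phi> x z v\<bar> \<le> B + (real k + 1) * (C / 2)"
    using linear_growth[OF xz] by blast
  have g: "\<bar>g (real j * s)\<bar> \<le> B + (real j + 2) * (C / 2)" for j
  proof -
    have "\<bar>real j * s\<bar> \<le> real j * (z - x)"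
      using xy yz by (simp add: abs_mult mult_left_mono s_def)
    then have "\<bar>y + real j * s - x\<bar> \<le> real (Suc j) * (z - x)"
      using xy yz by (simp add: algebra_simps)
    from B[OF this] show ?thesis by (simp add: g_def algebra_simps)
  qed
  show ?thesis
  proof (rule ccontr)
    assume "\<not> \<bar>\<phi> x y z\<bar> \<le> 2 * C"
    then have pos: "0 < 2 * \<bar>\<phi> x y z\<bar> - 7 / 2 * C" using C by linarith
    obtain j :: nat where j: "2 * B + 2 * C < real j * (2 * \<bar>\<phi> x y z\<bar> - 7 / 2 * C)"
      using reals_Archimedean3[OF pos] by blast
    have "real j * (2 * \<bar>\<phi> x y z\<bar>) = \<bar>real j * (2 * \<phi> x y z)\<bar>" by (simp add: abs_mult)
    also have "\<dots> \<le> real j * (3 * C) + \<bar>g 0\<bar> + \<bar>g (real j * s)\<bar>" using telescope[of j] by linarith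
    also have "\<dots> \<le> real j * (3 * C) + (B + C) + (B + (real j + 2) * (C / 2))"
      using g[of j] g[of 0] by simp
    finally show False using j by (simp add: algebra_simps)
  qed
qed

lemma bounded: "\<bar>\<phi> x y z\<bar> \<le> 2 * C"
proof -
  have C: "0 \<le> C" using quasi_cocycle[of 0 0 0 0] by linarith
  have sorted: "\<bar>\<phi> x y z\<bar> \<le> 2 * C" if "x \<le> y" "y \<le> z" for x y z
  proof (cases "x < z")
    case True
    then show ?thesis by (rule bounded_sorted[OF that])
  next
    case False
    then have "y = x" using that by simp
    then show ?thesis using swap12[of x x z] C by simp
  qed
  consider "x \<le> y \<and> y \<le> z" | "x \<le> z \<and> z \<le> y" | "y \<le> x \<and> x \<le> z" | "y \<le> z \<and> z \<le> x"
    | "z \<le> x \<and> x \<le> y" | "z \<le> y \<and> y \<le> x" by linarith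
  then show ?thesis
  proof cases
    case 1 then show ?thesis using sorted[of x y z] by auto
  next
    case 2 then show ?thesis using sorted[of x z y] swap23[of x y z] by auto
  next
    case 3 then show ?thesis using sorted[of y x z] swap12[of x y z] by auto
  next
    case 4 then show ?thesis using sorted[of y z x] swap12[of x y z] swap23[of y x z] by auto
  next
    case 5 then show ?thesis using sorted[of z x y] swap23[of x y z] swap12[of x z y] by auto
  next
    case 6 then show ?thesis using sorted[of z y x] swap12[of x y z] swap23[of y x z] swap12[of y z x] by auto
  qed
qed

end

section \<open>Alternating quasi-cocycles on hyperbolic space\<close>

text \<open>
  The unit speed geodesic through the origin in direction \<open>u\<close>.
\<close>

definition pt :: "real^'n::finite \<Rightarrow> real \<Rightarrow> real^'n" where
  "pt u t = tanh (t / 2) *\<^sub>R u"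

lemma pt_in_hyperbolic_space [simp]: "norm u = 1 \<Longrightarrow> pt u t \<in> hyperbolic_space"
  using tanh_real_lt_1[of "t / 2"] tanh_real_gt_neg1[of "t / 2"] by (simp add: mem_hyperbolic_space pt_def abs_less_iff)

lemma pt_zero [simp]: "pt u 0 = 0"
  by (simp add: pt_def)

lemma pt_uminus: "pt (- u) t = pt u (- t)"
  by (simp add: pt_def)

lemma rotation_pt: "Q *v pt u t = pt (Q *v u) t"
  by (simp add: pt_def matrix_vector_mult_scaleR)

lemma translation_pt:
  fixes u :: "real^'n::finite"
  assumes u: "norm u = 1"
  shows "translation (pt u s) (pt u t) = pt u (s + t)"
proof -
  define a b where "a = tanh (s / 2)" and "b = tanh (t / 2)"
  have uu: "u \<bullet> u = 1" using u by (simp add: norm_eq_1)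
  have "\<bar>a\<bar> < 1" "\<bar>b\<bar> < 1"
    using tanh_real_lt_1 tanh_real_gt_neg1 by (simp_all add: a_def b_def abs_less_iff)
  then have "\<bar>a * b\<bar> < 1" using abs_mult_less[of a 1 b 1] by (simp add: abs_mult)
  then have ab: "1 + a * b \<noteq> 0" by auto
  have num: "b *\<^sub>R u + ((b *\<^sub>R u) \<bullet> (b *\<^sub>R u)) *\<^sub>R (a *\<^sub>R u) = (b + b * b * a) *\<^sub>R u"
    by (simp add: uu scaleR_add_left)
  have den: "translation_denom (a *\<^sub>R u) (b *\<^sub>R u) = 1 + 2 * (a * b) + a * a * (b * b)"
    by (simp add: translation_denom_def uu)
  have "translation (a *\<^sub>R u) (b *\<^sub>R u) = (a + (1 - a * a) / (1 + 2 * (a * b) + a * a * (b * b)) * (b + b * b * a)) *\<^sub>R u"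
    unfolding translation_def num den by (simp add: uu scaleR_add_left[of a])
  also have "1 + 2 * (a * b) + a * a * (b * b) = (1 + a * b) * (1 + a * b)" by (simp add: algebra_simps)
  also have "b + b * b * a = b * (1 + a * b)" by (simp add: algebra_simps)
  also have "a + (1 - a * a) / ((1 + a * b) * (1 + a * b)) * (b * (1 + a * b)) = (a + b) / (1 + a * b)"
    using ab by (simp add: divide_simps) (simp add: algebra_simps)
  also have "\<dots> = tanh (s / 2 + t / 2)"
    by (simp add: a_def b_def tanh_add)
  finally show ?thesis by (simp add: pt_def a_def b_def add_divide_distrib)
qed

text \<open>
  The hyperbolic law of cosines.
\<close>

lemma cosh_dist_pt:
  fixes u v :: "real^'n::finite"
  assumes u: "norm u = 1" and v: "norm v = 1"
  shows "cosh_dist (pt u a) (pt v b) = cosh a * cosh b - sinh a * sinh b * (u \<bullet> v)"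
proof -
  define p q where "p = u \<bullet> v" and "q = 2 * p"
  define ca sa cb sb where "ca = cosh (a / 2)" and "sa = sinh (a / 2)" and "cb = cosh (b / 2)" and "sb = sinh (b / 2)"
  have uu: "u \<bullet> u = 1" "v \<bullet> v = 1" using u v by (simp_all add: norm_eq_1)
  have ca: "ca\<^sup>2 = 1 + sa\<^sup>2" "cb\<^sup>2 = 1 + sb\<^sup>2" "ca \<noteq> 0" "cb \<noteq> 0"
    using hyperbolic_pythagoras[of "a / 2"] hyperbolic_pythagoras[of "b / 2"]
    by (simp_all add: ca_def sa_def cb_def sb_def)
  have t: "tanh (a / 2) = sa / ca" "tanh (b / 2) = sb / cb" by (simp_all add: tanh_def ca_def sa_def cb_def sb_def)
  have n: "(norm (pt u a - pt v b))\<^sup>2 = (sa / ca)\<^sup>2 + (sb / cb)\<^sup>2 - 2 * (sa / ca) * (sb / cb) * p"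
    unfolding power2_norm_eq_inner pt_def t
    by (simp add: inner_diff_left inner_diff_right uu p_def inner_commute power2_eq_square)
  have d: "1 - pt u a \<bullet> pt u a = 1 / ca\<^sup>2" "1 - pt v b \<bullet> pt v b = 1 / cb\<^sup>2"
  proof -
    have "1 - (sa / ca)\<^sup>2 = (ca\<^sup>2 - sa\<^sup>2) / ca\<^sup>2" "1 - (sb / cb)\<^sup>2 = (cb\<^sup>2 - sb\<^sup>2) / cb\<^sup>2"
      using ca(3,4) by (simp_all add: diff_divide_distrib power_divide)
    then show "1 - pt u a \<bullet> pt u a = 1 / ca\<^sup>2" "1 - pt v b \<bullet> pt v b = 1 / cb\<^sup>2"
      by (simp_all add: pt_def t uu ca(1,2) power2_eq_square[symmetric])
  qed
  have "cosh_dist (pt u a) (pt v b) =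
      1 + 2 * ((sa / ca)\<^sup>2 + (sb / cb)\<^sup>2 - 2 * (sa / ca) * (sb / cb) * p) * ca\<^sup>2 * cb\<^sup>2"
    unfolding cosh_dist_def n d by simp
  also have "\<dots> = 1 + 2 * (sa\<^sup>2 * cb\<^sup>2 + sb\<^sup>2 * ca\<^sup>2) - (2 * sa * ca) * (2 * sb * cb) * p"
    using ca(3,4) by (simp add: power2_eq_square field_simps)
  also have "1 + 2 * (sa\<^sup>2 * cb\<^sup>2 + sb\<^sup>2 * ca\<^sup>2) = (ca\<^sup>2 + sa\<^sup>2) * (cb\<^sup>2 + sb\<^sup>2)"
    unfolding ca(1,2) by (simp add: algebra_simps)
  finally have "cosh_dist (pt u a) (pt v b) = (ca\<^sup>2 + sa\<^sup>2) * (cb\<^sup>2 + sb\<^sup>2) - (2 * sa * ca) * (2 * sb * cb) * p" .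
  moreover have "ca\<^sup>2 + sa\<^sup>2 = cosh a" "cb\<^sup>2 + sb\<^sup>2 = cosh b" "2 * sa * ca = sinh a" "2 * sb * cb = sinh b"
    using cosh_double[of "a / 2"] cosh_double[of "b / 2"] sinh_double[of "a / 2"] sinh_double[of "b / 2"]
    by (simp_all add: ca_def sa_def cb_def sb_def)
  ultimately show ?thesis by (simp only: p_def)
qed

lemma cosh_dist_pt':
  fixes u v :: "real^'n::finite"
  assumes "norm u = 1" "norm v = 1"
  shows "cosh_dist (pt u a) (pt v b) = cosh (a - b) + sinh a * sinh b * (1 - u \<bullet> v)"
  by (simp add: cosh_dist_pt[OF assms] cosh_diff algebra_simps)

lemma cosh_dist_pt_same: "norm u = 1 \<Longrightarrow> cosh_dist (pt u a) (pt u b) = cosh (a - b)"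
  by (simp add: cosh_dist_pt' norm_eq_1)

lemma cosh_dist_0_pt: "norm u = 1 \<Longrightarrow> cosh_dist 0 (pt u b) = cosh b"
  using cosh_dist_pt_same[of u 0 b] by simp

lemma polar_coordinates:
  fixes x :: "real^'n::finite"
  assumes x: "x \<in> hyperbolic_space"
  obtains u t where "norm u = 1" "0 \<le> t" "x = pt u t"
proof (cases "x = 0")
  case True
  then show ?thesis using that[of "axis undefined 1" 0] by (simp add: norm_axis_1)
next
  case False
  have "norm x < 1" using x by (simp add: mem_hyperbolic_space)
  define t where "t = ln ((1 + norm x) / (1 - norm x))"
  have "exp (- t) = (1 - norm x) / (1 + norm x)"
    using \<open>norm x < 1\<close> by (simp add: t_def exp_minus add_pos_nonneg)
  moreover have "1 + norm x \<noteq> 0" using norm_ge_zero[of x] by linarith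
  ultimately have "1 - exp (- t) = 2 * norm x / (1 + norm x)" "1 + exp (- t) = 2 / (1 + norm x)"
    by (simp_all add: field_simps)
  then have th: "tanh (t / 2) = norm x"
    unfolding tanh_real_altdef using \<open>1 + norm x \<noteq> 0\<close> by simp
  have "0 \<le> t"
  proof (rule ccontr)
    assume "\<not> 0 \<le> t"
    then have "tanh (t / 2) < 0" by simp
    then show False by (simp add: th)
  qed
  then show ?thesis using that[of "x /\<^sub>R norm x" t] False by (simp add: pt_def th)
qed

lemma one_minus_inner_le_2: "norm u = 1 \<Longrightarrow> norm v = 1 \<Longrightarrow> 0 \<le> 1 - u \<bullet> v \<and> 1 - u \<bullet> v \<le> 2"
  using Cauchy_Schwarz_ineq2[of u v] by (auto simp: abs_le_iff)

lemma one_minus_inner: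
  assumes "norm u = 1" "norm v = 1" shows "1 - u \<bullet> v = (norm (u - v))\<^sup>2 / 2"
  using assms unfolding power2_norm_eq_inner by (simp add: inner_diff_left inner_diff_right inner_commute norm_eq_1)

lemma rotation_between:
  fixes u v :: "real^'n::finite"
  assumes "2 \<le> CARD('n)" "norm u = 1" "norm v = 1"
  obtains Q where "rotation_matrix Q" "Q *v u = v"
proof -
  obtain f where f: "orthogonal_transformation f" "det (matrix f) = 1" "f u = v"
    using rotation_exists[of u v] assms by auto
  have "rotation_matrix (matrix f)"
    using f by (simp add: rotation_matrix_def orthogonal_transformation_matrix)
  moreover have "matrix f *v u = v" using f orthogonal_transformation_linear[OF f(1)] by simp
  ultimately show ?thesis by (rule that)
qed

text \<open>
  The geodesic can be reversed by an orientation preserving isometry, which swaps \<open>0\<close> and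
  \<open>pt u c\<close>: in dimension at least two the reversal of \<open>u\<close> extends to a rotation.
\<close>

lemma half_turn:
  fixes u :: "real^'n::finite"
  assumes dim: "2 \<le> CARD('n)" and u: "norm u = 1"
  obtains g where "g \<in> carrier Isom_plus" "\<And>s. g (pt u s) = pt u (c - s)"
proof -
  have mu: "norm (- u) = 1" using u by simp
  obtain Q where Q: "rotation_matrix Q" "Q *v u = - u" using rotation_between[OF dim u mu] by blast
  have "frame (pt u c) Q \<in> carrier Isom_plus" using u by (intro frame_in_Isom_plus Q) simp
  moreover have "frame (pt u c) Q (pt u s) = pt u (c - s)" for s
    using u by (simp add: frame_apply rotation_pt Q(2) pt_uminus translation_pt)
  ultimately show ?thesis by (rule that)
qed

text \<open>
  Geodesic triangles are thin. Here \<open>b\<close> and \<open>c\<close> are the two sides at a vertex, \<open>p\<close> is one minus the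
  cosine of the angle there, \<open>a\<close> is the opposite side, and \<open>t\<close> is the Gromov product. The points at
  distance \<open>t\<close> from the vertex on the two sides are at distance \<open>d\<close> with
  \<open>cosh d = 1 + (sinh t)\<^sup>2 p\<close>.
\<close>

lemma thin_triangle_estimate:
  fixes b c t p a :: real
  assumes "0 \<le> b" "0 \<le> c" "0 \<le> a" "0 \<le> p" "p \<le> 2"
    and a: "cosh a = cosh (b - c) + sinh b * sinh c * p" and t: "t = (b + c - a) / 2"
  shows "0 \<le> t" "t \<le> b" "t \<le> c" "(sinh t)\<^sup>2 * p \<le> 1 / 2"
proof -
  have bc: "0 \<le> sinh b * sinh c" using assms by simp
  have "cosh (b - c) \<le> cosh a" using bc assms by simp
  then have "\<bar>b - c\<bar> \<le> a"
    using cosh_real_nonneg_le_iff[of "\<bar>b - c\<bar>" a] assms by simp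
  moreover have "cosh a \<le> cosh (b - c) + sinh b * sinh c * 2"
    using a mult_left_mono[OF \<open>p \<le> 2\<close> bc] by simp
  then have "cosh a \<le> cosh (b + c)" by (simp add: cosh_diff cosh_add)
  then have "a \<le> b + c" using cosh_real_nonneg_le_iff[of a "b + c"] assms by simp
  ultimately show tt: "0 \<le> t" "t \<le> b" "t \<le> c" by (auto simp: t abs_le_iff)
  have product: "2 * (sinh x * sinh y) = cosh (x + y) - cosh (x - y)" for x y :: real
    by (simp add: cosh_add cosh_diff)
  have half: "0 \<le> sinh t * sinh (d - t) / sinh d \<and> sinh t * sinh (d - t) / sinh d \<le> 1 / 2" if d: "0 < d" "t \<le> d" for d
  proof -
    have "2 * (sinh t * sinh (d - t)) = cosh d - cosh (d - 2 * t)"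
      using product[of "d - t" t] by (simp add: mult.commute)
    also have "\<dots> \<le> cosh d - 1" using cosh_real_ge_1[of "d - 2 * t"] by simp
    also have "\<dots> \<le> sinh d"
    proof -
      have "cosh d - sinh d = exp (- d)" by (rule cosh_minus_sinh)
      moreover have "exp (- d) \<le> 1" using d by simp
      ultimately show ?thesis by linarith
    qed
    finally have "sinh t * sinh (d - t) \<le> sinh d / 2" by simp
    moreover have "0 < sinh d" using d by simp
    moreover have "0 \<le> sinh t * sinh (d - t)" using tt(1) d by simp
    ultimately show ?thesis by (simp add: field_simps)
  qed
  show "(sinh t)\<^sup>2 * p \<le> 1 / 2"
  proof (cases "b = 0 \<or> c = 0")
    case True
    then have "t = 0" using tt by auto
    then show ?thesis by simp
  next
    case False
    then have b: "0 < b" and c: "0 < c" using assms by auto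
    have "(b - t) + (c - t) = a" by (simp add: t)
    then have "sinh b * sinh c * p = 2 * (sinh (b - t) * sinh (c - t))"
      using a product[of "b - t" "c - t"] by simp
    then have p: "p = 2 * (sinh (b - t) * sinh (c - t)) / (sinh b * sinh c)"
      using b c by (simp add: field_simps)
    have "(sinh t)\<^sup>2 * p = 2 * ((sinh t * sinh (b - t) / sinh b) * (sinh t * sinh (c - t) / sinh c))"
      unfolding p by (simp add: power2_eq_square)
    also have "\<dots> \<le> 2 * ((1 / 2) * (1 / 2))"
      using half[OF b tt(2)] half[OF c tt(3)] by (intro mult_left_mono mult_mono) auto
    finally show ?thesis by simp
  qed
qed

locale invariant_quasi_cocycle =
  fixes A :: "real^'n::finite \<Rightarrow> real^'n \<Rightarrow> real^'n \<Rightarrow> real" and C :: real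
  assumes dim: "2 \<le> CARD('n)"
    and invariant: "g \<in> carrier Isom_plus \<Longrightarrow> x \<in> hyperbolic_space \<Longrightarrow> y \<in> hyperbolic_space \<Longrightarrow>
      z \<in> hyperbolic_space \<Longrightarrow> A (g x) (g y) (g z) = A x y z"
    and continuous: "continuous_on (hyperbolic_space \<times> hyperbolic_space \<times> hyperbolic_space) (\<lambda>(x, y, z). A x y z)"
    and quasi_cocycle: "x \<in> hyperbolic_space \<Longrightarrow> y \<in> hyperbolic_space \<Longrightarrow> z \<in> hyperbolic_space \<Longrightarrow>
      w \<in> hyperbolic_space \<Longrightarrow> \<bar>A y z w - A x z w + A x y w - A x y z\<bar> \<le> C"
begin

lemma C_nonneg: "0 \<le> C"
  using quasi_cocycle[of 0 0 0 0] by simp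

lemma invariant_translation:
  assumes "a \<in> hyperbolic_space" "x \<in> hyperbolic_space" "y \<in> hyperbolic_space" "z \<in> hyperbolic_space"
  shows "A (translation a x) (translation a y) (translation a z) = A x y z"
  using invariant[OF frame_in_Isom_plus[OF assms(1) rotation_matrix_mat] assms(2-4)] assms
  by (simp add: frame_apply)

lemma invariant_rotation:
  assumes "rotation_matrix Q" "x \<in> hyperbolic_space" "y \<in> hyperbolic_space" "z \<in> hyperbolic_space"
  shows "A (Q *v x) (Q *v y) (Q *v z) = A x y z"
  using invariant[OF frame_in_Isom_plus[OF zero_in_hyperbolic_space assms(1)] assms(2-4)] assms
  by (simp add: frame_apply)

lemma to_origin:
  assumes x: "x \<in> hyperbolic_space" and y: "y \<in> hyperbolic_space" and z: "z \<in> hyperbolic_space"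
  obtains y' z' where "y' \<in> hyperbolic_space" "z' \<in> hyperbolic_space" "A x y z = A 0 y' z'"
    "cosh_dist 0 y' = cosh_dist x y" "cosh_dist 0 z' = cosh_dist x z" "cosh_dist y' z' = cosh_dist y z"
proof -
  have b: "- x \<in> ball 0 1" "x \<in> ball 0 1" "y \<in> ball 0 1" "z \<in> ball 0 1" and m: "- x \<in> hyperbolic_space"
    using x y z by (simp_all add: hyperbolic_space_def)
  have 0: "translation (- x) x = 0" using translation_minus_translation[OF b(2), of 0] by simp
  show ?thesis
  proof (rule that[of "translation (- x) y" "translation (- x) z"])
    show "A x y z = A 0 (translation (- x) y) (translation (- x) z)"
      using invariant_translation[OF m x y z] by (simp add: 0)
  qed (use cosh_dist_translation[OF b(1)] b m y z translation_in_hyperbolic_space 0 in metis)+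
qed

text \<open>
  Move \<open>x\<close> to the origin; then \<open>y\<close> and \<open>z\<close> lie in a compact ball, where \<open>A\<close> is bounded by continuity.
\<close>

lemma bounded_small_triangles:
  "\<exists>B. \<forall>x\<in>hyperbolic_space. \<forall>y\<in>hyperbolic_space. \<forall>z\<in>hyperbolic_space.
     cosh_dist x y \<le> L \<longrightarrow> cosh_dist x z \<le> L \<longrightarrow> \<bar>A x y z\<bar> \<le> B"
proof -
  define L' where "L' = max L 1"
  define \<rho> where "\<rho> = sqrt ((L' - 1) / (L' + 1))"
  have L': "1 \<le> L'" "L \<le> L'" by (simp_all add: L'_def)
  then have \<rho>: "\<rho> < 1" unfolding \<rho>_def by (simp add: real_sqrt_lt_1_iff)
  let ?K = "{0 :: real^'n} \<times> cball (0 :: real^'n) \<rho> \<times> cball (0 :: real^'n) \<rho>"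
  have "?K \<subseteq> hyperbolic_space \<times> hyperbolic_space \<times> hyperbolic_space"
    using \<rho> by (auto simp: mem_hyperbolic_space)
  then have "continuous_on ?K (\<lambda>(x, y, z). A x y z)" using continuous continuous_on_subset by blast
  moreover have "compact ?K" by (intro compact_Times compact_cball) auto
  ultimately have "bounded ((\<lambda>(x, y, z). A x y z) ` ?K)"
    using compact_continuous_image compact_imp_bounded by blast
  then obtain B where B: "\<And>y z. y \<in> cball 0 \<rho> \<Longrightarrow> z \<in> cball 0 \<rho> \<Longrightarrow> \<bar>A 0 y z\<bar> \<le> B"
    by (force simp: bounded_iff)
  have near: "y \<in> cball 0 \<rho>" if y: "y \<in> hyperbolic_space" and "cosh_dist 0 y \<le> L" for y :: "real^'n"
  proof -
    have yy: "y \<bullet> y < 1" using inner_less_1 y by (simp add: hyperbolic_space_def)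
    have "1 + 2 * (y \<bullet> y) / (1 - y \<bullet> y) \<le> L'" using that L' by (simp add: cosh_dist_def dot_square_norm)
    then have "y \<bullet> y \<le> (L' - 1) / (L' + 1)" using yy L' by (simp add: field_simps)
    then have "norm y \<le> \<rho>" unfolding \<rho>_def norm_eq_sqrt_inner by (rule real_sqrt_le_mono)
    then show ?thesis by simp
  qed
  have "\<bar>A x y z\<bar> \<le> B" if xyz: "x \<in> hyperbolic_space" "y \<in> hyperbolic_space" "z \<in> hyperbolic_space"
    and L: "cosh_dist x y \<le> L" "cosh_dist x z \<le> L" for x y z
  proof -
    obtain y' z' where y': "y' \<in> hyperbolic_space" "z' \<in> hyperbolic_space" "A x y z = A 0 y' z'"
      "cosh_dist 0 y' = cosh_dist x y" "cosh_dist 0 z' = cosh_dist x z"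
      using to_origin[OF xyz] by metis
    show ?thesis unfolding y'(3) using near[OF y'(1)] near[OF y'(2)] L y'(4,5) by (intro B) auto
  qed
  then show ?thesis by blast
qed

end

locale alternating_quasi_cocycle = invariant_quasi_cocycle A C
  for A :: "real^'n::finite \<Rightarrow> real^'n \<Rightarrow> real^'n \<Rightarrow> real" and C :: real +
  assumes swap12: "x \<in> hyperbolic_space \<Longrightarrow> y \<in> hyperbolic_space \<Longrightarrow> z \<in> hyperbolic_space \<Longrightarrow> A y x z = - A x y z"
    and swap23: "x \<in> hyperbolic_space \<Longrightarrow> y \<in> hyperbolic_space \<Longrightarrow> z \<in> hyperbolic_space \<Longrightarrow> A x z y = - A x y z"
begin

lemma collinear_bounded:
  assumes u: "norm u = 1"
  shows "\<bar>A (pt u s) (pt u t) (pt u r)\<bar> \<le> 2 * C"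
proof -
  interpret line_cochain "\<lambda>s t r. A (pt u s) (pt u t) (pt u r)" C
  proof
    fix s t r h :: real
    show "A (pt u (s + h)) (pt u (t + h)) (pt u (r + h)) = A (pt u s) (pt u t) (pt u r)"
      using invariant_translation[of "pt u h" "pt u s" "pt u t" "pt u r"] u
      by (simp add: translation_pt add.commute)
    have mu: "norm (- u) = 1" using u by simp
    obtain Q where Q: "rotation_matrix Q" "Q *v u = - u" using rotation_between[OF dim u mu] by blast
    show "A (pt u (- s)) (pt u (- t)) (pt u (- r)) = A (pt u s) (pt u t) (pt u r)"
      using invariant_rotation[OF Q(1), of "pt u s" "pt u t" "pt u r"] u by (simp add: rotation_pt Q(2) pt_uminus)
  next
    fix c :: real
    obtain B where B: "\<forall>x\<in>hyperbolic_space. \<forall>y\<in>hyperbolic_space. \<forall>z\<in>hyperbolic_space.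
     cosh_dist x y \<le> cosh c \<longrightarrow> cosh_dist x z \<le> cosh c \<longrightarrow> \<bar>A x y z\<bar> \<le> B"
      using bounded_small_triangles by blast
    have "\<bar>A (pt u 0) (pt u c) (pt u w)\<bar> \<le> B" if "w \<in> {0..c}" for w
      using B[rule_format, of "pt u 0" "pt u c" "pt u w"] u that
      by (simp add: cosh_dist_0_pt cosh_real_nonneg_le_iff)
    then show "\<exists>B. \<forall>w\<in>{0..c}. \<bar>A (pt u 0) (pt u c) (pt u w)\<bar> \<le> B" by blast
  qed (use u in \<open>auto intro: swap12 swap23 quasi_cocycle\<close>)
  show ?thesis by (rule bounded)
qed

lemma collinear_bounded_0:
  assumes "norm u = 1"
  shows "\<bar>A 0 (pt u t) (pt u r)\<bar> \<le> 2 * C"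
  using collinear_bounded[OF assms, of 0 t r] by simp

text \<open>
  The apex is \<open>0\<close> and the base runs from \<open>pt u a\<close> to \<open>pt v a\<close>; the condition bounds its length. If \<open>Q\<close>
  rotates \<open>u\<close> to \<open>v\<close> and \<open>v\<close> to \<open>v1\<close>, then the triangle over \<open>u, v1\<close> consists of two congruent copies
  of the given one, so \<open>A\<close> doubles up to a bounded error. Its base is at most doubled, which is
  repaired by moving it towards the apex, from radius \<open>a\<close> to the radius \<open>a'\<close> with
  \<open>sinh a' = sinh a / 2\<close>; this step costs a bounded error, as \<open>a - a'\<close> is bounded. The new triangle
  satisfies the same condition, and \<open>2 |A| \<le> |A'| + const\<close> propagates a bound independent of
  \<open>a\<close> by induction on the size of \<open>sinh a\<close>.
\<close>

lemma short_isosceles_bounded: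
  assumes \<kappa>: "0 \<le> \<kappa>"
  shows "\<exists>K. \<forall>u v a. norm u = 1 \<longrightarrow> norm v = 1 \<longrightarrow> 0 \<le> a \<longrightarrow> (sinh a)\<^sup>2 * (1 - u \<bullet> v) \<le> \<kappa> \<longrightarrow>
     \<bar>A 0 (pt u a) (pt v a)\<bar> \<le> K"
proof -
  obtain M where M: "\<forall>x\<in>hyperbolic_space. \<forall>y\<in>hyperbolic_space. \<forall>z\<in>hyperbolic_space.
     cosh_dist x y \<le> 2 + 4 * \<kappa> \<longrightarrow> cosh_dist x z \<le> 2 + 4 * \<kappa> \<longrightarrow> \<bar>A x y z\<bar> \<le> M"
    using bounded_small_triangles by blast
  have M0: "0 \<le> M" using M[rule_format, of 0 0 0] \<kappa> by (simp add: cosh_dist_def)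
  define K where "K = 7 * C + 3 * M"
  have MK: "M \<le> K" using C_nonneg M0 by (simp add: K_def)
  have main: "\<bar>A 0 (pt u a) (pt v a)\<bar> \<le> K"
    if "sinh a \<le> 2 ^ n" "norm u = 1" "norm v = 1" "0 \<le> a" "(sinh a)\<^sup>2 * (1 - u \<bullet> v) \<le> \<kappa>" for n a u v
    using that
  proof (induction n arbitrary: a u v)
    case 0
    have "(cosh a)\<^sup>2 = 1 + (sinh a)\<^sup>2" using hyperbolic_pythagoras[of a] by simp
    also have "\<dots> \<le> 1 + 1\<^sup>2" using 0 by (intro add_left_mono power_mono) auto
    also have "\<dots> \<le> 2\<^sup>2" by simp
    finally have "cosh a \<le> 2" by (rule power2_le_imp_le) simp
    then have "\<bar>A 0 (pt u a) (pt v a)\<bar> \<le> M"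
      using 0 \<kappa> by (intro M[rule_format]) (auto simp: cosh_dist_0_pt)
    with MK show ?case by linarith
  next
    case (Suc n)
    note u = \<open>norm u = 1\<close> and v = \<open>norm v = 1\<close> and a = \<open>0 \<le> a\<close> and \<kappa>' = \<open>(sinh a)\<^sup>2 * (1 - u \<bullet> v) \<le> \<kappa>\<close>
    obtain Q where Q: "rotation_matrix Q" "Q *v u = v" using rotation_between[OF dim u v] by blast
    define v1 where "v1 = Q *v v"
    have v1: "norm v1 = 1" using v Q by (simp add: v1_def rotation_matrixD(1))
    \<comment> \<open>At this radius the base over the doubled angle \<open>u, v1\<close> meets the length condition again.\<close>
    define a' where "a' = arsinh (sinh a / 2)"
    have sa': "sinh a' = sinh a / 2" by (simp add: a'_def)
    have "0 \<le> sinh a'" using a by (simp add: sa')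
    then have a': "0 \<le> a'" by simp
    have uv1: "1 - u \<bullet> v1 \<le> 4 * (1 - u \<bullet> v)"
    proof -
      have "norm (v - v1) = norm (u - v)"
        using rotation_matrixD(1)[OF Q(1), of "u - v"] by (simp add: Q(2) v1_def matrix_vector_mult_diff_distrib)
      then have "norm (u - v1) \<le> 2 * norm (u - v)" using norm_triangle_ineq[of "u - v" "v - v1"] by simp
      then have "(norm (u - v1))\<^sup>2 \<le> (2 * norm (u - v))\<^sup>2" by (intro power_mono) auto
      then show ?thesis using u v v1 by (simp add: one_minus_inner power_mult_distrib)
    qed
    have s1: "(sinh a)\<^sup>2 * (1 - u \<bullet> v1) \<le> 4 * \<kappa>"
    proof -
      have "(sinh a)\<^sup>2 * (1 - u \<bullet> v1) \<le> (sinh a)\<^sup>2 * (4 * (1 - u \<bullet> v))" by (intro mult_left_mono uv1) simp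
      also have "\<dots> = 4 * ((sinh a)\<^sup>2 * (1 - u \<bullet> v))" by (rule mult.left_commute)
      finally show ?thesis using \<kappa>' by linarith
    qed
    have s2: "(sinh a')\<^sup>2 * (1 - u \<bullet> v1) \<le> \<kappa>" using s1 by (simp add: sa' power_divide)
    let ?w = "pt u a" and ?v = "pt v a" and ?x = "pt v1 a" and ?w' = "pt u a'" and ?x' = "pt v1 a'"
    have aa: "cosh (a - a') \<le> 2"
    proof -
      have "0 \<le> sinh a" using a by simp
      then have "sinh a' \<le> sinh a" using sa' by linarith
      then have le: "a' \<le> a" by simp
      define d where "d = a - a'"
      have d: "0 \<le> d" using le by (simp add: d_def)
      have "sinh a = sinh (a' + d)" by (simp add: d_def)
      also have "\<dots> = sinh a' * cosh d + cosh a' * sinh d" by (rule sinh_add)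
      finally have sd: "sinh a = sinh a' * cosh d + cosh a' * sinh d" .
      have "sinh a' * cosh d \<le> 2 * sinh a'" 
      proof -
        have "0 \<le> cosh a' * sinh d" using d by simp
        then show ?thesis using sa' sd by linarith
      qed
      then show ?thesis
      proof (cases "a' = 0")
        case True
        then have "sinh a = 0" using sa' by simp
        then show ?thesis using True by simp
      next
        case False
        then have "0 < sinh a'" using a' by simp
        with \<open>sinh a' * cosh d \<le> 2 * sinh a'\<close> show ?thesis by (simp add: d_def)
      qed
    qed
    have "\<bar>A 0 ?w ?x - 2 * A 0 ?w ?v\<bar> \<le> C + M"
    proof -
      have "A 0 ?v ?x = A 0 ?w ?v"
        using invariant_rotation[OF Q(1), of 0 ?w ?v] u v by (simp add: rotation_pt Q(2) v1_def)
      moreover have "\<bar>A ?w ?v ?x\<bar> \<le> M"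
        using u v v1 \<kappa> \<kappa>' s1 by (intro M[rule_format]) (simp_all add: cosh_dist_pt' power2_eq_square)
      ultimately show ?thesis using quasi_cocycle[of 0 ?w ?v ?x] u v v1 by simp
    qed
    moreover have "\<bar>A 0 ?w ?x - A 0 ?w' ?x\<bar> \<le> 3 * C + M"
    proof -
      have "\<bar>A ?w ?w' ?x\<bar> \<le> M"
        using u v v1 \<kappa> s1 aa by (intro M[rule_format]) (simp_all add: cosh_dist_pt_same, simp add: cosh_dist_pt' power2_eq_square)
      moreover have "\<bar>A 0 ?w ?w'\<bar> \<le> 2 * C" by (rule collinear_bounded_0[OF u])
      ultimately show ?thesis using quasi_cocycle[of 0 ?w ?w' ?x] u v1 by simp
    qed
    moreover have "\<bar>A 0 ?w' ?x - A 0 ?w' ?x'\<bar> \<le> 3 * C + M"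
    proof -
      have "\<bar>A ?x' ?w' ?x\<bar> \<le> M"
      proof (rule M[rule_format])
        show "cosh_dist ?x' ?w' \<le> 2 + 4 * \<kappa>"
          using u v1 \<kappa> s2 by (simp add: cosh_dist_pt' power2_eq_square inner_commute)
        show "cosh_dist ?x' ?x \<le> 2 + 4 * \<kappa>"
        proof -
          have "cosh (a' - a) = cosh (a - a')" by (simp add: abs_minus_commute)
          then show ?thesis unfolding cosh_dist_pt_same[OF v1] using \<kappa> aa by linarith
        qed
      qed (use u v1 in auto)
      moreover have "A ?w' ?x ?x' = A ?x' ?w' ?x"
        using swap12[of ?w' ?x' ?x] swap23[of ?w' ?x ?x'] u v1 by simp
      moreover have "\<bar>A 0 ?x ?x'\<bar> \<le> 2 * C" by (rule collinear_bounded_0[OF v1])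
      ultimately show ?thesis using quasi_cocycle[of 0 ?w' ?x ?x'] u v1 by simp
    qed
    moreover have "\<bar>A 0 ?w' ?x'\<bar> \<le> K"
      using Suc.prems(1) by (intro Suc.IH u v1 a' s2) (simp add: sa')
    ultimately show ?case by (simp add: K_def)
  qed
  have "\<exists>n. sinh a \<le> 2 ^ n" for a :: real
    using real_arch_pow[of 2 "sinh a"] by (auto intro: less_imp_le)
  with main show ?thesis by blast
qed

text \<open>
  Put the vertex opposite to the short side at the origin and cut the longer of the two long sides
  at the length of the shorter one. This leaves an isosceles triangle, a degenerate triangle and
  a small one.
\<close>

lemma short_side_bounded:
  "\<exists>K. \<forall>x\<in>hyperbolic_space. \<forall>y\<in>hyperbolic_space. \<forall>z\<in>hyperbolic_space.
     cosh_dist y z \<le> L \<longrightarrow> \<bar>A x y z\<bar> \<le> K"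
proof -
  define \<kappa> where "\<kappa> = max L 0"
  obtain K where K: "\<And>u v a. norm u = 1 \<Longrightarrow> norm v = 1 \<Longrightarrow> 0 \<le> a \<Longrightarrow> (sinh a)\<^sup>2 * (1 - u \<bullet> v) \<le> \<kappa> \<Longrightarrow>
     \<bar>A 0 (pt u a) (pt v a)\<bar> \<le> K"
    using short_isosceles_bounded[of \<kappa>] by (auto simp: \<kappa>_def)
  obtain M where M: "\<forall>x\<in>hyperbolic_space. \<forall>y\<in>hyperbolic_space. \<forall>z\<in>hyperbolic_space.
     cosh_dist x y \<le> 1 + \<kappa> \<longrightarrow> cosh_dist x z \<le> 1 + \<kappa> \<longrightarrow> \<bar>A x y z\<bar> \<le> M"
    using bounded_small_triangles by blast
  have le: "\<bar>A 0 (pt u a) (pt v b)\<bar> \<le> 3 * C + M + K"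
    if u: "norm u = 1" and v: "norm v = 1" and a: "0 \<le> a" and ab: "a \<le> b" and L: "cosh_dist (pt u a) (pt v b) \<le> L" for u v a b
  proof -
    have uv: "0 \<le> 1 - u \<bullet> v" using one_minus_inner_le_2[OF u v] by simp
    have "(sinh a)\<^sup>2 * (1 - u \<bullet> v) \<le> sinh a * sinh b * (1 - u \<bullet> v)"
      using a ab uv by (intro mult_right_mono) (auto simp: power2_eq_square intro: mult_left_mono)
    also have "\<dots> \<le> \<kappa>" using L cosh_real_pos[of "a - b"] unfolding cosh_dist_pt'[OF u v] \<kappa>_def by linarith
    finally have s: "(sinh a)\<^sup>2 * (1 - u \<bullet> v) \<le> \<kappa>" .
    have "\<bar>A (pt u a) (pt v a) (pt v b)\<bar> \<le> M"
      using u v L s by (intro M[rule_format]) (simp_all add: \<kappa>_def, simp add: cosh_dist_pt' power2_eq_square)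
    moreover have "\<bar>A 0 (pt v a) (pt v b)\<bar> \<le> 2 * C" by (rule collinear_bounded_0[OF v])
    moreover have "\<bar>A 0 (pt u a) (pt v a)\<bar> \<le> K" by (rule K[OF u v a s])
    ultimately show ?thesis using quasi_cocycle[of 0 "pt u a" "pt v a" "pt v b"] u v by simp
  qed
  have "\<bar>A x y z\<bar> \<le> 3 * C + M + K"
    if xyz: "x \<in> hyperbolic_space" "y \<in> hyperbolic_space" "z \<in> hyperbolic_space" and L: "cosh_dist y z \<le> L" for x y z
  proof -
    obtain y' z' where y': "y' \<in> hyperbolic_space" and z': "z' \<in> hyperbolic_space"
      and eq: "A x y z = A 0 y' z'" "cosh_dist y' z' = cosh_dist y z"
      using to_origin[OF xyz] by metis
    obtain u a where u: "norm u = 1" "0 \<le> a" "y' = pt u a" using polar_coordinates[OF y'] by blast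
    obtain v b where v: "norm v = 1" "0 \<le> b" "z' = pt v b" using polar_coordinates[OF z'] by blast
    show ?thesis
    proof (cases "a \<le> b")
      case True
      then show ?thesis using le[OF u(1) v(1) u(2)] eq L u v by simp
    next
      case False
      then have "\<bar>A 0 z' y'\<bar> \<le> 3 * C + M + K"
        using le[OF v(1) u(1) v(2)] eq L u v by (simp add: cosh_dist_commute)
      then show ?thesis using swap23[OF zero_in_hyperbolic_space z' y'] by (simp add: eq(1))
    qed
  qed
  then show ?thesis by blast
qed

text \<open>
  Put one vertex at the origin and let \<open>w\<close> be the point on the side \<open>[0, y]\<close> whose distance \<open>t\<close> from
  \<open>0\<close> is the Gromov product. It cuts the triangle into \<open>0 y w\<close>, which is degenerate, and \<open>0 z w\<close>
  and \<open>y z w\<close>. In \<open>0 z w\<close> the vertex \<open>w\<close> is close to the point at distance \<open>t\<close> on \<open>[0, z]\<close>, so the value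
  of \<open>A\<close> is that of a degenerate triangle up to triangles with a short side. The half turn that
  exchanges \<open>0\<close> and \<open>y\<close> brings \<open>y z w\<close> into the same position, since \<open>c - t\<close> is the Gromov product
  at \<open>y\<close>.
\<close>

theorem bounded:
  "\<exists>K. \<forall>x\<in>hyperbolic_space. \<forall>y\<in>hyperbolic_space. \<forall>z\<in>hyperbolic_space. \<bar>A x y z\<bar> \<le> K"
proof -
  obtain K where K: "\<forall>x\<in>hyperbolic_space. \<forall>y\<in>hyperbolic_space. \<forall>z\<in>hyperbolic_space.
     cosh_dist y z \<le> 3 / 2 \<longrightarrow> \<bar>A x y z\<bar> \<le> K"
    using short_side_bounded by blast
  define K' where "K' = 3 * C + 2 * K"
  have thin: "\<bar>A 0 z (pt u ((b + c - a) / 2))\<bar> \<le> K'"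
    if u: "norm u = 1" and z: "z \<in> hyperbolic_space" and abc: "0 \<le> a" "0 \<le> b" "0 \<le> c"
      and b: "cosh_dist 0 z = cosh b" and a: "cosh_dist (pt u c) z = cosh a" for u z a b c
  proof -
    obtain v b' where v: "norm v = 1" "0 \<le> b'" "z = pt v b'" using polar_coordinates[OF z] by blast
    have "cosh b' = cosh b" using b v by (simp add: cosh_dist_0_pt)
    then have z': "z = pt v b" using abc v by (metis arcosh_cosh_real)
    define t where "t = (b + c - a) / 2"
    have "cosh a = cosh (b - c) + sinh b * sinh c * (1 - u \<bullet> v)"
    proof -
      have "cosh (b - c) = cosh (c - b)" by (simp add: abs_minus_commute)
      then show ?thesis using a cosh_dist_pt'[OF u v(1), of c b] by (simp only: z' mult.commute[of "sinh b"])
    qed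
    note est = thin_triangle_estimate[OF abc(2,3,1) _ _ this t_def]
    have s: "(sinh t)\<^sup>2 * (1 - u \<bullet> v) \<le> 1 / 2" using est(4) one_minus_inner_le_2[OF u v(1)] by simp
    let ?p = "pt v t" and ?w = "pt u t"
    have pw: "cosh_dist ?p ?w \<le> 3 / 2"
      using s by (simp add: cosh_dist_pt'[OF v(1) u] power2_eq_square inner_commute)
    have "\<bar>A z ?p ?w\<bar> \<le> K" "\<bar>A 0 ?p ?w\<bar> \<le> K"
      using K pw z u v(1) by simp_all
    moreover have "\<bar>A 0 z ?p\<bar> \<le> 2 * C" unfolding z' by (rule collinear_bounded_0[OF v(1)])
    ultimately have "\<bar>A 0 z ?w\<bar> \<le> K'"
      using quasi_cocycle[of 0 z ?p ?w] z u v(1) by (simp add: K'_def)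
    then show ?thesis by (simp add: t_def)
  qed
  have "\<bar>A x y z\<bar> \<le> 3 * C + 2 * K'"
    if xyz: "x \<in> hyperbolic_space" "y \<in> hyperbolic_space" "z \<in> hyperbolic_space" for x y z
  proof -
    obtain y' z' where y': "y' \<in> hyperbolic_space" and z': "z' \<in> hyperbolic_space" and eq: "A x y z = A 0 y' z'"
      using to_origin[OF xyz] by metis
    obtain u c where u: "norm u = 1" and c: "0 \<le> c" and yc: "y' = pt u c" using polar_coordinates[OF y'] by blast
    define a b where "a = arcosh (cosh_dist y' z')" and "b = arcosh (cosh_dist 0 z')"
    have ge: "1 \<le> cosh_dist y' z'" "1 \<le> cosh_dist 0 z'"
      using cosh_dist_ge_1 y' z' zero_in_hyperbolic_space unfolding hyperbolic_space_def by blast+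
    have a: "0 \<le> a" "cosh_dist y' z' = cosh a" and b: "0 \<le> b" "cosh_dist 0 z' = cosh b"
      using ge by (simp_all add: a_def b_def)
    define t where "t = (b + c - a) / 2"
    have 1: "\<bar>A 0 z' (pt u t)\<bar> \<le> K'"
      using thin[OF u z' a(1) b(1) c b(2)] a(2) by (simp add: yc t_def)
    have 2: "\<bar>A y' z' (pt u t)\<bar> \<le> K'"
    proof -
      obtain g where g: "g \<in> carrier Isom_plus" and gpt: "\<And>s. g (pt u s) = pt u (c - s)"
        using half_turn[OF dim u] by blast
      have gz: "g z' \<in> hyperbolic_space" by (rule carrier_Isom_plusD(1)[OF g z'])
      have "cosh_dist 0 (g z') = cosh a"
        using carrier_Isom_plusD(3)[OF g y' z'] a(2) gpt[of c] by (simp add: yc)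
      moreover have "cosh_dist (pt u c) (g z') = cosh b"
        using carrier_Isom_plusD(3)[OF g zero_in_hyperbolic_space z'] b(2) gpt[of 0] by simp
      ultimately have "\<bar>A 0 (g z') (pt u ((a + c - b) / 2))\<bar> \<le> K'"
        using thin[OF u gz b(1) a(1) c] by simp
      moreover have "(a + c - b) / 2 = c - t" by (simp add: t_def field_simps)
      moreover have "A y' z' (pt u t) = A 0 (g z') (pt u (c - t))"
        using invariant[OF g y' z', of "pt u t"] u gpt[of c] gpt[of t] by (simp add: yc)
      ultimately show ?thesis by simp
    qed
    have "\<bar>A 0 y' (pt u t)\<bar> \<le> 2 * C" unfolding yc by (rule collinear_bounded_0[OF u])
    with 1 2 show ?thesis unfolding eq using quasi_cocycle[of 0 y' z' "pt u t"] y' z' u by simp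
  qed
  then show ?thesis by blast
qed

end

section \<open>Invariant quasi-cocycles on hyperbolic space\<close>

context invariant_quasi_cocycle
begin

lemma on_diagonal: "x \<in> hyperbolic_space \<Longrightarrow> A x x x = A 0 0 0"
  using invariant_translation[of x 0 0 0] by simp

lemma back_and_forth_symmetric:
  assumes x: "x \<in> hyperbolic_space" and y: "y \<in> hyperbolic_space"
  shows "A x y x = A y x y"
proof -
  have m: "- x \<in> hyperbolic_space" using x by simp
  have 0: "translation (- x) x = 0"
    using translation_minus_translation[of x 0] x by (simp add: hyperbolic_space_def)
  obtain u c where u: "norm u = 1" "translation (- x) y = pt u c"
    using polar_coordinates[OF translation_in_hyperbolic_space[OF m y]] by metis
  have "A x y x = A 0 (pt u c) 0" using invariant_translation[OF m x y x] by (simp add: 0 u(2))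
  moreover have "A y x y = A (pt u c) 0 (pt u c)" using invariant_translation[OF m y x y] by (simp add: 0 u(2))
  moreover obtain g where g: "g \<in> carrier Isom_plus" "\<And>s. g (pt u s) = pt u (c - s)"
    using half_turn[OF dim u(1)] by blast
  have "A 0 (pt u c) 0 = A (pt u c) 0 (pt u c)"
    using invariant[OF g(1), of 0 "pt u c" 0] g(2)[of 0] g(2)[of c] u(1) by simp
  ultimately show ?thesis by simp
qed

text \<open>
  This is \<open>A - d\<gamma>\<close> for the symmetric invariant function \<open>\<gamma> x y = A x y x / 2\<close>, chosen so that the
  result is constant on the triples \<open>(x, y, x)\<close>.
\<close>

definition normalized :: "real^'n \<Rightarrow> real^'n \<Rightarrow> real^'n \<Rightarrow> real" where
  "normalized x y z = A x y z - (A y z y - A x z x + A x y x) / 2"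

lemma normalized_quasi_cocycle:
  assumes "x \<in> hyperbolic_space" "y \<in> hyperbolic_space" "z \<in> hyperbolic_space" "w \<in> hyperbolic_space"
  shows "\<bar>normalized y z w - normalized x z w + normalized x y w - normalized x y z\<bar> \<le> C"
  using quasi_cocycle[OF assms] by (simp add: normalized_def field_simps)

text \<open>
  The quasi-cocycle inequality at \<open>(x, y, x, z)\<close> and \<open>(x, y, z, y)\<close> expresses the two sums, up to
  a bounded error, by values at triples with a repeated entry. For adjacent repeated entries the quasi-cocycle inequality bounds
  those values; for the outer ones the normalization does.
\<close>

lemma normalized_quasi_alternating:
  obtains D where "0 \<le> D"
    "\<And>x y z. x \<in> hyperbolic_space \<Longrightarrow> y \<in> hyperbolic_space \<Longrightarrow> z \<in> hyperbolic_space \<Longrightarrow>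
       \<bar>normalized y x z + normalized x y z\<bar> \<le> D"
    "\<And>x y z. x \<in> hyperbolic_space \<Longrightarrow> y \<in> hyperbolic_space \<Longrightarrow> z \<in> hyperbolic_space \<Longrightarrow>
       \<bar>normalized x z y + normalized x y z\<bar> \<le> D"
proof -
  define e where "e = A 0 0 0 / 2"
  have d: "normalized x x x = e" if "x \<in> hyperbolic_space" for x
    using on_diagonal[OF that] by (simp add: normalized_def e_def)
  have l: "\<bar>normalized x x z\<bar> \<le> \<bar>e\<bar> + C" if "x \<in> hyperbolic_space" "z \<in> hyperbolic_space" for x z
    using normalized_quasi_cocycle[of x x x z] d[of x] that by simp
  have r: "\<bar>normalized x z z\<bar> \<le> \<bar>e\<bar> + C" if "x \<in> hyperbolic_space" "z \<in> hyperbolic_space" for x z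
    using normalized_quasi_cocycle[of x z z z] d[of z] that by simp
  have b: "normalized x y x = e" if "x \<in> hyperbolic_space" "y \<in> hyperbolic_space" for x y
    
  proof -
    define p where "p = A x y x"
    have p: "A x y x = p" "A y x y = p" using back_and_forth_symmetric[OF that] by (simp_all add: p_def)
    show ?thesis unfolding normalized_def e_def p on_diagonal[OF that(1)] by (simp add: field_simps)
  qed
  show ?thesis
  proof (rule that[of "2 * C + 2 * \<bar>e\<bar>"])
    show "0 \<le> 2 * C + 2 * \<bar>e\<bar>" using C_nonneg by simp
    fix x y z :: "real^'n" assume x: "x \<in> hyperbolic_space" "y \<in> hyperbolic_space" "z \<in> hyperbolic_space"
    show "\<bar>normalized y x z + normalized x y z\<bar> \<le> 2 * C + 2 * \<bar>e\<bar>"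
      using normalized_quasi_cocycle[of x y x z] l[of x z] b[of x y] x by linarith
    show "\<bar>normalized x z y + normalized x y z\<bar> \<le> 2 * C + 2 * \<bar>e\<bar>"
      using normalized_quasi_cocycle[of x y z y] r[of x y] b[of y z] x by linarith
  qed
qed

text \<open>
  The alternation of the normalized function is within bounded distance of it, hence still a
  quasi-cocycle, and alternating quasi-cocycles are bounded.
\<close>

theorem normalized_bounded:
  "\<exists>K. \<forall>x\<in>hyperbolic_space. \<forall>y\<in>hyperbolic_space. \<forall>z\<in>hyperbolic_space. \<bar>normalized x y z\<bar> \<le> K"
proof -
  let ?H = "hyperbolic_space :: (real^'n) set"
  obtain D where D: "0 \<le> D"
    and s12: "\<And>x y z. x \<in> ?H \<Longrightarrow> y \<in> ?H \<Longrightarrow> z \<in> ?H \<Longrightarrow> \<bar>normalized y x z + normalized x y z\<bar> \<le> D"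
    and s23: "\<And>x y z. x \<in> ?H \<Longrightarrow> y \<in> ?H \<Longrightarrow> z \<in> ?H \<Longrightarrow> \<bar>normalized x z y + normalized x y z\<bar> \<le> D"
    using normalized_quasi_alternating by blast
  define E where "E x y z = (normalized x y z + normalized y z x + normalized z x y
     - normalized y x z - normalized x z y - normalized z y x) / 6" for x y z
  have near: "\<bar>E x y z - normalized x y z\<bar> \<le> 2 * D" if x: "x \<in> ?H" "y \<in> ?H" "z \<in> ?H" for x y z
    using s12[of x y z] s23[of x y z] s23[of y x z] s12[of x z y] s12[of z y x] s12[of y z x] D x
    unfolding E_def by (simp add: abs_le_iff field_simps)
  have cA: "continuous_on (?H \<times> ?H \<times> ?H) (\<lambda>p. A (f p) (g p) (h p))"
    if "continuous_on (?H \<times> ?H \<times> ?H) f" "continuous_on (?H \<times> ?H \<times> ?H) g" "continuous_on (?H \<times> ?H \<times> ?H) h"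
      "\<And>p. p \<in> ?H \<times> ?H \<times> ?H \<Longrightarrow> f p \<in> ?H" "\<And>p. p \<in> ?H \<times> ?H \<times> ?H \<Longrightarrow> g p \<in> ?H" "\<And>p. p \<in> ?H \<times> ?H \<times> ?H \<Longrightarrow> h p \<in> ?H"
    for f g h :: "(real^'n) \<times> (real^'n) \<times> (real^'n) \<Rightarrow> real^'n"
  proof -
    have "continuous_on (?H \<times> ?H \<times> ?H) (\<lambda>p. (\<lambda>(x, y, z). A x y z) (f p, g p, h p))"
      by (rule continuous_on_compose2[OF continuous]) (use that in \<open>auto intro!: continuous_on_Pair\<close>)
    then show ?thesis by simp
  qed
  interpret E: alternating_quasi_cocycle E "C + 8 * D"
  proof
    fix g :: "real^'n \<Rightarrow> real^'n" and x y z :: "real^'n"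
    assume g: "g \<in> carrier Isom_plus" and x: "x \<in> ?H" "y \<in> ?H" "z \<in> ?H"
    show "E (g x) (g y) (g z) = E x y z"
      unfolding E_def normalized_def by (simp only: invariant[OF g] x)
  next
    show "continuous_on (?H \<times> ?H \<times> ?H) (\<lambda>(x, y, z). E x y z)"
      unfolding E_def normalized_def case_prod_unfold
      by (intro continuous_on_divide continuous_on_diff continuous_on_add continuous_on_const cA
            continuous_on_fst continuous_on_snd continuous_on_id) auto
  next
    fix x y z w :: "real^'n" assume x: "x \<in> ?H" "y \<in> ?H" "z \<in> ?H" "w \<in> ?H"
    show "\<bar>E y z w - E x z w + E x y w - E x y z\<bar> \<le> C + 8 * D"
      using near[OF x(2,3,4)] near[OF x(1,3,4)] near[OF x(1,2,4)] near[OF x(1,2,3)] normalized_quasi_cocycle[OF x]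
      by linarith
  qed (use dim in \<open>simp_all add: E_def field_simps\<close>)
  obtain K where K: "\<forall>x\<in>?H. \<forall>y\<in>?H. \<forall>z\<in>?H. \<bar>E x y z\<bar> \<le> K" using E.bounded by blast
  have "\<bar>normalized x y z\<bar> \<le> K + 2 * D" if "x \<in> ?H" "y \<in> ?H" "z \<in> ?H" for x y z
    using near[OF that] K[rule_format, OF that] by linarith
  then show ?thesis by blast
qed

end

section \<open>From the isometry group to hyperbolic space, and the comparison map\<close>

definition triple :: "'a \<Rightarrow> 'a \<Rightarrow> 'a \<Rightarrow> nat \<Rightarrow> 'a" where
  "triple x y z = (\<lambda>i\<in>{..2}. [x, y, z] ! i)"

definition quadruple :: "'a \<Rightarrow> 'a \<Rightarrow> 'a \<Rightarrow> 'a \<Rightarrow> nat \<Rightarrow> 'a" where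
  "quadruple x y z w = (\<lambda>i\<in>{..3}. [x, y, z, w] ! i)"

lemma atMost_2: "{..2::nat} = {0, 1, 2}" and atMost_3: "{..3::nat} = {0, 1, 2, 3}"
  by auto

lemma triple_in_tuples: "x \<in> carrier G \<Longrightarrow> y \<in> carrier G \<Longrightarrow> z \<in> carrier G \<Longrightarrow> triple x y z \<in> tuples G 2"
  by (auto simp: triple_def tuples_def atMost_2)

lemma quadruple_in_tuples:
  "x \<in> carrier G \<Longrightarrow> y \<in> carrier G \<Longrightarrow> z \<in> carrier G \<Longrightarrow> w \<in> carrier G \<Longrightarrow> quadruple x y z w \<in> tuples G 3"
  by (auto simp: quadruple_def tuples_def atMost_3)

lemma tuples_2_eq_triple: "h \<in> tuples G 2 \<Longrightarrow> h = triple (h 0) (h 1) (h 2)"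
  by (auto simp: triple_def tuples_def atMost_2 PiE_iff extensional_def fun_eq_iff)

lemma diagonal_act_triple:
  "diagonal_act G 2 g (triple x y z) = triple (g \<otimes>\<^bsub>G\<^esub> x) (g \<otimes>\<^bsub>G\<^esub> y) (g \<otimes>\<^bsub>G\<^esub> z)"
  by (auto simp: diagonal_act_def triple_def fun_eq_iff atMost_2)

lemma omit_quadruple:
  "omit 2 0 (quadruple x y z w) = triple y z w" "omit 2 1 (quadruple x y z w) = triple x z w"
  "omit 2 2 (quadruple x y z w) = triple x y w" "omit 2 3 (quadruple x y z w) = triple x y z"
  by (auto simp: omit_def quadruple_def triple_def fun_eq_iff atMost_2)

lemma cobd_quadruple:
  assumes "x \<in> carrier G" "y \<in> carrier G" "z \<in> carrier G" "w \<in> carrier G"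
  shows "cobd G 2 \<beta> (quadruple x y z w) =
    \<beta> (triple y z w) - \<beta> (triple x z w) + \<beta> (triple x y w) - \<beta> (triple x y z)"
proof -
  have "{..Suc 2} = {0, 1, 2, 3::nat}" by auto
  moreover have "quadruple x y z w \<in> tuples G (Suc 2)" using quadruple_in_tuples[OF assms] by (simp add: eval_nat_numeral)
  ultimately show ?thesis
    by (simp add: cobd_def omit_quadruple omit_quadruple(2)[unfolded One_nat_def])
qed

locale bounded_coboundary =
  fixes \<beta> :: "(nat \<Rightarrow> real^'n::finite \<Rightarrow> real^'n) \<Rightarrow> real" and C :: real
  assumes dim: "2 \<le> CARD('n)"
    and cochain: "\<beta> \<in> continuous_cochains Isom_plus Isom_plus_topology 2"
    and cobd_bounded: "h \<in> tuples (Isom_plus :: (real^'n \<Rightarrow> real^'n) monoid) 3 \<Longrightarrow> \<bar>cobd Isom_plus 2 \<beta> h\<bar> \<le> C"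
begin

abbreviation G :: "(real^'n \<Rightarrow> real^'n) monoid" where "G \<equiv> Isom_plus"
abbreviation Hyp :: "(real^'n) set" where "Hyp \<equiv> hyperbolic_space"
abbreviation SO :: "(real^'n^'n) set" where "SO \<equiv> rotations"

sublocale G: group G by (rule group_Isom_plus)

definition b :: "(real^'n \<Rightarrow> real^'n) \<Rightarrow> (real^'n \<Rightarrow> real^'n) \<Rightarrow> (real^'n \<Rightarrow> real^'n) \<Rightarrow> real" where
  "b x y z = \<beta> (triple x y z)"

lemma b_invariant:
  assumes "g \<in> carrier G" "x \<in> carrier G" "y \<in> carrier G" "z \<in> carrier G"
  shows "b (g \<otimes>\<^bsub>G\<^esub> x) (g \<otimes>\<^bsub>G\<^esub> y) (g \<otimes>\<^bsub>G\<^esub> z) = b x y z"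
  using cochain assms triple_in_tuples[OF assms(2-4)]
  unfolding continuous_cochains_def b_def diagonal_act_triple[symmetric] by blast

lemma b_quasi_cocycle:
  assumes "x \<in> carrier G" "y \<in> carrier G" "z \<in> carrier G" "w \<in> carrier G"
  shows "\<bar>b y z w - b x z w + b x y w - b x y z\<bar> \<le> C"
  using cobd_bounded[OF quadruple_in_tuples[OF assms]] unfolding cobd_quadruple[OF assms] b_def .

lemma b_continuous:
  assumes "continuous_map (top_of_set S) Isom_plus_topology f" "continuous_map (top_of_set S) Isom_plus_topology g"
    "continuous_map (top_of_set S) Isom_plus_topology h"
  shows "continuous_on S (\<lambda>s. b (f s) (g s) (h s))"
proof -
  have "continuous_on S (\<lambda>s. \<beta> (\<lambda>i\<in>{..2}. ([f, g, h] ! i) s))"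
    by (rule continuous_on_cochain[OF cochain]) (use assms in \<open>auto simp: le_Suc_eq numeral_2_eq_2\<close>)
  moreover have "(\<lambda>i\<in>{..2}. ([f, g, h] ! i) s) = triple (f s) (g s) (h s)" for s
    by (auto simp: triple_def fun_eq_iff atMost_2)
  ultimately show ?thesis by (simp add: b_def)
qed

lemma frame_continuous:
  assumes "continuous_on S x" "continuous_on S Q" "\<And>s. s \<in> S \<Longrightarrow> x s \<in> Hyp" "\<And>s. s \<in> S \<Longrightarrow> Q s \<in> SO"
  shows "continuous_map (top_of_set S) Isom_plus_topology (\<lambda>s. frame (x s) (Q s))"
proof -
  have "continuous_map (top_of_set S) (top_of_set (Hyp \<times> SO)) (\<lambda>s. (x s, Q s))"
    using assms by (auto simp: continuous_map_in_subtopology intro!: continuous_on_Pair)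
  from continuous_map_compose[OF this continuous_map_frame] show ?thesis by (simp add: o_def)
qed

lemma const_continuous:
  "g \<in> carrier G \<Longrightarrow> continuous_map (top_of_set S) Isom_plus_topology (\<lambda>s. g)"
  by (simp add: topspace_Isom_plus_topology)

text \<open>
  The mean of the cochain over all frames at three points. It descends to hyperbolic space, and it is
  invariant since isometries permute the frames over a point by left multiplication in \<open>SO(n)\<close>.
\<close>

definition average :: "real^'n \<Rightarrow> real^'n \<Rightarrow> real^'n \<Rightarrow> real" where
  "average x y z = rot.mean3 (\<lambda>k l m. b (frame x k) (frame y l) (frame z m))"

lemma average_integrand_continuous:
  assumes "x \<in> Hyp" "y \<in> Hyp" "z \<in> Hyp"
  shows "rot.continuous3 (\<lambda>k l m. b (frame x k) (frame y l) (frame z m))"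
  unfolding rot.continuous3_def
  by (intro b_continuous frame_continuous continuous_intros) (use assms in auto)

lemma average_invariant:
  assumes g: "g \<in> carrier G" and x: "x \<in> Hyp" and y: "y \<in> Hyp" and z: "z \<in> Hyp"
  shows "average (g x) (g y) (g z) = average x y z"
proof -
  obtain R where R: "rotation_matrix R" "\<And>Q. rotation_matrix Q \<Longrightarrow> g \<otimes>\<^bsub>G\<^esub> frame x Q = frame (g x) (R ** Q)"
    using mult_frame[OF g x] by blast
  obtain S where S: "rotation_matrix S" "\<And>Q. rotation_matrix Q \<Longrightarrow> g \<otimes>\<^bsub>G\<^esub> frame y Q = frame (g y) (S ** Q)"
    using mult_frame[OF g y] by blast
  obtain T where T: "rotation_matrix T" "\<And>Q. rotation_matrix Q \<Longrightarrow> g \<otimes>\<^bsub>G\<^esub> frame z Q = frame (g z) (T ** Q)"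
    using mult_frame[OF g z] by blast
  have "average (g x) (g y) (g z)
      = rot.mean3 (\<lambda>k l m. b (frame (g x) (R ** k)) (frame (g y) (S ** l)) (frame (g z) (T ** m)))"
    unfolding average_def
    by (rule rot.mean3_translate[symmetric])
       (use R(1) S(1) T(1) average_integrand_continuous carrier_Isom_plusD(1)[OF g] x y z in auto)
  also have "\<dots> = average x y z"
    unfolding average_def rot.mean3_def rot.mean2_def
  proof (intro rot.mean_cong)
    fix k l m assume "k \<in> SO" "l \<in> SO" "m \<in> SO"
    then show "b (frame (g x) (R ** k)) (frame (g y) (S ** l)) (frame (g z) (T ** m)) = b (frame x k) (frame y l) (frame z m)"
      using R(2)[of k] S(2)[of l] T(2)[of m] b_invariant[OF g, of "frame x k" "frame y l" "frame z m"] x y z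
      by (simp add: frame_in_Isom_plus)
  qed
  finally show ?thesis .
qed

lemma average_continuous: "continuous_on (Hyp \<times> Hyp \<times> Hyp) (\<lambda>(x, y, z). average x y z)"
  unfolding average_def rot.mean3_def rot.mean2_def case_prod_unfold
  by (intro rot.continuous_on_mean b_continuous frame_continuous continuous_intros) auto

text \<open>
  The prism operator for the homotopy between the identity and a change of frames: it sums \<open>b\<close> with signs
  over the two simplices of the prism over the edge \<open>(g, h)\<close>.
\<close>

definition prism :: "(real^'n \<Rightarrow> real^'n) \<Rightarrow> (real^'n \<Rightarrow> real^'n) \<Rightarrow> real^'n^'n \<Rightarrow> real^'n^'n \<Rightarrow> real" where
  "prism g h k l = b g (frame (g 0) k) (frame (h 0) l) - b g h (frame (h 0) l)"

definition homotopy :: "(real^'n \<Rightarrow> real^'n) \<Rightarrow> (real^'n \<Rightarrow> real^'n) \<Rightarrow> real" where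
  "homotopy g h = rot.mean2 (prism g h)"

lemma prism_continuous:
  assumes "g \<in> carrier G" "h \<in> carrier G" "continuous_on S k" "continuous_on S l"
    "\<And>s. s \<in> S \<Longrightarrow> k s \<in> SO" "\<And>s. s \<in> S \<Longrightarrow> l s \<in> SO"
  shows "continuous_on S (\<lambda>s. prism g h (k s) (l s))"
  unfolding prism_def
  by (intro continuous_on_diff b_continuous frame_continuous const_continuous continuous_on_const assms)
     (use assms in \<open>auto simp: carrier_Isom_plusD(1)\<close>)

lemma prism_continuous2:
  assumes "g \<in> carrier G" "h \<in> carrier G"
  shows "rot.continuous2 (prism g h)"
  unfolding rot.continuous2_def
  by (intro prism_continuous assms continuous_intros) auto

lemma mult_apply_0: "g \<in> carrier G \<Longrightarrow> h \<in> carrier G \<Longrightarrow> (g \<otimes>\<^bsub>G\<^esub> h) 0 = g (h 0)"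
  by (rule mult_Isom_plus_apply) auto

lemma homotopy_invariant:
  assumes g: "g \<in> carrier G" and x: "x \<in> carrier G" and y: "y \<in> carrier G"
  shows "homotopy (g \<otimes>\<^bsub>G\<^esub> x) (g \<otimes>\<^bsub>G\<^esub> y) = homotopy x y"
proof -
  have x0: "x 0 \<in> Hyp" and y0: "y 0 \<in> Hyp" using carrier_Isom_plusD(1)[OF x] carrier_Isom_plusD(1)[OF y] by auto
  obtain R where R: "rotation_matrix R" "\<And>Q. rotation_matrix Q \<Longrightarrow> g \<otimes>\<^bsub>G\<^esub> frame (x 0) Q = frame (g (x 0)) (R ** Q)"
    using mult_frame[OF g x0] by blast
  obtain S where S: "rotation_matrix S" "\<And>Q. rotation_matrix Q \<Longrightarrow> g \<otimes>\<^bsub>G\<^esub> frame (y 0) Q = frame (g (y 0)) (S ** Q)"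
    using mult_frame[OF g y0] by blast
  have gx: "g \<otimes>\<^bsub>G\<^esub> x \<in> carrier G" and gy: "g \<otimes>\<^bsub>G\<^esub> y \<in> carrier G" using g x y by simp_all
  have "homotopy (g \<otimes>\<^bsub>G\<^esub> x) (g \<otimes>\<^bsub>G\<^esub> y) = rot.mean2 (\<lambda>k l. prism (g \<otimes>\<^bsub>G\<^esub> x) (g \<otimes>\<^bsub>G\<^esub> y) (R ** k) (S ** l))"
    unfolding homotopy_def
    by (rule rot.mean2_translate[OF prism_continuous2[OF gx gy], symmetric]) (use R(1) S(1) in auto)
  also have "\<dots> = homotopy x y"
    unfolding homotopy_def rot.mean2_def
  proof (intro rot.mean_cong)
    fix k l assume "k \<in> SO" "l \<in> SO"
    then have k: "rotation_matrix k" and l: "rotation_matrix l" by auto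
    have f: "frame (x 0) k \<in> carrier G" "frame (y 0) l \<in> carrier G"
      using frame_in_Isom_plus x0 y0 k l by auto
    show "prism (g \<otimes>\<^bsub>G\<^esub> x) (g \<otimes>\<^bsub>G\<^esub> y) (R ** k) (S ** l) = prism x y k l"
      unfolding prism_def mult_apply_0[OF g x] mult_apply_0[OF g y] R(2)[OF k, symmetric] S(2)[OF l, symmetric]
      by (simp only: b_invariant[OF g x f] b_invariant[OF g x y f(2)])
  qed
  finally show ?thesis .
qed

text \<open>
  Before averaging, the quantity is a signed sum of three values of the coboundary of \<open>b\<close>, one for each of
  the tetrahedra that make up the prism over the triangle \<open>(x, y, z)\<close>; each of them is at most \<open>C\<close>.
\<close>

lemma average_homotopic:
  assumes x: "x \<in> carrier G" and y: "y \<in> carrier G" and z: "z \<in> carrier G"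
  shows "\<bar>b x y z + (homotopy y z - homotopy x z + homotopy x y) - average (x 0) (y 0) (z 0)\<bar> \<le> 3 * C"
proof -
  have in_X: "x 0 \<in> Hyp" "y 0 \<in> Hyp" "z 0 \<in> Hyp"
    using carrier_Isom_plusD(1)[OF x] carrier_Isom_plusD(1)[OF y] carrier_Isom_plusD(1)[OF z] by auto
  define F where "F = (\<lambda>k l m. b (frame (x 0) k) (frame (y 0) l) (frame (z 0) m))"
  have cF: "rot.continuous3 F" unfolding F_def by (rule average_integrand_continuous[OF in_X])
  have cH: "rot.continuous3 (\<lambda>k l m. prism y z l m)" "rot.continuous3 (\<lambda>k l m. prism x z k m)"
    "rot.continuous3 (\<lambda>k l m. prism x y k l)"
    unfolding rot.continuous3_def by (intro prism_continuous assms continuous_intros; auto)+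
  have cm: "rot.continuous3 (\<lambda>k l m. - prism y z l m)" "rot.continuous3 (\<lambda>k l m. - prism x y k l)"
    using cH unfolding rot.continuous3_def by (auto intro: continuous_on_minus)
  have c1: "rot.continuous3 (\<lambda>k l m. F k l m + - prism y z l m)"
    using cF cm(1) unfolding rot.continuous3_def by (rule continuous_on_add)
  have c2: "rot.continuous3 (\<lambda>k l m. F k l m + - prism y z l m + prism x z k m)"
    using c1 cH(2) unfolding rot.continuous3_def by (rule continuous_on_add)
  have c3: "rot.continuous3 (\<lambda>k l m. F k l m + - prism y z l m + prism x z k m + - prism x y k l)"
    using c2 cm(2) unfolding rot.continuous3_def by (rule continuous_on_add)
  have "rot.mean3 (\<lambda>k l m. F k l m + - prism y z l m + prism x z k m + - prism x y k l)
      = average (x 0) (y 0) (z 0) - homotopy y z + homotopy x z - homotopy x y"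
    unfolding rot.mean3_add[OF c2 cm(2)] rot.mean3_add[OF c1 cH(2)] rot.mean3_add[OF cF cm(1)]
      rot.mean3_uminus[OF cH(1)] rot.mean3_uminus[OF cH(3)]
    by (simp add: rot.mean3_mean2 homotopy_def average_def F_def)
  moreover have "\<bar>rot.mean3 (\<lambda>k l m. F k l m + - prism y z l m + prism x z k m + - prism x y k l) - b x y z\<bar> \<le> 3 * C"
  proof (rule rot.mean3_near[OF c3])
    fix k l m assume "k \<in> SO" "l \<in> SO" "m \<in> SO"
    then have f: "frame (x 0) k \<in> carrier G" "frame (y 0) l \<in> carrier G" "frame (z 0) m \<in> carrier G"
      using frame_in_Isom_plus in_X by auto
    show "\<bar>F k l m + - prism y z l m + prism x z k m + - prism x y k l - b x y z\<bar> \<le> 3 * C"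
      using b_quasi_cocycle[OF x f] b_quasi_cocycle[OF x y f(2,3)] b_quasi_cocycle[OF x y z f(3)]
      unfolding F_def prism_def by linarith
  qed
  ultimately show ?thesis by linarith
qed

sublocale average: invariant_quasi_cocycle average "13 * C"
proof
  fix x y z w :: "real^'n" assume x: "x \<in> Hyp" "y \<in> Hyp" "z \<in> Hyp" "w \<in> Hyp"
  have f: "frame x (mat 1) \<in> carrier G" "frame y (mat 1) \<in> carrier G" "frame z (mat 1) \<in> carrier G" "frame w (mat 1) \<in> carrier G"
    using x by (simp_all add: frame_in_Isom_plus rotation_matrix_mat)
  show "\<bar>average y z w - average x z w + average x y w - average x y z\<bar> \<le> 13 * C"
    using average_homotopic[OF f(2,3,4)] average_homotopic[OF f(1,3,4)] average_homotopic[OF f(1,2,4)]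
      average_homotopic[OF f(1,2,3)] b_quasi_cocycle[OF f]
    unfolding frame_zero by linarith
qed (use dim average_invariant average_continuous in auto)

text \<open>
  The coboundary of this function accounts for both reductions: the homotopy to the average over
  frames, and the normalization of the average.
\<close>

definition correction :: "(real^'n \<Rightarrow> real^'n) \<Rightarrow> (real^'n \<Rightarrow> real^'n) \<Rightarrow> real" where
  "correction g h = homotopy g h - average (g 0) (h 0) (g 0) / 2"

lemma corrected_bounded:
  "\<exists>K. \<forall>x\<in>carrier G. \<forall>y\<in>carrier G. \<forall>z\<in>carrier G.
     \<bar>b x y z + (correction y z - correction x z + correction x y)\<bar> \<le> K"
proof -
  obtain K where K: "\<forall>x\<in>Hyp. \<forall>y\<in>Hyp. \<forall>z\<in>Hyp. \<bar>average.normalized x y z\<bar> \<le> K"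
    using average.normalized_bounded by blast
  have "\<bar>b x y z + (correction y z - correction x z + correction x y)\<bar> \<le> K + 3 * C"
    if x: "x \<in> carrier G" "y \<in> carrier G" "z \<in> carrier G" for x y z
  proof -
    have "x 0 \<in> Hyp" "y 0 \<in> Hyp" "z 0 \<in> Hyp"
      using carrier_Isom_plusD(1) x zero_in_hyperbolic_space by blast+
    then have "\<bar>average.normalized (x 0) (y 0) (z 0)\<bar> \<le> K" using K by blast
    then show ?thesis
      using average_homotopic[OF x] unfolding average.normalized_def correction_def
      by (simp add: abs_le_iff field_simps)
  qed
  then show ?thesis by blast
qed

lemma correction_continuous:
  "continuous_on ((Hyp \<times> SO) \<times> (Hyp \<times> SO)) (\<lambda>(p, q). correction (frame (fst p) (snd p)) (frame (fst q) (snd q)))"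
proof -
  have "continuous_on ((Hyp \<times> SO) \<times> (Hyp \<times> SO)) (\<lambda>s. (\<lambda>(x, y, z). average x y z) (fst (fst s), fst (snd s), fst (fst s)))"
    by (rule continuous_on_compose2[OF average_continuous]) (auto intro!: continuous_intros)
  then have "continuous_on ((Hyp \<times> SO) \<times> (Hyp \<times> SO)) (\<lambda>s. average (fst (fst s)) (fst (snd s)) (fst (fst s)))" by simp
  moreover have "continuous_on ((Hyp \<times> SO) \<times> (Hyp \<times> SO)) (\<lambda>s. homotopy (frame (fst (fst s)) (snd (fst s))) (frame (fst (snd s)) (snd (snd s))))"
    unfolding homotopy_def rot.mean2_def prism_def frame_zero
    by (intro rot.continuous_on_mean continuous_on_diff b_continuous frame_continuous continuous_intros) auto
  ultimately show ?thesis
    unfolding correction_def frame_zero case_prod_unfold by (intro continuous_intros) auto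
qed

definition correction_cochain :: "(nat \<Rightarrow> real^'n \<Rightarrow> real^'n) \<Rightarrow> real" where
  "correction_cochain = (\<lambda>h\<in>tuples G 1. correction (h 0) (h 1))"

lemma correction_cochain: "correction_cochain \<in> continuous_cochains G Isom_plus_topology 1"
  unfolding continuous_cochains_def
proof (intro CollectI conjI ballI)
  show "correction_cochain \<in> extensional (tuples G 1)" by (simp add: correction_cochain_def)
  have top: "topspace (product_topology (\<lambda>_. Isom_plus_topology) {..1}) = tuples G 1"
    by (simp add: tuples_def topspace_Isom_plus_topology)
  have "continuous_map (product_topology (\<lambda>_. Isom_plus_topology) {..1::nat}) euclideanreal
      (\<lambda>h. (\<lambda>(p, q). correction (frame (fst p) (snd p)) (frame (fst q) (snd q))) (coordinates (h 0), coordinates (h 1)))"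
    by (rule continuous_map_coordinates_pair[OF correction_continuous])
  then show "continuous_map (product_topology (\<lambda>_. Isom_plus_topology) {..1}) euclideanreal correction_cochain"
  proof (rule continuous_map_eq)
    fix h assume "h \<in> topspace (product_topology (\<lambda>_. Isom_plus_topology :: (real^'n \<Rightarrow> real^'n) topology) {..1::nat})"
    then have h: "h \<in> tuples G 1" by (simp only: top)
    then have "h 0 \<in> carrier G" "h 1 \<in> carrier G" by (auto simp: tuples_def)
    then show "(\<lambda>(p, q). correction (frame (fst p) (snd p)) (frame (fst q) (snd q))) (coordinates (h 0), coordinates (h 1))
        = correction_cochain h"
      using h by (simp add: correction_cochain_def coordinates_def frame_decomposition(3))
  qed
  fix g h assume g: "g \<in> carrier G" and h: "h \<in> tuples G 1"
  then have h01: "h 0 \<in> carrier G" "h 1 \<in> carrier G" by (auto simp: tuples_def)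
  have Hyp: "h 0 0 \<in> Hyp" "h 1 0 \<in> Hyp" using carrier_Isom_plusD(1) h01 zero_in_hyperbolic_space by blast+
  have "correction_cochain (diagonal_act G 1 g h) = correction (g \<otimes>\<^bsub>G\<^esub> h 0) (g \<otimes>\<^bsub>G\<^esub> h 1)"
    using diagonal_act_tuples[OF group_Isom_plus g h] by (simp add: correction_cochain_def diagonal_act_def)
  also have "\<dots> = correction (h 0) (h 1)"
    unfolding correction_def homotopy_invariant[OF g h01] mult_apply_0[OF g h01(1)] mult_apply_0[OF g h01(2)]
    by (simp only: average_invariant[OF g Hyp(1) Hyp(2) Hyp(1)])
  finally show "correction_cochain (diagonal_act G 1 g h) = correction_cochain h"
    using h by (simp add: correction_cochain_def)
qed

theorem cobounded:
  "\<exists>\<gamma>\<in>continuous_cochains G Isom_plus_topology 1. bounded ((\<lambda>h. \<beta> h + cobd G 1 \<gamma> h) ` tuples G 2)"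
proof
  obtain K where K: "\<forall>x\<in>carrier G. \<forall>y\<in>carrier G. \<forall>z\<in>carrier G.
     \<bar>b x y z + (correction y z - correction x z + correction x y)\<bar> \<le> K"
    using corrected_bounded by blast
  have "\<bar>\<beta> h + cobd G 1 correction_cochain h\<bar> \<le> K" if h: "h \<in> tuples G 2" for h
  proof -
    have c: "h 0 \<in> carrier G" "h 1 \<in> carrier G" "h 2 \<in> carrier G" using h by (auto simp: tuples_def)
    have h': "h \<in> tuples G (Suc 1)" using h by (simp add: numeral_2_eq_2)
    have S: "{..Suc 1} = {0, 1, 2::nat}" by auto
    have "cobd G 1 correction_cochain h = correction (h 1) (h 2) - correction (h 0) (h 2) + correction (h 0) (h 1)"
      unfolding cobd_def restrict_apply'[OF h'] S using omit_tuples[OF h']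
      by (simp add: correction_cochain_def omit_def numeral_2_eq_2)
    moreover have "\<beta> h = b (h 0) (h 1) (h 2)" using tuples_2_eq_triple[OF h] by (simp add: b_def)
    ultimately show ?thesis using K c by simp
  qed
  then show "bounded ((\<lambda>h. \<beta> h + cobd G 1 correction_cochain h) ` tuples G 2)" by (auto simp: bounded_iff)
qed (rule correction_cochain)

end

lemma bounded_primitive:
  assumes dim: "2 \<le> CARD('n::finite)"
    and \<alpha>: "\<alpha> \<in> bounded_continuous_cochains (Isom_plus :: (real^'n \<Rightarrow> real^'n) monoid) Isom_plus_topology 3"
    and \<beta>: "\<beta> \<in> continuous_cochains (Isom_plus :: (real^'n \<Rightarrow> real^'n) monoid) Isom_plus_topology 2"
    and \<alpha>\<beta>: "\<alpha> = cobd Isom_plus 2 \<beta>"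
  shows "\<alpha> \<in> cobd Isom_plus 2 ` bounded_continuous_cochains Isom_plus Isom_plus_topology 2"
proof -
  let ?G = "Isom_plus :: (real^'n \<Rightarrow> real^'n) monoid" and ?T = "Isom_plus_topology :: (real^'n \<Rightarrow> real^'n) topology"
  obtain C where C: "\<And>h. h \<in> tuples ?G 3 \<Longrightarrow> \<bar>\<alpha> h\<bar> \<le> C"
    using \<alpha> by (auto simp: bounded_continuous_cochains_def bounded_iff)
  interpret bounded_coboundary \<beta> C
    by unfold_locales (use dim \<beta> C \<alpha>\<beta> in auto)
  obtain \<gamma> where \<gamma>: "\<gamma> \<in> continuous_cochains ?G ?T 1"
    and bd: "bounded ((\<lambda>h. \<beta> h + cobd ?G 1 \<gamma> h) ` tuples ?G 2)"
    using cobounded by blast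
  let ?\<beta>' = "\<lambda>h\<in>tuples ?G 2. \<beta> h + cobd ?G 1 \<gamma> h"
  have sub: "cochain_subcomplex ?G (continuous_cochains ?G ?T)"
    by (rule continuous_cochains_subcomplex[OF group_Isom_plus topspace_Isom_plus_topology])
  have d\<gamma>: "cobd ?G 1 \<gamma> \<in> continuous_cochains ?G ?T 2"
    using cobd_continuous_cochains[OF group_Isom_plus topspace_Isom_plus_topology \<gamma>] by (simp add: numeral_2_eq_2)
  have "?\<beta>' \<in> continuous_cochains ?G ?T 2"
    using sub subgroup.m_closed[of "continuous_cochains ?G ?T 2" "cochain_monoid ?G 2", OF _ \<beta> d\<gamma>]
    by (simp add: cochain_subcomplex_def cochain_monoid_def)
  then have "?\<beta>' \<in> bounded_continuous_cochains ?G ?T 2"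
    using bd by (simp add: bounded_continuous_cochains_def)
  moreover have "cobd ?G 2 ?\<beta>' = \<alpha>"
  proof -
    have e: "Suc 2 = 3" "Suc 1 = 2" "Suc (Suc 1) = 3" by simp_all
    have dd: "cobd ?G 2 (cobd ?G 1 \<gamma>) h = 0" if "h \<in> tuples ?G 3" for h
      using cobd_cobd[of ?G 1 \<gamma>] that unfolding e by (simp add: cochain_monoid_def)
    have "cobd ?G 2 ?\<beta>' h = cobd ?G 2 \<beta> h + cobd ?G 2 (cobd ?G 1 \<gamma>) h" if h: "h \<in> tuples ?G (Suc 2)" for h
      unfolding cobd_def[of ?G 2] restrict_apply'[OF h] sum.distrib[symmetric]
      by (intro sum.cong refl) (simp add: omit_tuples[OF h] distrib_left)
    then have eq: "cobd ?G 2 ?\<beta>' h = cobd ?G 2 \<beta> h" if "h \<in> tuples ?G 3" for h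
      using dd[OF that] that unfolding e by simp
    show ?thesis
      unfolding \<alpha>\<beta>
    proof
      fix h
      show "cobd ?G 2 ?\<beta>' h = cobd ?G 2 \<beta> h"
      proof (cases "h \<in> tuples ?G 3")
        case False
        then show ?thesis unfolding cobd_def e by simp
      qed (rule eq)
    qed
  qed
  ultimately show ?thesis by blast
qed

theorem corollary1p2:
  assumes "2 \<le> CARD('n::finite)"
  shows "inj_on (comparison_map (Isom_plus :: (real ^ 'n \<Rightarrow> real ^ 'n) monoid) Isom_plus_topology 3)
           (carrier (bounded_continuous_cohomology
              (Isom_plus :: (real ^ 'n \<Rightarrow> real ^ 'n) monoid) Isom_plus_topology 3))"
proof (rule inj_onI)
  let ?G = "Isom_plus :: (real^'n \<Rightarrow> real^'n) monoid" and ?T = "Isom_plus_topology :: (real^'n \<Rightarrow> real^'n) topology"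
  let ?M = "cochain_monoid ?G 3"
  let ?Bb = "coboundaries ?G (bounded_continuous_cochains ?G ?T) 3"
  let ?Bc = "coboundaries ?G (continuous_cochains ?G ?T) 3"
  let ?Z = "cocycles ?G (bounded_continuous_cochains ?G ?T) 3"
  interpret comm_group ?M by (rule cochain_monoid_comm_group)
  note G = group_Isom_plus and T = topspace_Isom_plus_topology
  note sc = continuous_cochains_subcomplex[OF G T] and sb = bounded_continuous_cochains_subcomplex[OF G T]
  have representative: "\<exists>\<alpha>\<in>?Z. A = ?Bb #>\<^bsub>?M\<^esub> \<alpha>" if "A \<in> carrier (bounded_continuous_cohomology ?G ?T 3)" for A
    using that by (auto simp: bounded_continuous_cohomology_def cohomology_group_def FactGroup_def RCOSETS_def r_coset_def)
  fix A B
  assume A: "A \<in> carrier (bounded_continuous_cohomology ?G ?T 3)" and B: "B \<in> carrier (bounded_continuous_cohomology ?G ?T 3)"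
    and eq: "comparison_map ?G ?T 3 A = comparison_map ?G ?T 3 B"
  obtain \<alpha> where \<alpha>: "\<alpha> \<in> ?Z" "A = ?Bb #>\<^bsub>?M\<^esub> \<alpha>" using representative[OF A] by blast
  obtain \<beta> where \<beta>: "\<beta> \<in> ?Z" "B = ?Bb #>\<^bsub>?M\<^esub> \<beta>" using representative[OF B] by blast
  note Z = subgroup_cocycles[OF sb, of 3]
  have car: "\<alpha> \<in> carrier ?M" "\<beta> \<in> carrier ?M" using subgroup.mem_carrier[OF Z] \<alpha>(1) \<beta>(1) by auto
  have "?Bc #>\<^bsub>?M\<^esub> \<alpha> = ?Bc #>\<^bsub>?M\<^esub> \<beta>"
    using eq unfolding \<alpha>(2) \<beta>(2) comparison_map_coset[OF G T \<alpha>(1)] comparison_map_coset[OF G T \<beta>(1)] .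
  then have "\<alpha> \<in> ?Bc #>\<^bsub>?M\<^esub> \<beta>"
    using rcos_self[OF car(1) subgroup_coboundaries[OF sc]] by simp
  then obtain c where c: "c \<in> ?Bc" "\<alpha> = c \<otimes>\<^bsub>?M\<^esub> \<beta>" by (auto simp: r_coset_def)
  have cM: "c \<in> carrier ?M" using subgroup.mem_carrier[OF subgroup_coboundaries[OF sc] c(1)] .
  have "c = \<alpha> \<otimes>\<^bsub>?M\<^esub> inv\<^bsub>?M\<^esub> \<beta>" using c(2) car cM by (simp add: m_assoc)
  then have "c \<in> ?Z"
    using subgroup.m_closed[OF Z \<alpha>(1) subgroup.m_inv_closed[OF Z \<beta>(1)]] by simp
  then have "c \<in> bounded_continuous_cochains ?G ?T 3" by (simp add: cocycles_def)
  moreover obtain \<delta> where "\<delta> \<in> continuous_cochains ?G ?T 2" "c = cobd ?G 2 \<delta>"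
    using c(1) by (auto simp: coboundaries_def eval_nat_numeral)
  ultimately have "c \<in> cobd ?G 2 ` bounded_continuous_cochains ?G ?T 2"
    by (intro bounded_primitive[OF assms])
  then have "c \<in> ?Bb" by (simp add: coboundaries_def eval_nat_numeral)
  then have "\<alpha> \<in> ?Bb #>\<^bsub>?M\<^esub> \<beta>" using c(2) by (auto simp: r_coset_def)
  then show "A = B"
    unfolding \<alpha>(2) \<beta>(2) using repr_independence[OF _ car(2) subgroup_coboundaries[OF sb]] by simp
qed

end
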